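(* Let $d, k, n$ be positive integers with $1 \leq k \leq d$. Let $U$ be a matrix chosen randomly with respect to normalized Haar measure from the unitary group $U(d)$, and let $U_k$ be its $k \times k$ upper left corner. Then $$\mathbb{E}_{U(d)}\big(|\operatorname{Tr}(U_k)|^{2n}\big) = \sum_{\lambda \vdash n,\ \ell(\lambda) \leq k} (f^{\lambda})^2\, \frac{s_{\lambda,k}(1)}{s_{\lambda,d}(1)}.$$
   Context: $U(d)$ is the group of $d \times d$ complex unitary matrices, regarded as a probability space under normalized Haar measure $dU$, and $\mathbb{E}_{U(d)}(X) = \int_{U(d)} X\, dU$. The sum runs over all partitions $\lambda$ of $n$ whose number of parts (rows) $\ell(\lambda)$ is at most $k$. $f^{\lambda}$ denotes the number of standard Young tableaux of shape $\lambda$. For a positive integer $r$, $s_{\lambda,r}(1)$ denotes the number of semistandard Young tableaux of shape $\lambda$ with entries from $[r] = \{1, \dots, r\}$; equivalently, it is the value of the Schur function $s_\lambda$ with the first $r$ variables set to $1$ and all remaining variables set to $0$. *)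

theory Defs
  imports "HOL-Probability.Probability"
begin

definition adjoint_matrix :: "complex^'n^'m \<Rightarrow> complex^'m^'n" where
  "adjoint_matrix A = (\<chi> i j. cnj (A $ j $ i))"

definition unitary_matrix :: "complex^'d^'d \<Rightarrow> bool" where
  "unitary_matrix U \<longleftrightarrow>
     adjoint_matrix U ** U = mat 1 \<and> U ** adjoint_matrix U = mat 1"

definition unitary_group :: "(complex^'d^'d) set" where
  "unitary_group = {U. unitary_matrix U}"

text \<open>
  The left-invariant Borel probability measures on the unitary group. Right invariance,
  uniqueness and regularity are consequences (the group is compact and second countable) and
  are not part of the definition.
\<close>

definition normalized_haar_measure :: "(complex^'d^'d) measure \<Rightarrow> bool" where
  "normalized_haar_measure M \<longleftrightarrow>
     prob_space M \<and>
     space M = unitary_group \<and>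
     sets M = sets (restrict_space borel unitary_group) \<and>
     (\<forall>V \<in> unitary_group. \<forall>A \<in> sets M. emeasure M ((\<lambda>U. V ** U) ` A) = emeasure M A)"

text \<open>
  Rows and columns are indexed by a finite linearly ordered type, whose elements in increasing
  order play the role of the indices \<open>1, \<dots>, d\<close>; positions are counted from \<open>0\<close>.
  The corner is meaningful only when \<open>CARD('k) \<le> CARD('d)\<close>.
\<close>

definition index_pos :: "'a::{finite,linorder} \<Rightarrow> nat" where
  "index_pos i = card {j. j < i}"

definition index_at :: "nat \<Rightarrow> 'a::{finite,linorder}" where
  "index_at p = sorted_list_of_set UNIV ! p"

definition upper_left_corner ::
    "complex^'d::{finite,linorder}^'d::{finite,linorder} \<Rightarrow>
     complex^'k::{finite,linorder}^'k::{finite,linorder}" where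
  "upper_left_corner U = (\<chi> i j. U $ index_at (index_pos i) $ index_at (index_pos j))"

lemma index_pos_index_at:
  assumes "p < CARD('a)"
  shows "index_pos (index_at p :: 'a::{finite,linorder}) = p"
proof -
  let ?xs = "sorted_list_of_set (UNIV :: 'a set)"
  have len: "length ?xs = CARD('a)" by simp
  have s: "sorted_wrt (<) ?xs" by simp
  have "{j. j < ?xs ! p} = (!) ?xs ` {..<p}"
  proof (intro equalityI subsetI)
    fix j assume j: "j \<in> {j. j < ?xs ! p}"
    have "j \<in> set ?xs" by simp
    then obtain q where q: "q < length ?xs" "j = ?xs ! q" by (metis in_set_conv_nth)
    have "q < p"
    proof (rule ccontr)
      assume "\<not> q < p"
      then have "?xs ! p \<le> ?xs ! q"
        using q(1) by (intro sorted_nth_mono) auto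
      with j q(2) show False by simp
    qed
    with q(2) show "j \<in> (!) ?xs ` {..<p}" by blast
  next
    fix j assume "j \<in> (!) ?xs ` {..<p}"
    then obtain q where "q < p" "j = ?xs ! q" by blast
    then show "j \<in> {j. j < ?xs ! p}"
      using sorted_wrt_nth_less[OF s, of q p] assms len by simp
  qed
  moreover have "inj_on ((!) ?xs) {..<p}"
    using assms len by (intro inj_on_nth) auto
  ultimately show ?thesis
    by (simp add: index_pos_def index_at_def card_image)
qed

definition partitions :: "nat \<Rightarrow> nat list set" where
  "partitions n = {\<nu>. sorted_wrt (\<ge>) \<nu> \<and> 0 \<notin> set \<nu> \<and> sum_list \<nu> = n}"

lemma finite_partitions: "finite (partitions n)"
proof (rule finite_subset)
  show "partitions n \<subseteq> {xs. set xs \<subseteq> {..n} \<and> length xs \<le> n}"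
  proof
    fix xs assume "xs \<in> partitions n"
    then have xs: "0 \<notin> set xs" "sum_list xs = n" by (auto simp: partitions_def)
    have "length xs \<le> sum_list xs"
      using xs(1) by (induction xs) auto
    moreover have "set xs \<subseteq> {..n}"
      using member_le_sum_list[of _ xs] xs(2) by auto
    ultimately show "xs \<in> {xs. set xs \<subseteq> {..n} \<and> length xs \<le> n}"
      using xs(2) by simp
  qed
  show "finite {xs. set xs \<subseteq> {..n} \<and> length xs \<le> n}"
    by (rule finite_lists_length_le) simp
qed

definition young_diagram :: "nat list \<Rightarrow> (nat \<times> nat) set" where
  "young_diagram \<nu> = {(i, j). i < length \<nu> \<and> j < \<nu> ! i}"

text \<open>
  Tableaux are extensional functions on the cells (row, column), so that distinct functions
  are distinct fillings and cardinalities count correctly.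
\<close>

definition standard_tableaux :: "nat list \<Rightarrow> (nat \<times> nat \<Rightarrow> nat) set" where
  "standard_tableaux \<nu> =
     {T \<in> extensional (young_diagram \<nu>).
        bij_betw T (young_diagram \<nu>) {1..sum_list \<nu>} \<and>
        (\<forall>i j j'. j < j' \<and> (i, j) \<in> young_diagram \<nu> \<and> (i, j') \<in> young_diagram \<nu>
           \<longrightarrow> T (i, j) < T (i, j')) \<and>
        (\<forall>i i' j. i < i' \<and> (i, j) \<in> young_diagram \<nu> \<and> (i', j) \<in> young_diagram \<nu>
           \<longrightarrow> T (i, j) < T (i', j))}"

definition semistandard_tableaux :: "nat list \<Rightarrow> nat \<Rightarrow> (nat \<times> nat \<Rightarrow> nat) set" where
  "semistandard_tableaux \<nu> r =
     {T \<in> young_diagram \<nu> \<rightarrow>\<^sub>E {1..r}.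
        (\<forall>i j j'. j < j' \<and> (i, j) \<in> young_diagram \<nu> \<and> (i, j') \<in> young_diagram \<nu>
           \<longrightarrow> T (i, j) \<le> T (i, j')) \<and>
        (\<forall>i i' j. i < i' \<and> (i, j) \<in> young_diagram \<nu> \<and> (i', j) \<in> young_diagram \<nu>
           \<longrightarrow> T (i, j) < T (i', j))}"

definition num_SYT :: "nat list \<Rightarrow> nat" where
  "num_SYT \<nu> = card (standard_tableaux \<nu>)"

definition num_SSYT :: "nat list \<Rightarrow> nat \<Rightarrow> nat" where
  "num_SSYT \<nu> r = card (semistandard_tableaux \<nu> r)"

end

(* The function G_n(x) = E |sum_i sqrt(x_i) U_ii|^(2n) is a symmetric polynomial of degree n.
   Writing th_i for x_i d/dx_i, invariance of Haar measure under rotations of two rows and of two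
   columns gives n^2 (x_i - x_j) E(|U_ij|^2 |T|^(2n-2)) = (th_i - th_j) G_n with
   T = sum_i sqrt(x_i) U_ii, and the rows of U being unit vectors then yields
     n^2 p_1 G_(n-1) = (sum_i th_i^2 + sum_(i<j) (x_i + x_j)/(x_i - x_j) (th_i - th_j)) G_n.
   Conjugation by the Vandermonde product turns the operator on the right into sum_i th_i^2 plus
   a scalar, which is diagonal on alternants and positive on those of degree n >= 1.
   So the recursion has only one solution, and in the Schur basis it reads
     (sum over the cells of lambda of (d + 2 content)) g_lambda = n^2 sum_mu g_mu,
   mu running over lambda with a box removed. It is solved by
   (f^lambda)^2 / s_lambda(1^d); all the numbers involved are expressed through the alternant
   det (l_j choose i) of the shifted parts l_j, which equals s_lambda(1^d).
   Finally x is specialised to k ones and d - k zeros. *)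

theory Submission
  imports "Jordan_Normal_Form.Determinant" Defs
begin

no_notation Matrix.vec_index (infixl \<open>$\<close> 100)
hide_const (open) Matrix.mat Matrix.row Matrix.col Determinant.det

section \<open>Invariance of Haar measure\<close>

text \<open>The classical route decomposes a tensor power into irreducible representations and
  applies orthogonality of matrix coefficients; here only invariance of the measure enters.
  Invariance relates derivatives with respect to the weights of single diagonal entries, so every
  entry carries its own weight although the corner uses only the weights 0 and 1. Two difficulties
  shape the argument. The equation divides by x_i - x_j, so it is available only at distinct x,
  whereas the corner has repeated values; both sides are polynomials in x, and a limit bridges the
  gap. Moreover, the scalar by which the conjugated operator acts on a single monomial need not be
  positive: for d = 2 and n = 1 it vanishes on x_0 x_1. Such exponents have a repeated entry and are
  excluded by antisymmetry, so uniqueness is proved for coefficients of antisymmetric polynomials.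
  The operators th_i act on G_n by multiplying each monomial by an exponent, so the equation lives
  on finite weighted sums of monomials.\<close>

lemma adjoint_matrix_nth [simp]: "adjoint_matrix A $ i $ j = cnj (A $ j $ i)"
  by (simp add: adjoint_matrix_def)

lemma adjoint_adjoint [simp]: "adjoint_matrix (adjoint_matrix A) = A"
  by (simp add: vec_eq_iff)

lemma adjoint_mult: "adjoint_matrix (A ** B) = adjoint_matrix B ** adjoint_matrix A"
  by (simp add: vec_eq_iff matrix_matrix_mult_def mult.commute)

lemma transpose_adjoint: "transpose (adjoint_matrix A) = adjoint_matrix (transpose A)"
  by (simp add: vec_eq_iff transpose_def)

lemma unitary_adjoint: "U \<in> unitary_group \<Longrightarrow> adjoint_matrix U \<in> unitary_group"
  by (simp add: unitary_group_def unitary_matrix_def)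

lemma unitary_mult:
  assumes "U \<in> unitary_group" "V \<in> unitary_group" shows "U ** V \<in> unitary_group"
proof -
  have "(adjoint_matrix V ** adjoint_matrix U) ** (U ** V) =
      adjoint_matrix V ** (adjoint_matrix U ** U) ** V"
    "(U ** V) ** (adjoint_matrix V ** adjoint_matrix U) =
      U ** (V ** adjoint_matrix V) ** adjoint_matrix U"
    by (simp_all add: matrix_mul_assoc)
  then show ?thesis
    using assms by (simp add: unitary_group_def unitary_matrix_def adjoint_mult)
qed

lemma unitary_transpose:
  assumes "U \<in> unitary_group" shows "transpose U \<in> unitary_group"
proof -
  have "transpose (U ** adjoint_matrix U) = mat 1" "transpose (adjoint_matrix U ** U) = mat 1"
    using assms by (simp_all add: unitary_group_def unitary_matrix_def)
  then show ?thesis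
    by (simp add: unitary_group_def unitary_matrix_def matrix_transpose_mul transpose_adjoint)
qed

lemma unitary_row:
  assumes "U \<in> unitary_group"
  shows "(\<Sum>j\<in>UNIV. (cmod (U $ i $ j))\<^sup>2) = 1"
proof -
  have "(U ** adjoint_matrix U) $ i $ i = (mat 1 :: complex^'a^'a) $ i $ i"
    using assms by (simp add: unitary_group_def unitary_matrix_def)
  then have "(\<Sum>j\<in>UNIV. U $ i $ j * cnj (U $ i $ j)) = 1"
    by (simp add: matrix_matrix_mult_def mat_def)
  then have "of_real (\<Sum>j\<in>UNIV. (cmod (U $ i $ j))\<^sup>2) = (1 :: complex)"
    by (simp add: complex_norm_square del: of_real_power)
  then show ?thesis
    using of_real_eq_1_iff by blast
qed

section \<open>Topology of the unitary group\<close>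

lemma continuous_on_entry [continuous_intros]:
  "continuous_on S (\<lambda>U :: complex^'n^'m. U $ i $ j)"
  by (intro continuous_intros)

lemma continuous_on_matrix_mult [continuous_intros]:
  fixes f :: "'a::topological_space \<Rightarrow> complex^'n^'m"
  assumes "continuous_on S f" "continuous_on S g"
  shows "continuous_on S (\<lambda>x. f x ** g x)"
  unfolding matrix_matrix_mult_def by (intro continuous_intros assms)

lemma continuous_on_adjoint [continuous_intros]:
  assumes "continuous_on S f" shows "continuous_on S (\<lambda>x. adjoint_matrix (f x))"
  unfolding adjoint_matrix_def by (intro continuous_intros assms)

lemma continuous_on_transpose [continuous_intros]:
  fixes f :: "'a::topological_space \<Rightarrow> complex^'n^'m"
  assumes "continuous_on S f" shows "continuous_on S (\<lambda>x. transpose (f x))"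
  unfolding transpose_def by (intro continuous_intros assms)

text \<open>Rows are unit vectors, so entries are bounded, and the defining equations are closed.
  Compactness makes every continuous function integrable and supplies the uniform bound for
  differentiating under the integral.\<close>

lemma compact_unitary_group: "compact (unitary_group :: (complex^'d^'d) set)"
proof (rule compact_eq_bounded_closed[THEN iffD2], rule conjI)
  have "norm U \<le> (\<Sum>i\<in>(UNIV::'d set). \<Sum>j\<in>(UNIV::'d set). 1)" if "U \<in> unitary_group" for U :: "complex^'d^'d"
  proof -
    have "norm (U $ i $ j) \<le> 1" for i j
    proof -
      have "(cmod (U $ i $ j))\<^sup>2 \<le> (\<Sum>j\<in>UNIV. (cmod (U $ i $ j))\<^sup>2)"
        by (rule member_le_sum) auto
      then show ?thesis
        using unitary_row[OF that, of i] by (simp add: power_le_one_iff abs_square_le_1)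
    qed
    then have "norm (U $ i) \<le> (\<Sum>j\<in>(UNIV::'d set). 1)" for i
      unfolding norm_vec_def by (intro order.trans[OF L2_set_le_sum] sum_mono) auto
    then show ?thesis
      unfolding norm_vec_def[of U] by (intro order.trans[OF L2_set_le_sum] sum_mono) auto
  qed
  then show "bounded (unitary_group :: (complex^'d^'d) set)"
    unfolding bounded_iff by blast
  have "closed ({U. adjoint_matrix U ** U = mat 1} \<inter>
      {U. U ** adjoint_matrix U = (mat 1 :: complex^'d^'d)})"
    by (intro closed_Int closed_Collect_eq continuous_intros)
  then show "closed (unitary_group :: (complex^'d^'d) set)"
    by (simp add: unitary_group_def unitary_matrix_def Int_def)
qed

text \<open>The image of a set under V is its preimage under the adjoint of V, so invariant
  pushforwards give invariance in the sense of the definition.\<close>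

lemma normalized_haar_measureI:
  fixes N :: "(complex^'d^'d) measure"
  assumes "prob_space N" "space N = unitary_group"
    "sets N = sets (restrict_space borel unitary_group)"
    and inv: "\<And>V. V \<in> unitary_group \<Longrightarrow> distr N N (\<lambda>U. V ** U) = N"
  shows "normalized_haar_measure N"
  unfolding normalized_haar_measure_def
proof (intro conjI ballI)
  fix V :: "complex^'d^'d" and A assume V: "V \<in> unitary_group" and A: "A \<in> sets N"
  let ?V = "adjoint_matrix V"
  have V': "?V \<in> unitary_group" using V by (rule unitary_adjoint)
  have eq: "V ** (?V ** U) = U" "?V ** (V ** U) = U" for U
    using V by (simp_all add: matrix_mul_assoc unitary_group_def unitary_matrix_def)
  have sub: "A \<subseteq> unitary_group" using sets.sets_into_space[OF A] assms(2) by simp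
  have meas: "(\<lambda>U. ?V ** U) \<in> measurable N N"
    using V' assms(2,3)
    by (subst measurable_cong_sets[OF assms(3) assms(3)])
       (auto intro!: measurable_restrict_space2 borel_measurable_continuous_on_restrict
          continuous_intros unitary_mult simp: space_restrict_space)
  have "emeasure N A = emeasure (distr N N (\<lambda>U. ?V ** U)) A"
    by (simp add: inv[OF V'])
  also have "\<dots> = emeasure N ((\<lambda>U. ?V ** U) -` A \<inter> space N)"
    by (rule emeasure_distr[OF meas A])
  also have "(\<lambda>U. ?V ** U) -` A \<inter> space N = (\<lambda>U. V ** U) ` A"
    using sub V by (auto simp: assms(2) eq unitary_mult intro!: image_eqI[where x="?V ** x" for x])
  finally show "emeasure N ((\<lambda>U. V ** U) ` A) = emeasure N A" by simp
qed (use assms in auto)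

section \<open>Invariance under translations, adjoint and transpose\<close>

locale haar =
  fixes M :: "(complex^'d^'d) measure"
  assumes haar: "normalized_haar_measure M"
begin

sublocale prob_space M
  using haar by (simp add: normalized_haar_measure_def)

lemma space_M: "space M = unitary_group"
  and sets_M: "sets M = sets (restrict_space borel unitary_group)"
  using haar by (auto simp: normalized_haar_measure_def)

lemma measurable_continuous:
  "continuous_on unitary_group f \<Longrightarrow> f \<in> borel_measurable M"
  by (subst measurable_cong_sets[OF sets_M refl]) (rule borel_measurable_continuous_on_restrict)

lemma integrable_continuous:
  fixes f :: "_ \<Rightarrow> 'b::{banach,second_countable_topology}"
  assumes "continuous_on unitary_group f"
  shows "integrable M f"
proof -
  have "bounded (f ` unitary_group)"
    by (intro compact_imp_bounded compact_continuous_image assms compact_unitary_group)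
  then obtain B where "\<forall>y \<in> f ` unitary_group. norm y \<le> B"
    unfolding bounded_iff by auto
  then have "norm (f U) \<le> B" if "U \<in> unitary_group" for U using that by simp
  then show ?thesis
    by (intro integrable_const_bound[where B=B] measurable_continuous[OF assms])
       (auto simp: space_M)
qed

lemma measurable_self_map:
  assumes "f \<in> borel_measurable N" "\<And>x. x \<in> space N \<Longrightarrow> f x \<in> unitary_group"
  shows "f \<in> measurable N M"
  by (subst measurable_cong_sets[OF refl sets_M])
     (rule measurable_restrict_space2, use assms in auto)

lemma measurable_M_continuous:
  assumes "continuous_on unitary_group f" "\<And>U. U \<in> unitary_group \<Longrightarrow> f U \<in> unitary_group"
  shows "f \<in> measurable M M"
  using assms by (intro measurable_self_map measurable_continuous) (auto simp: space_M)

lemma measurable_left: "V \<in> unitary_group \<Longrightarrow> (\<lambda>U. V ** U) \<in> measurable M M"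
  by (intro measurable_M_continuous continuous_intros unitary_mult)

lemma measurable_right: "V \<in> unitary_group \<Longrightarrow> (\<lambda>U. U ** V) \<in> measurable M M"
  by (intro measurable_M_continuous continuous_intros unitary_mult)

lemma measurable_adjoint: "adjoint_matrix \<in> measurable M M"
  using measurable_M_continuous[of "\<lambda>U. adjoint_matrix U"]
  by (simp add: continuous_intros unitary_adjoint)

lemma measurable_transpose: "transpose \<in> measurable M M"
  using measurable_M_continuous[of "\<lambda>U. transpose U"]
  by (simp add: continuous_intros unitary_transpose)

lemma distr_left:
  assumes V: "V \<in> unitary_group"
  shows "distr M M (\<lambda>U. V ** U) = M"
proof (rule measure_eqI)
  fix A assume "A \<in> sets (distr M M (\<lambda>U. V ** U))"
  then have A: "A \<in> sets M" by simp
  let ?V = "adjoint_matrix V"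
  have V': "?V \<in> unitary_group" using V by (rule unitary_adjoint)
  have eq: "V ** (?V ** U) = U" "?V ** (V ** U) = U" for U
    using V by (simp_all add: matrix_mul_assoc unitary_group_def unitary_matrix_def)
  have sub: "A \<subseteq> unitary_group" using sets.sets_into_space[OF A] space_M by simp
  have "(\<lambda>U. V ** U) -` A \<inter> space M = (\<lambda>U. ?V ** U) ` A"
    using sub V' by (auto simp: space_M eq unitary_mult intro!: image_eqI[where x="V ** x" for x])
  then show "emeasure (distr M M (\<lambda>U. V ** U)) A = emeasure M A"
    using haar V' A
    by (simp add: emeasure_distr[OF measurable_left[OF V] A] normalized_haar_measure_def)
qed simp

text \<open>The Fubini argument for unimodularity: averaging f(W) = f(adj(U) W) over U and
  exchanging the integrals, one reads adj(U) W as the adjoint of adj(W) U and uses left invariance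
  in U. Right invariance follows by conjugating left translation with the adjoint.\<close>

lemma distr_adjoint: "distr M M adjoint_matrix = M"
proof (rule measure_eqI)
  fix A assume "A \<in> sets (distr M M adjoint_matrix)"
  then have A: "A \<in> sets M" by simp
  let ?f = "indicator A :: _ \<Rightarrow> ennreal"
  interpret pair_sigma_finite M M ..
  have f: "?f \<in> borel_measurable M" using A by simp
  have mfst: "fst \<in> borel_measurable (M \<Otimes>\<^sub>M M)" and msnd: "snd \<in> borel_measurable (M \<Otimes>\<^sub>M M)"
    using measurable_compose[OF measurable_fst[of M M] measurable_continuous[OF continuous_on_id]]
      measurable_compose[OF measurable_snd[of M M] measurable_continuous[OF continuous_on_id]]
    by simp_all
  have "(\<lambda>p. adjoint_matrix (fst p) ** snd p) \<in> measurable (M \<Otimes>\<^sub>M M) M"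
    by (intro measurable_self_map borel_measurable_continuous_Pair[OF mfst msnd] continuous_intros)
       (auto simp: space_pair_measure space_M intro!: unitary_mult unitary_adjoint)
  then have pm: "(\<lambda>(U, W). ?f (adjoint_matrix U ** W)) \<in> borel_measurable (M \<Otimes>\<^sub>M M)"
    using measurable_compose[OF _ f] by (simp add: case_prod_unfold)
  have left: "(\<integral>\<^sup>+W. g (V ** W) \<partial>M) = (\<integral>\<^sup>+W. g W \<partial>M)"
    if "V \<in> space M" "g \<in> borel_measurable M" for V and g :: "_ \<Rightarrow> ennreal"
  proof -
    have V: "V \<in> unitary_group" using that by (simp add: space_M)
    show ?thesis
      using nn_integral_distr[OF measurable_left[OF V], of g] that(2)
      by (simp add: distr_left[OF V])
  qed
  have fa: "(\<lambda>U. ?f (adjoint_matrix U)) \<in> borel_measurable M"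
    using measurable_compose[OF measurable_adjoint f] .
  have "emeasure M A = (\<integral>\<^sup>+W. ?f W \<partial>M)" using A by simp
  also have "\<dots> = (\<integral>\<^sup>+U. (\<integral>\<^sup>+W. ?f W \<partial>M) \<partial>M)"
    by (simp add: emeasure_space_1)
  also have "\<dots> = (\<integral>\<^sup>+U. (\<integral>\<^sup>+W. ?f (adjoint_matrix U ** W) \<partial>M) \<partial>M)"
    by (intro nn_integral_cong left[symmetric] f) (simp add: space_M unitary_adjoint)
  also have "\<dots> = (\<integral>\<^sup>+W. (\<integral>\<^sup>+U. ?f (adjoint_matrix U ** W) \<partial>M) \<partial>M)"
    using Fubini'[OF pm] by simp
  also have "\<dots> = (\<integral>\<^sup>+W. (\<integral>\<^sup>+U. ?f (adjoint_matrix (adjoint_matrix W ** U)) \<partial>M) \<partial>M)"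
    by (simp add: adjoint_mult)
  also have "\<dots> = (\<integral>\<^sup>+W. (\<integral>\<^sup>+U. ?f (adjoint_matrix U) \<partial>M) \<partial>M)"
    by (intro nn_integral_cong left[of "adjoint_matrix W" "\<lambda>U. ?f (adjoint_matrix U)" for W] fa)
       (simp add: space_M unitary_adjoint)
  also have "\<dots> = (\<integral>\<^sup>+U. ?f (adjoint_matrix U) \<partial>M)"
    by (simp add: emeasure_space_1)
  also have "\<dots> = (\<integral>\<^sup>+U. ?f U \<partial>(distr M M adjoint_matrix))"
    by (rule nn_integral_distr[symmetric, OF measurable_adjoint]) (use A in simp)
  also have "\<dots> = emeasure (distr M M adjoint_matrix) A" using A by simp
  finally show "emeasure (distr M M adjoint_matrix) A = emeasure M A" by simp
qed simp

lemma distr_right: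
  assumes V: "V \<in> unitary_group"
  shows "distr M M (\<lambda>U. U ** V) = M"
proof -
  have V': "adjoint_matrix V \<in> unitary_group" using V by (rule unitary_adjoint)
  have eq: "(\<lambda>U. U ** V) = adjoint_matrix \<circ> ((\<lambda>U. adjoint_matrix V ** U) \<circ> adjoint_matrix)"
    by (simp add: fun_eq_iff adjoint_mult)
  have "distr M M (adjoint_matrix \<circ> ((\<lambda>U. adjoint_matrix V ** U) \<circ> adjoint_matrix)) =
      distr (distr (distr M M adjoint_matrix) M (\<lambda>U. adjoint_matrix V ** U)) M adjoint_matrix"
    using measurable_left[OF V'] measurable_adjoint
      measurable_comp[OF measurable_adjoint measurable_left[OF V']]
    by (simp add: distr_distr del: distr_id2)
  then show ?thesis
    by (simp only: eq distr_adjoint distr_left[OF V'])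
qed

text \<open>Left translation after transposing is right translation before it. Hence an identity
  about rows, proved for every Haar measure, can be read off for columns.\<close>

lemma haar_transpose: "normalized_haar_measure (distr M M transpose)"
proof (rule normalized_haar_measureI)
  fix V :: "complex^'d^'d" assume V: "V \<in> unitary_group"
  let ?N = "distr M M transpose"
  have V': "transpose V \<in> unitary_group" using V by (rule unitary_transpose)
  have "distr ?N ?N (\<lambda>U. V ** U) = distr ?N M (\<lambda>U. V ** U)"
    by (rule distr_cong) auto
  also have "\<dots> = distr M M ((\<lambda>U. V ** U) \<circ> transpose)"
    using measurable_left[OF V] measurable_transpose by (simp add: distr_distr)
  also have "(\<lambda>U. V ** U) \<circ> transpose = transpose \<circ> (\<lambda>U. U ** transpose V)"
    by (simp add: fun_eq_iff matrix_transpose_mul)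
  also have "distr M M (transpose \<circ> (\<lambda>U. U ** transpose V)) =
      distr (distr M M (\<lambda>U. U ** transpose V)) M transpose"
    using measurable_right[OF V'] measurable_transpose by (simp add: distr_distr)
  finally show "distr ?N ?N (\<lambda>U. V ** U) = ?N"
    by (simp add: distr_right[OF V'])
qed (auto simp: space_M sets_M intro: prob_space_distr measurable_transpose)

lemma integral_left:
  fixes f :: "_ \<Rightarrow> 'b::{banach,second_countable_topology}"
  assumes "V \<in> unitary_group" "continuous_on unitary_group f"
  shows "(\<integral>U. f (V ** U) \<partial>M) = (\<integral>U. f U \<partial>M)"
  using integral_distr[OF measurable_left[OF assms(1)] measurable_continuous[OF assms(2)]]
  by (simp add: distr_left[OF assms(1)])

lemma integral_right:
  fixes f :: "_ \<Rightarrow> 'b::{banach,second_countable_topology}"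
  assumes "V \<in> unitary_group" "continuous_on unitary_group f"
  shows "(\<integral>U. f (U ** V) \<partial>M) = (\<integral>U. f U \<partial>M)"
  using integral_distr[OF measurable_right[OF assms(1)] measurable_continuous[OF assms(2)]]
  by (simp add: distr_right[OF assms(1)])

end

section \<open>Ward identities\<close>

text \<open>The weights \<open>t\<close> are the square roots of the variables x_i; weights 0 and 1
  give the trace of a corner.\<close>

definition dtrace :: "('d \<Rightarrow> real) \<Rightarrow> complex^'d^'d \<Rightarrow> complex" where
  "dtrace t U = (\<Sum>a\<in>UNIV. of_real (t a) * U $ a $ a)"

lemma continuous_on_dtrace [continuous_intros]:
  "continuous_on S f \<Longrightarrow> continuous_on S (\<lambda>x. dtrace t (f x))"
  unfolding dtrace_def by (intro continuous_intros)

definition phase :: "'d \<Rightarrow> complex \<Rightarrow> complex^'d^'d" where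
  "phase i w = (\<chi> a b. if a = b then (if a = i then w else 1) else 0)"

lemma phase_left: "(phase i w ** U) $ a $ b = (if a = i then w else 1) * U $ a $ b"
proof -
  have "(phase i w ** U) $ a $ b =
      (\<Sum>k\<in>UNIV. if a = k then (if a = i then w else 1) * U $ k $ b else 0)"
    unfolding matrix_matrix_mult_def phase_def vec_lambda_beta by (intro sum.cong) auto
  then show ?thesis by simp
qed

lemma phase_right: "(U ** phase i w) $ a $ b = U $ a $ b * (if b = i then w else 1)"
proof -
  have "(U ** phase i w) $ a $ b =
      (\<Sum>k\<in>UNIV. if b = k then U $ a $ k * (if b = i then w else 1) else 0)"
    unfolding matrix_matrix_mult_def phase_def vec_lambda_beta by (intro sum.cong) auto
  then show ?thesis by simp
qed

lemma phase_unitary: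
  assumes "cmod w = 1" shows "phase i w \<in> unitary_group"
proof -
  have adj: "adjoint_matrix (phase i w) = phase i (cnj w)"
    by (auto simp: vec_eq_iff phase_def)
  have "cnj w * w = 1" using assms by (metis complex_norm_square mult.commute of_real_1 one_power2)
  then have "phase i (cnj w) ** phase i w = mat 1"
    "phase i w ** phase i (cnj w) = mat 1"
    unfolding vec_eq_iff phase_left by (auto simp: phase_def mat_def mult.commute)
  then show ?thesis
    by (simp add: unitary_group_def unitary_matrix_def adj)
qed

text \<open>The two special rows are sums of one-entry terms, so that the sum over the middle index
  of a matrix product collapses termwise.\<close>

definition rotation :: "'d \<Rightarrow> 'd \<Rightarrow> real \<Rightarrow> complex^'d^'d" where
  "rotation i j \<theta> = (\<chi> a b.
     if a = i then (if i = b then of_real (cos \<theta>) else 0) + (if j = b then of_real (sin \<theta>) else 0)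
     else if a = j then (if i = b then - of_real (sin \<theta>) else 0) + (if j = b then of_real (cos \<theta>) else 0)
     else if a = b then 1 else 0)"

lemma rotation_left:
  "(rotation i j \<theta> ** U) $ a $ b =
    (if a = i then of_real (cos \<theta>) * U $ i $ b + of_real (sin \<theta>) * U $ j $ b
     else if a = j then - of_real (sin \<theta>) * U $ i $ b + of_real (cos \<theta>) * U $ j $ b
     else U $ a $ b)"
proof -
  have "(if P then x else 0) * y = (if P then x * y else 0)" for P and x y :: complex
    by simp
  then show ?thesis
    by (simp add: matrix_matrix_mult_def rotation_def distrib_right sum.distrib)
qed

lemma rotation_unitary:
  assumes "i \<noteq> j" shows "rotation i j \<theta> \<in> unitary_group"
proof -
  have adj: "adjoint_matrix (rotation i j \<theta>) = rotation i j (- \<theta>)" for \<theta>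
    using assms by (auto simp: vec_eq_iff rotation_def)
  have cs: "of_real (cos \<theta>) * of_real (cos \<theta>) + of_real (sin \<theta>) * of_real (sin \<theta>) = (1 :: complex)" for \<theta>
    by (metis of_real_1 of_real_add of_real_mult power2_eq_square sin_cos_squared_add2 add.commute)
  have "rotation i j (- \<theta>) ** rotation i j \<theta> = mat 1" for \<theta>
    unfolding vec_eq_iff rotation_left using assms cs[of \<theta>]
    by (auto simp: rotation_def mat_def algebra_simps)
  from this[of \<theta>] this[of "- \<theta>"] show ?thesis
    by (simp add: unitary_group_def unitary_matrix_def adj)
qed

text \<open>Only the diagonal entries of the two rotated rows change. Writing the change through
  \<open>cos \<theta> - 1\<close> and \<open>sin \<theta>\<close> keeps the original trace as base
  point, and the coefficient of the sine is the derivative at angle 0.\<close>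

lemma dtrace_rotation:
  assumes "i \<noteq> j"
  shows "dtrace t (rotation i j \<theta> ** U) = dtrace t U
     + (of_real (t i) * U $ i $ i + of_real (t j) * U $ j $ j) * (of_real (cos \<theta>) - 1)
     + (of_real (t i) * U $ j $ i - of_real (t j) * U $ i $ j) * of_real (sin \<theta>)"
proof -
  have split: "(\<Sum>a\<in>UNIV. g a) = g i + (g j + (\<Sum>a\<in>UNIV - {i} - {j}. g a))" for g :: "'a \<Rightarrow> complex"
    using assms by (subst sum.remove[of _ i], simp, simp, subst sum.remove[of _ j]) auto
  have "(\<Sum>a\<in>UNIV - {i} - {j}. of_real (t a) * (rotation i j \<theta> ** U) $ a $ a) =
      (\<Sum>a\<in>UNIV - {i} - {j}. of_real (t a) * U $ a $ a)"
    by (intro sum.cong) (auto simp: rotation_left)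
  then show ?thesis
    unfolding dtrace_def split using assms by (simp add: rotation_left algebra_simps)
qed

section \<open>Differentiation under the integral\<close>

lemma has_vector_derivativeD_tendsto:
  fixes f :: "real \<Rightarrow> 'a::real_normed_vector"
  assumes "(f has_vector_derivative D) (at a)"
  shows "((\<lambda>h. (f (a + h) - f a) /\<^sub>R h) \<longlongrightarrow> D) (at 0)"
proof -
  have "((\<lambda>h. norm (f (a + h) - f a - h *\<^sub>R D) / norm h) \<longlongrightarrow> 0) (at 0)"
    using assms unfolding has_vector_derivative_def has_derivative_at by simp
  moreover have "norm (f (a + h) - f a - h *\<^sub>R D) / norm h = norm ((f (a + h) - f a) /\<^sub>R h - D)"
    if "h \<noteq> 0" for h
  proof -
    have "(f (a + h) - f a) /\<^sub>R h - D = (f (a + h) - f a - h *\<^sub>R D) /\<^sub>R h"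
      using that by (simp add: scaleR_diff_right)
    then show ?thesis by (simp add: divide_inverse mult.commute)
  qed
  then have "\<forall>\<^sub>F h in at 0. norm (f (a + h) - f a - h *\<^sub>R D) / norm h = norm ((f (a + h) - f a) /\<^sub>R h - D)"
    by (auto simp: eventually_at_filter)
  ultimately have "((\<lambda>h. norm ((f (a + h) - f a) /\<^sub>R h - D)) \<longlongrightarrow> 0) (at 0)"
    by (rule Lim_transform_eventually)
  then show ?thesis
    using Lim_null tendsto_norm_zero_iff by blast
qed

text \<open>Dominated convergence along the step sizes 1/(k+1): the mean value inequality bounds the
  difference quotients by \<open>C\<close>, and each of them has expectation zero. All steps lie in
  [0,1], hence the range of the bound.\<close>

lemma (in prob_space) integral_derivative_zero:
  fixes F :: "real \<Rightarrow> 'a \<Rightarrow> complex"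
  assumes int: "\<And>\<theta>. integrable M (F \<theta>)"
    and meas: "F' 0 \<in> borel_measurable M"
    and deriv: "\<And>\<theta> x. x \<in> space M \<Longrightarrow> ((\<lambda>\<theta>. F \<theta> x) has_vector_derivative F' \<theta> x) (at \<theta>)"
    and bound: "\<And>\<theta> x. 0 \<le> \<theta> \<Longrightarrow> \<theta> \<le> 1 \<Longrightarrow> x \<in> space M \<Longrightarrow> cmod (F' \<theta> x) \<le> C"
    and const: "\<And>\<theta>. expectation (F \<theta>) = c"
  shows "expectation (F' 0) = 0"
proof -
  define h where "h k = 1 / real (Suc k)" for k
  have h: "0 < h k" "h k \<le> 1" for k by (auto simp: h_def)
  define q where "q k x = (F (h k) x - F 0 x) /\<^sub>R h k" for k x
  have "(\<lambda>k. expectation (q k)) \<longlonglongrightarrow> expectation (F' 0)"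
  proof (rule integral_dominated_convergence[where w="\<lambda>_. C"])
    show "AE x in M. (\<lambda>k. q k x) \<longlonglongrightarrow> F' 0 x"
    proof (rule AE_I2)
      fix x assume x: "x \<in> space M"
      have "((\<lambda>\<theta>. (F \<theta> x - F 0 x) /\<^sub>R \<theta>) \<longlongrightarrow> F' 0 x) (at 0)"
        using has_vector_derivativeD_tendsto[OF deriv[OF x, of 0]] by simp
      moreover have "filterlim h (at 0) sequentially"
        using LIMSEQ_inverse_real_of_nat h(1)
        unfolding h_def[abs_def] inverse_eq_divide filterlim_at by (auto simp: less_imp_neq[symmetric])
      ultimately show "(\<lambda>k. q k x) \<longlonglongrightarrow> F' 0 x"
        unfolding q_def by (rule filterlim_compose)
    qed
    show "AE x in M. norm (q k x) \<le> C" for k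
    proof (rule AE_I2)
      fix x assume x: "x \<in> space M"
      have C: "cmod (F' \<theta> x) \<le> C" if "\<theta> \<in> {0..h k}" for \<theta>
        using that h(2)[of k] by (intro bound x) auto
      have C0: "0 \<le> C" by (rule order.trans[OF norm_ge_zero C[of 0]]) (use h(1)[of k] in simp)
      have "norm (F (h k) x - F 0 x) \<le> C * norm (h k - 0)"
      proof (rule differentiable_bound[where S="{0..h k}" and f'="\<lambda>\<theta> z. z *\<^sub>R F' \<theta> x"])
        show "((\<lambda>\<theta>. F \<theta> x) has_derivative (\<lambda>z. z *\<^sub>R F' \<theta> x)) (at \<theta> within {0..h k})" for \<theta>
          using deriv[OF x, of \<theta>] unfolding has_vector_derivative_def
          by (rule has_derivative_at_withinI)
        show "onorm (\<lambda>z. z *\<^sub>R F' \<theta> x) \<le> C" if "\<theta> \<in> {0..h k}" for \<theta>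
        proof (rule onorm_bound[OF C0])
          fix z :: real
          show "norm (z *\<^sub>R F' \<theta> x) \<le> C * norm z"
            using mult_left_mono[OF C[OF that], of "\<bar>z\<bar>"] by (simp add: mult.commute)
        qed
      qed (use h[of k] in auto)
      then show "norm (q k x) \<le> C"
        unfolding q_def norm_scaleR using h[of k] by (simp add: field_simps)
    qed
  qed (auto simp: q_def[abs_def] intro!: meas borel_measurable_integrable int)
  moreover have "expectation (q k) = 0" for k
    unfolding q_def using int const by simp
  ultimately show ?thesis
    by (simp add: LIMSEQ_const_iff)
qed

section \<open>Identities from rotations of rows and columns\<close>

context haar
begin

lemma integral_phase_conj:
  fixes f :: "_ \<Rightarrow> 'b::{banach,second_countable_topology}"
  assumes "cmod w = 1" "continuous_on unitary_group f"
  shows "(\<integral>U. f (phase i w ** U ** phase i (cnj w)) \<partial>M) = (\<integral>U. f U \<partial>M)"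
proof -
  have w: "cmod (cnj w) = 1" using assms by simp
  have "continuous_on unitary_group (\<lambda>U. f (U ** phase i (cnj w)))"
    by (rule continuous_on_compose2[OF assms(2)])
       (auto intro!: continuous_intros unitary_mult phase_unitary w)
  from integral_left[OF phase_unitary[OF assms(1)] this]
  show ?thesis
    using integral_right[OF phase_unitary[OF w] assms(2)] by simp
qed

text \<open>The integrand is the derivative at angle 0 of U_ij T^m cnj(T)^(m+1) along the rotation
  of rows i and j, whose expectation is constant. The additional conjugate factor balances the phase
  of U_ij. At m = 0 the truncated exponent \<open>m - 1\<close> is harmless because of the factor
  m.\<close>

lemma ward_rotation:
  fixes t :: "'d \<Rightarrow> real"
  assumes ij: "i \<noteq> j"
  shows "(\<integral>U. U $ j $ j * dtrace t U ^ m * cnj (dtrace t U) ^ Suc m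
      + U $ i $ j * (of_nat m * dtrace t U ^ (m - 1)
          * (of_real (t i) * U $ j $ i - of_real (t j) * U $ i $ j) * cnj (dtrace t U) ^ Suc m
        + of_nat (Suc m) * dtrace t U ^ m * cnj (dtrace t U) ^ m
          * cnj (of_real (t i) * U $ j $ i - of_real (t j) * U $ i $ j)) \<partial>M) = 0"
proof -
  define A where "A z U = cos z * U $ i $ j + sin z * U $ j $ j" for z and U :: "complex^'d^'d"
  define A' where "A' z U = - sin z * U $ i $ j + cos z * U $ j $ j" for z and U :: "complex^'d^'d"
  define p where "p U = of_real (t i) * U $ i $ i + of_real (t j) * U $ j $ j" for U :: "complex^'d^'d"
  define q where "q U = of_real (t i) * U $ j $ i - of_real (t j) * U $ i $ j" for U :: "complex^'d^'d"
  define T where "T z U = dtrace t U + p U * (cos z - 1) + q U * sin z" for z U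
  define T' where "T' z U = - p U * sin z + q U * cos z" for z U
  \<comment> \<open>\<open>S\<close> replaces the conjugate of \<open>T\<close>: it agrees with it
    at real angles but is holomorphic in z, so the product rule for complex derivatives applies to
    all of \<open>F\<close>.\<close>
  define S where "S z U = cnj (dtrace t U) + cnj (p U) * (cos z - 1) + cnj (q U) * sin z" for z U
  define S' where "S' z U = - cnj (p U) * sin z + cnj (q U) * cos z" for z U
  define F where "F z U = A z U * (T z U ^ m * S z U ^ Suc m)" for z U
  define F' where "F' z U = A' z U * (T z U ^ m * S z U ^ Suc m) + A z U *
     (of_nat m * T z U ^ (m - 1) * T' z U * S z U ^ Suc m
      + T z U ^ m * (of_nat (Suc m) * S z U ^ m * S' z U))" for z U
  have FR: "F (of_real \<theta>) U = (\<lambda>V. V $ i $ j * (dtrace t V ^ m * cnj (dtrace t V) ^ Suc m))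
     (rotation i j \<theta> ** U)" for \<theta> U
    unfolding dtrace_rotation[OF ij] rotation_left F_def A_def T_def S_def
    by (simp add: p_def q_def cos_of_real sin_of_real)
  have cont: "continuous_on X (\<lambda>U. F z U)" for X z
    unfolding F_def A_def T_def S_def p_def q_def by (intro continuous_intros)
  \<comment> \<open>Joint continuity in angle and matrix, on the compact product with [0,1], yields
    the dominating constant \<open>C\<close>.\<close>
  have cont': "continuous_on X (\<lambda>p. F' (of_real (fst p)) (snd p))" for X :: "(real \<times> _) set"
    unfolding F'_def A_def A'_def T_def S_def T'_def S'_def p_def q_def
    by (intro continuous_intros continuous_on_compose2[OF continuous_on_entry continuous_on_snd]) auto
  have "compact (({0..1} :: real set) \<times> (unitary_group :: (complex^'d^'d) set))"
    by (intro compact_Times compact_unitary_group) auto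
  from compact_imp_bounded[OF compact_continuous_image[OF cont' this]]
  obtain C where C: "\<And>\<theta> U. 0 \<le> \<theta> \<Longrightarrow> \<theta> \<le> 1 \<Longrightarrow> U \<in> unitary_group \<Longrightarrow> cmod (F' (of_real \<theta>) U) \<le> C"
    unfolding bounded_iff by force
  have "expectation (F' (of_real 0)) = 0"
  proof (rule integral_derivative_zero[where F="\<lambda>\<theta>. F (of_real \<theta>)" and F'="\<lambda>\<theta>. F' (of_real \<theta>)"])
    show "((\<lambda>\<theta>. F (of_real \<theta>) U) has_vector_derivative F' (of_real \<theta>) U) (at \<theta>)" for \<theta> U
    proof (rule has_vector_derivative_real_field)
      have A: "((\<lambda>z. A z U) has_field_derivative A' z U) (at z)" for z
        unfolding A_def A'_def by (auto intro!: derivative_eq_intros)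
      have T: "((\<lambda>z. T z U) has_field_derivative T' z U) (at z)" for z
        unfolding T_def T'_def by (auto intro!: derivative_eq_intros)
      have S: "((\<lambda>z. S z U) has_field_derivative S' z U) (at z)" for z
        unfolding S_def S'_def by (auto intro!: derivative_eq_intros)
      show "((\<lambda>z. F z U) has_field_derivative F' (of_real \<theta>) U) (at (of_real \<theta>))"
        unfolding F_def
        by (rule DERIV_cong[OF DERIV_mult[OF A DERIV_mult[OF DERIV_power[OF T] DERIV_power[OF S]]]])
           (simp add: F'_def mult_ac)
    qed
    show "expectation (F (of_real \<theta>)) =
        (\<integral>V. V $ i $ j * (dtrace t V ^ m * cnj (dtrace t V) ^ Suc m) \<partial>M)" for \<theta>
      unfolding FR
      by (rule integral_left[OF rotation_unitary[OF ij]]) (intro continuous_intros)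
    show "F' (of_real 0) \<in> borel_measurable M"
      using continuous_on_compose2[OF cont', of unitary_group "\<lambda>U. (0, U)" UNIV]
      by (intro measurable_continuous) (simp add: continuous_intros)
  qed (use C in \<open>auto simp: space_M intro!: integrable_continuous cont\<close>)
  moreover have "F' (of_real 0) = (\<lambda>U. U $ j $ j * dtrace t U ^ m * cnj (dtrace t U) ^ Suc m
      + U $ i $ j * (of_nat m * dtrace t U ^ (m - 1) * q U * cnj (dtrace t U) ^ Suc m
        + of_nat (Suc m) * dtrace t U ^ m * cnj (dtrace t U) ^ m * cnj (q U)))"
    by (rule ext) (simp add: F'_def A_def A'_def T_def S_def T'_def S'_def del: power_Suc of_nat_Suc)
  ultimately show ?thesis by (simp only: q_def)
qed

lemma integral_odd_phase:
  fixes f :: "complex^'d^'d \<Rightarrow> complex"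
  assumes "continuous_on unitary_group f"
    and "\<And>U. f (phase i w ** U ** phase i (cnj w)) = - f U" "cmod w = 1"
  shows "(\<integral>U. f U \<partial>M) = 0"
  using integral_phase_conj[OF assms(3,1), of i] by (simp add: assms(2))

lemma dtrace_phase_conj:
  assumes "cmod w = 1"
  shows "dtrace t (phase i w ** U ** phase i (cnj w)) = dtrace t U"
proof -
  have "w * cnj w = 1" using assms by (metis complex_norm_square of_real_1 one_power2)
  then show ?thesis
    unfolding dtrace_def
    by (intro sum.cong) (auto simp: phase_left phase_right)
qed

text \<open>Conjugation by a phase fixes the diagonal entries, hence the trace, and makes the terms
  of \<open>ward_rotation\<close> with U_ij^2 and with U_ij cnj(U_ji) odd. Three of the five terms
  survive.\<close>

lemma ward_left:
  fixes t :: "'d \<Rightarrow> real"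
  assumes ij: "i \<noteq> j"
  shows "(\<integral>U. U $ j $ j * dtrace t U ^ m * cnj (dtrace t U) ^ Suc m \<partial>M)
      + of_nat m * of_real (t i) *
        (\<integral>U. U $ i $ j * U $ j $ i * dtrace t U ^ (m - 1) * cnj (dtrace t U) ^ Suc m \<partial>M)
    = of_nat (Suc m) * of_real (t j) *
        (\<integral>U. U $ i $ j * cnj (U $ i $ j) * dtrace t U ^ m * cnj (dtrace t U) ^ m \<partial>M)"
proof -
  define f1 where "f1 U = U $ j $ j * dtrace t U ^ m * cnj (dtrace t U) ^ Suc m" for U
  define f2 where "f2 U = U $ i $ j * U $ j $ i * dtrace t U ^ (m - 1) * cnj (dtrace t U) ^ Suc m" for U
  define f3 where "f3 U = U $ i $ j * cnj (U $ i $ j) * dtrace t U ^ m * cnj (dtrace t U) ^ m" for U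
  define f4 where "f4 U = U $ i $ j * U $ i $ j * dtrace t U ^ (m - 1) * cnj (dtrace t U) ^ Suc m" for U
  define f5 where "f5 U = U $ i $ j * cnj (U $ j $ i) * dtrace t U ^ m * cnj (dtrace t U) ^ m" for U
  have cont: "continuous_on unitary_group f1" "continuous_on unitary_group f2"
    "continuous_on unitary_group f3" "continuous_on unitary_group f4" "continuous_on unitary_group f5"
    unfolding f1_def f2_def f3_def f4_def f5_def by (intro continuous_intros)+
  note int = cont[THEN integrable_continuous]
  have ii: "\<i> * (\<i> * z) = - z" for z by (simp flip: mult.assoc)
  \<comment> \<open>The phase is the imaginary unit: U_ij is multiplied by it and U_ji by its
    negative, so both integrands change sign.\<close>
  have "(\<integral>U. f4 U \<partial>M) = 0" "(\<integral>U. f5 U \<partial>M) = 0"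
    using ij
    by (intro integral_odd_phase[of _ i \<i>] cont;
        simp add: f4_def f5_def dtrace_phase_conj[of "\<i>", simplified] phase_left phase_right mult_ac ii)+
  moreover have "(\<integral>U. f1 U + of_nat m * of_real (t i) * f2 U - of_nat m * of_real (t j) * f4 U
      + of_nat (Suc m) * of_real (t i) * f5 U - of_nat (Suc m) * of_real (t j) * f3 U \<partial>M) = 0"
    using ward_rotation[OF ij, of t m]
    by (simp add: f1_def f2_def f3_def f4_def f5_def algebra_simps del: power_Suc of_nat_Suc)
  ultimately show ?thesis
    using int unfolding f1_def[symmetric] f2_def[symmetric] f3_def[symmetric]
    by (simp del: of_nat_Suc)
qed

lemma transpose_nth: "transpose A $ a $ b = A $ b $ a"
  by (simp add: transpose_def)

lemma dtrace_transpose [simp]: "dtrace t (transpose U) = dtrace t U"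
  by (simp add: dtrace_def transpose_nth)

text \<open>Interchanging i and j in \<open>ward_left\<close> alone would bring in U_ji; the
  transposed measure restores U_ij. Both identities then contain the same two off-diagonal
  integrals.\<close>

lemma ward_right:
  fixes t :: "'d \<Rightarrow> real"
  assumes ij: "i \<noteq> j"
  shows "(\<integral>U. U $ i $ i * dtrace t U ^ m * cnj (dtrace t U) ^ Suc m \<partial>M)
      + of_nat m * of_real (t j) *
        (\<integral>U. U $ i $ j * U $ j $ i * dtrace t U ^ (m - 1) * cnj (dtrace t U) ^ Suc m \<partial>M)
    = of_nat (Suc m) * of_real (t i) *
        (\<integral>U. U $ i $ j * cnj (U $ i $ j) * dtrace t U ^ m * cnj (dtrace t U) ^ m \<partial>M)"
proof -
  interpret T: haar "distr M M transpose"
    by (rule haar.intro[OF haar_transpose])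
  have tr: "(\<integral>U. f U \<partial>(distr M M transpose)) = (\<integral>U. f (transpose U) \<partial>M)"
    if "continuous_on unitary_group f" for f :: "_ \<Rightarrow> complex"
    by (rule integral_distr[OF measurable_transpose measurable_continuous[OF that]])
  note w = T.ward_left[OF ij[symmetric], of t m]
  show ?thesis
    using w by (subst (asm) (1 2 3) tr) (simp_all add: transpose_nth mult.commute mult.left_commute
      continuous_intros del: power_Suc of_nat_Suc)
qed

text \<open>The mixed integral of U_ij U_ji enters \<open>ward_left\<close> with t_i and
  \<open>ward_right\<close> with t_j, so it cancels after multiplying them by t_j and t_i and
  subtracting.\<close>

lemma ward:
  fixes t :: "'d \<Rightarrow> real"
  assumes ij: "i \<noteq> j"
  shows "of_real (t j) * (\<integral>U. U $ j $ j * dtrace t U ^ m * cnj (dtrace t U) ^ Suc m \<partial>M)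
      - of_real (t i) * (\<integral>U. U $ i $ i * dtrace t U ^ m * cnj (dtrace t U) ^ Suc m \<partial>M)
    = of_nat (Suc m) * of_real ((t j)\<^sup>2 - (t i)\<^sup>2) *
        (\<integral>U. U $ i $ j * cnj (U $ i $ j) * dtrace t U ^ m * cnj (dtrace t U) ^ m \<partial>M)"
proof -
  have eliminate: "b * p - a * p' = s * (b\<^sup>2 - a\<^sup>2) * r"
    if "p + k * a * q = s * b * r" "p' + k * b * q = s * a * r" for a b k p p' q r s :: complex
  proof -
    have p: "p = s * b * r - k * a * q" using that(1) unfolding eq_diff_eq .
    have p': "p' = s * a * r - k * b * q" using that(2) unfolding eq_diff_eq .
    show ?thesis unfolding p p' by (simp add: algebra_simps power2_eq_square)
  qed
  show ?thesis
    unfolding of_real_diff of_real_power by (rule eliminate[OF ward_left[OF ij] ward_right[OF ij]])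
qed

end

section \<open>The radial equation\<close>

lemma cmod_power2: "(complex_of_real (cmod z))\<^sup>2 = z * cnj z"
  by (metis complex_norm_square of_real_power)

lemma cmod_even_power: "complex_of_real (cmod z) ^ (2 * n) = z ^ n * cnj z ^ n"
  by (simp add: power_mult cmod_power2 power_mult_distrib)

text \<open>Powers of the trace are expanded over words instead of multi-indices, so multinomial
  coefficients never appear: a monomial simply occurs once for every arrangement of its
  letters.\<close>

definition words :: "nat \<Rightarrow> 'd::finite list set" where
  "words n = {w. length w = n}"

lemma finite_words [simp]: "finite (words n :: 'd::finite list set)"
  using finite_lists_length_eq[of "UNIV :: 'd set" n] by (simp add: words_def)

lemma sum_words_Suc:
  fixes f :: "'d::finite list \<Rightarrow> 'b::comm_monoid_add"
  shows "(\<Sum>w\<in>words (Suc n). f w) = (\<Sum>a\<in>UNIV. \<Sum>w\<in>words n. f (a # w))"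
proof -
  have "words (Suc n) = (\<lambda>(a, w). a # w) ` (UNIV \<times> (words n :: 'd list set))"
    by (auto simp: words_def length_Suc_conv image_iff)
  moreover have "inj_on (\<lambda>(a, w). a # w) (UNIV \<times> (words n :: 'd list set))"
    by (auto simp: inj_on_def)
  ultimately show ?thesis
    by (simp add: sum.reindex sum.cartesian_product case_prod_unfold comp_def)
qed

lemma power_sum_words:
  fixes z :: "'d::finite \<Rightarrow> 'b::comm_semiring_1"
  shows "(\<Sum>a\<in>UNIV. z a) ^ n = (\<Sum>w\<in>words n. prod_list (map z w))"
proof (induction n)
  case 0
  then show ?case by (simp add: words_def)
next
  case (Suc n)
  then show ?case by (simp add: sum_words_Suc sum_product)
qed

text \<open>This is z_i d/dz_i applied to \<open>power_sum_words\<close>: on a word it multiplies by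
  the number of letters i.\<close>

lemma power_sum_words_count:
  fixes z :: "'d::finite \<Rightarrow> 'b::comm_ring_1"
  shows "of_nat n * z i * (\<Sum>a\<in>UNIV. z a) ^ (n - 1) =
    (\<Sum>w\<in>words n. of_nat (count_list w i) * prod_list (map z w))"
proof (induction n)
  case 0
  then show ?case by (simp add: words_def)
next
  case (Suc n)
  let ?S = "\<Sum>a\<in>UNIV. z a"
  have "(\<Sum>w\<in>words (Suc n). of_nat (count_list w i) * prod_list (map z w)) =
      (\<Sum>a\<in>UNIV. \<Sum>w\<in>words n. (if a = i then z a * prod_list (map z w) else 0)
        + z a * (of_nat (count_list w i) * prod_list (map z w)))"
    unfolding sum_words_Suc by (intro sum.cong refl) (auto simp: algebra_simps)
  also have "\<dots> = z i * (\<Sum>w\<in>words n. prod_list (map z w))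
      + ?S * (\<Sum>w\<in>words n. of_nat (count_list w i) * prod_list (map z w))"
    by (simp add: sum.distrib sum_distrib_left sum_distrib_right sum.swap[of _ UNIV "words n"])
       (simp add: sum.swap[of _ "words n" UNIV])
  also have "\<dots> = z i * ?S ^ n + ?S * (of_nat n * z i * ?S ^ (n - 1))"
    by (simp only: Suc.IH[symmetric] power_sum_words)
  also have "?S * (of_nat n * z i * ?S ^ (n - 1)) = of_nat n * z i * ?S ^ n"
    by (cases n) (auto simp: mult_ac)
  finally show ?case by (simp add: algebra_simps)
qed

lemma prod_list_map_count:
  fixes g :: "'d::finite \<Rightarrow> 'b::comm_monoid_mult"
  shows "prod_list (map g w) = (\<Prod>a\<in>UNIV. g a ^ count_list w a)"
proof (induction w)
  case (Cons b w)
  have "(\<Prod>a\<in>UNIV. g a ^ count_list (b # w) a) =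
      (\<Prod>a\<in>UNIV. (if a = b then g a else 1) * g a ^ count_list w a)"
    by (intro prod.cong) auto
  then show ?case using Cons by (simp add: prod.distrib)
qed simp

lemma sum_count_list_UNIV: "(\<Sum>a\<in>UNIV. count_list w a) = length (w :: 'd::finite list)"
proof (induction w)
  case (Cons b w)
  have "count_list (b # w) a = (if a = b then 1 else 0) + count_list w a" for a by simp
  then show ?case using Cons by (simp only: sum.distrib) simp
qed simp

text \<open>The pairs of words whose product survives averaging over diagonal unitary
  matrices.\<close>

definition balanced :: "nat \<Rightarrow> ('d::finite list \<times> 'd list) set" where
  "balanced n = {(v, w) \<in> words n \<times> words n. count_list v = count_list w}"

lemma finite_balanced [simp]: "finite (balanced n :: ('d::finite list \<times> 'd list) set)"
  by (rule finite_subset[of _ "words n \<times> words n"]) (auto simp: balanced_def)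

section \<open>Averaging over the diagonal torus\<close>

context haar
begin

definition diag_moment :: "('d \<Rightarrow> nat) \<Rightarrow> real" where
  "diag_moment \<alpha> = (\<integral>U. (cmod (\<Prod>a\<in>UNIV. (U $ a $ a) ^ \<alpha> a))\<^sup>2 \<partial>M)"

text \<open>If the exponents differ at i, multiplying row i by a suitable phase changes the sign of
  the integrand.\<close>

lemma integral_diag_monomials:
  "(\<integral>U. (\<Prod>a\<in>UNIV. (U $ a $ a) ^ \<alpha> a) * cnj (\<Prod>a\<in>UNIV. (U $ a $ a) ^ \<beta> a) \<partial>M) =
    (if \<alpha> = \<beta> then of_real (diag_moment \<alpha>) else 0)"
proof (cases "\<alpha> = \<beta>")
  case True
  then show ?thesis
    by (simp add: diag_moment_def flip: integral_complex_of_real complex_norm_square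
        del: cnj_prod complex_cnj_power of_real_power)
next
  case False
  then obtain i where i: "\<alpha> i \<noteq> \<beta> i" by auto
  let ?f = "\<lambda>U :: complex^'d^'d. (\<Prod>a\<in>UNIV. (U $ a $ a) ^ \<alpha> a) * cnj (\<Prod>a\<in>UNIV. (U $ a $ a) ^ \<beta> a)"
  \<comment> \<open>Chosen so that the difference of the two exponents at i times the angle is
    exactly pi; this works for either sign of the difference.\<close>
  define x where "x = pi / (real (\<alpha> i) - real (\<beta> i))"
  define w where "w = cis x"
  have "w ^ \<alpha> i * cnj (w ^ \<beta> i) = cis (real (\<alpha> i) * x + - (real (\<beta> i) * x))"
    by (simp only: w_def Complex.DeMoivre cis_cnj cis_mult)
  also have "real (\<alpha> i) * x + - (real (\<beta> i) * x) = (real (\<alpha> i) - real (\<beta> i)) * x"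
    by (simp add: left_diff_distrib)
  also have "\<dots> = pi" using i by (simp add: x_def)
  finally have w: "w ^ \<alpha> i * cnj (w ^ \<beta> i) = -1" by simp
  have prod: "(\<Prod>a\<in>UNIV. ((phase i w ** U) $ a $ a) ^ \<gamma> a) = w ^ \<gamma> i * (\<Prod>a\<in>UNIV. (U $ a $ a) ^ \<gamma> a)"
    for U and \<gamma> :: "'d \<Rightarrow> nat"
  proof -
    have "(\<Prod>a\<in>UNIV. ((phase i w ** U) $ a $ a) ^ \<gamma> a) =
       (\<Prod>a\<in>UNIV. (if a = i then w ^ \<gamma> a else 1) * (U $ a $ a) ^ \<gamma> a)"
      by (intro prod.cong) (auto simp: phase_left power_mult_distrib)
    then show ?thesis by (simp add: prod.distrib)
  qed
  have "?f (phase i w ** U) = (w ^ \<alpha> i * cnj (w ^ \<beta> i)) * ?f U" for U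
    unfolding prod by (simp add: mult_ac)
  then have "?f (phase i w ** U) = - ?f U" for U
    unfolding w by simp
  moreover have "(\<integral>U. ?f (phase i w ** U) \<partial>M) = (\<integral>U. ?f U \<partial>M)"
    by (intro integral_left[where f="?f"] phase_unitary continuous_intros) (simp add: w_def)
  ultimately show ?thesis using False by simp
qed

text \<open>On balanced pairs the weights t_a occur only through their squares, which makes the
  integral a polynomial in x. The factors \<open>f\<close> and \<open>g\<close> are free so that the
  moment and its first and second derivatives are all instances.\<close>

lemma integral_word_sums:
  fixes t :: "'d \<Rightarrow> real" and f g :: "'d list \<Rightarrow> real"
  shows "(\<integral>U. (\<Sum>v\<in>words n. of_real (f v) * prod_list (map (\<lambda>a. of_real (t a) * U $ a $ a) v)) *
      cnj (\<Sum>w\<in>words n. of_real (g w) * prod_list (map (\<lambda>a. of_real (t a) * U $ a $ a) w)) \<partial>M) =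
    of_real (\<Sum>(v, w)\<in>balanced n. f v * g w * (diag_moment (count_list v) *
      (\<Prod>a\<in>UNIV. ((t a)\<^sup>2) ^ count_list v a)))"
proof -
  define T where "T v = (\<Prod>a\<in>UNIV. t a ^ count_list v a)" for v
  define u where "u v U = (\<Prod>a\<in>UNIV. (U $ a $ a) ^ count_list v a)" for v and U :: "complex^'d^'d"
  have pl: "prod_list (map (\<lambda>a. of_real (t a) * U $ a $ a) v) = of_real (T v) * u v U" for v U
    unfolding T_def u_def prod_list_map_count
    by (simp add: power_mult_distrib prod.distrib)
  have "(\<integral>U. (\<Sum>v\<in>words n. of_real (f v) * (of_real (T v) * u v U)) *
      cnj (\<Sum>w\<in>words n. of_real (g w) * (of_real (T w) * u w U)) \<partial>M) =
      (\<integral>U. (\<Sum>v\<in>words n. \<Sum>w\<in>words n. of_real (f v * g w * (T v * T w)) * (u v U * cnj (u w U))) \<partial>M)"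
    by (simp add: sum_product mult_ac)
  also have "\<dots> = (\<Sum>v\<in>words n. \<Sum>w\<in>words n. of_real (f v * g w * (T v * T w)) * (\<integral>U. u v U * cnj (u w U) \<partial>M))"
    unfolding u_def
    by (subst Bochner_Integration.integral_sum,
        intro integrable_continuous continuous_intros,
        intro sum.cong refl,
        subst Bochner_Integration.integral_sum,
        intro integrable_continuous continuous_intros,
        intro sum.cong refl integral_mult_right_zero)
  also have "\<dots> = (\<Sum>v\<in>words n. \<Sum>w\<in>words n. if count_list v = count_list w then
      of_real (f v * g w * (diag_moment (count_list v) * (T v)\<^sup>2)) else 0)"
    unfolding u_def integral_diag_monomials
    by (intro sum.cong refl) (auto simp: T_def power2_eq_square)
  also have "\<dots> = (\<Sum>p\<in>words n \<times> words n. if count_list (fst p) = count_list (snd p) then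
      of_real (f (fst p) * g (snd p) * (diag_moment (count_list (fst p)) * (T (fst p))\<^sup>2)) else 0)"
    by (simp add: sum.cartesian_product case_prod_unfold)
  also have "\<dots> = (\<Sum>p\<in>balanced n.
      of_real (f (fst p) * g (snd p) * (diag_moment (count_list (fst p)) * (T (fst p))\<^sup>2)))"
    by (rule sum.mono_neutral_cong_right) (auto simp: balanced_def)
  finally show ?thesis
    unfolding pl by (simp add: case_prod_unfold T_def flip: prod_power_distrib power_mult)
      (simp add: prod_power_distrib mult.commute flip: power_mult)
qed

section \<open>Moments and their derivatives\<close>

definition moment :: "nat \<Rightarrow> ('d \<Rightarrow> real) \<Rightarrow> real" where
  "moment n t = (\<integral>U. cmod (dtrace t U) ^ (2 * n) \<partial>M)"

definition entry_moment :: "nat \<Rightarrow> ('d \<Rightarrow> real) \<Rightarrow> 'd \<Rightarrow> 'd \<Rightarrow> real" where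
  "entry_moment n t i j = (\<integral>U. (cmod (U $ i $ j))\<^sup>2 * cmod (dtrace t U) ^ (2 * n) \<partial>M)"

text \<open>With \<open>f\<close> equal to 1, to the number of letters i, or to its square, this is
  G_n, th_i G_n or th_i^2 G_n, evaluated at x_a = t_a^2.\<close>

definition wsum :: "nat \<Rightarrow> ('d \<Rightarrow> real) \<Rightarrow> ('d list \<Rightarrow> real) \<Rightarrow> real" where
  "wsum n t f = (\<Sum>(v, w)\<in>balanced n. f v * (diag_moment (count_list v) *
      (\<Prod>a\<in>UNIV. ((t a)\<^sup>2) ^ count_list v a)))"

lemma integral_entry_moment:
  "(\<integral>U. U $ i $ j * cnj (U $ i $ j) * dtrace t U ^ n * cnj (dtrace t U) ^ n \<partial>M) =
    of_real (entry_moment n t i j)"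
proof -
  have "U $ i $ j * cnj (U $ i $ j) * dtrace t U ^ n * cnj (dtrace t U) ^ n =
      of_real ((cmod (U $ i $ j))\<^sup>2 * cmod (dtrace t U) ^ (2 * n))" for U :: "complex^'d^'d"
    unfolding of_real_mult of_real_power cmod_even_power cmod_power2 by (simp add: mult_ac)
  then show ?thesis
    unfolding entry_moment_def by (simp only: integral_complex_of_real)
qed

lemma dtrace_power: "dtrace t U ^ n =
    (\<Sum>w\<in>words n. prod_list (map (\<lambda>a. of_real (t a) * U $ a $ a) w))"
  unfolding dtrace_def by (rule power_sum_words)

lemma dtrace_power_count: "of_nat n * (of_real (t i) * U $ i $ i) * dtrace t U ^ (n - 1) =
    (\<Sum>w\<in>words n. of_nat (count_list w i) * prod_list (map (\<lambda>a. of_real (t a) * U $ a $ a) w))"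
  unfolding dtrace_def by (rule power_sum_words_count)

lemma moment_expansion: "moment n t = wsum n t (\<lambda>_. 1)"
proof -
  have "complex_of_real (moment n t) = (\<integral>U. of_real (cmod (dtrace t U) ^ (2 * n)) \<partial>M)"
    unfolding moment_def by (rule integral_complex_of_real[symmetric])
  also have "\<dots> = (\<integral>U. dtrace t U ^ n * cnj (dtrace t U ^ n) \<partial>M)"
    by (simp add: cmod_even_power)
  also have "\<dots> = of_real (wsum n t (\<lambda>_. 1))"
    using integral_word_sums[where n=n and t=t and f="\<lambda>_. 1" and g="\<lambda>_. 1"]
    unfolding dtrace_power wsum_def by simp
  finally show ?thesis by (simp only: of_real_eq_iff)
qed

lemma first_order_expansion:
  "of_nat n * of_real (t i) * (\<integral>U. U $ i $ i * dtrace t U ^ (n - 1) * cnj (dtrace t U) ^ n \<partial>M)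
    = of_real (wsum n t (\<lambda>v. real (count_list v i)))"
proof -
  have "of_nat n * of_real (t i) * (\<integral>U. U $ i $ i * dtrace t U ^ (n - 1) * cnj (dtrace t U) ^ n \<partial>M)
    = (\<integral>U. (of_nat n * (of_real (t i) * U $ i $ i) * dtrace t U ^ (n - 1)) *
        cnj (dtrace t U ^ n) \<partial>M)"
    by (simp add: mult_ac flip: integral_mult_right_zero)
  also have "\<dots> = of_real (wsum n t (\<lambda>v. real (count_list v i)))"
    using integral_word_sums[where n=n and t=t and f="\<lambda>v. real (count_list v i)" and g="\<lambda>_. 1"]
    unfolding dtrace_power_count unfolding dtrace_power wsum_def by simp
  finally show ?thesis .
qed

text \<open>The squared modulus of a first derivative of T^n yields one count from each word of a
  pair. On balanced pairs the counts agree, so their product is the square that represents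
  th_i^2.\<close>

lemma second_order_expansion:
  "(real n)\<^sup>2 * (t i)\<^sup>2 * entry_moment (n - 1) t i i
    = wsum n t (\<lambda>v. (real (count_list v i))\<^sup>2)"
proof -
  have "of_real ((real n)\<^sup>2 * (t i)\<^sup>2 * entry_moment (n - 1) t i i)
    = (\<integral>U. (of_nat n * (of_real (t i) * U $ i $ i) * dtrace t U ^ (n - 1)) *
        cnj (of_nat n * (of_real (t i) * U $ i $ i) * dtrace t U ^ (n - 1)) \<partial>M)"
    by (simp add: power2_eq_square mult_ac flip: integral_mult_right_zero integral_entry_moment)
  also have "\<dots> = of_real (\<Sum>(v, w)\<in>balanced n. real (count_list v i) * real (count_list w i) *
      (diag_moment (count_list v) * (\<Prod>a\<in>UNIV. ((t a)\<^sup>2) ^ count_list v a)))"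
    using integral_word_sums[where n=n and t=t and f="\<lambda>v. real (count_list v i)" and g="\<lambda>v. real (count_list v i)"]
    unfolding dtrace_power_count by simp
  also have "(\<Sum>(v, w)\<in>balanced n. real (count_list v i) * real (count_list w i) *
      (diag_moment (count_list v) * (\<Prod>a\<in>UNIV. ((t a)\<^sup>2) ^ count_list v a)))
    = wsum n t (\<lambda>v. (real (count_list v i))\<^sup>2)"
    unfolding wsum_def
    by (intro sum.cong refl) (auto simp: balanced_def power2_eq_square)
  finally show ?thesis by (simp only: of_real_eq_iff)
qed

lemma sum_entry_moment: "(\<Sum>j\<in>UNIV. entry_moment n t i j) = moment n t"
proof -
  have "(\<Sum>j\<in>UNIV. entry_moment n t i j) =
      (\<integral>U. (\<Sum>j\<in>UNIV. (cmod (U $ i $ j))\<^sup>2 * cmod (dtrace t U) ^ (2 * n)) \<partial>M)"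
    unfolding entry_moment_def
    by (rule Bochner_Integration.integral_sum[symmetric]) (intro integrable_continuous continuous_intros)
  also have "\<dots> = moment n t"
    unfolding moment_def sum_distrib_right[symmetric]
    by (rule Bochner_Integration.integral_cong) (auto simp: space_M unitary_row)
  finally show ?thesis .
qed

lemma off_diagonal_moment:
  assumes "i \<noteq> j" "(t i)\<^sup>2 \<noteq> (t j)\<^sup>2"
  shows "(real (Suc m))\<^sup>2 * entry_moment m t i j =
    (wsum (Suc m) t (\<lambda>v. real (count_list v i)) - wsum (Suc m) t (\<lambda>v. real (count_list v j)))
      / ((t i)\<^sup>2 - (t j)\<^sup>2)"
proof -
  let ?\<theta> = "\<lambda>i. wsum (Suc m) t (\<lambda>v. real (count_list v i))"
  have "of_real (?\<theta> j) - of_real (?\<theta> i) = of_nat (Suc m) *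
      (of_real (t j) * (\<integral>U. U $ j $ j * dtrace t U ^ m * cnj (dtrace t U) ^ Suc m \<partial>M)
      - of_real (t i) * (\<integral>U. U $ i $ i * dtrace t U ^ m * cnj (dtrace t U) ^ Suc m \<partial>M))"
    using first_order_expansion[of "Suc m" t i] first_order_expansion[of "Suc m" t j]
    by (simp add: right_diff_distrib mult.assoc del: power_Suc of_nat_Suc)
  also have "\<dots> = of_real ((real (Suc m))\<^sup>2 * ((t j)\<^sup>2 - (t i)\<^sup>2) * entry_moment m t i j)"
    unfolding ward[OF assms(1)] integral_entry_moment
    by (simp add: power2_eq_square mult_ac del: power_Suc of_nat_Suc)
  finally have "?\<theta> j - ?\<theta> i = (real (Suc m))\<^sup>2 * ((t j)\<^sup>2 - (t i)\<^sup>2) * entry_moment m t i j"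
    by (simp only: of_real_eq_iff flip: of_real_diff)
  then show ?thesis
    using assms(2) by (simp add: field_simps del: of_nat_Suc)
qed

text \<open>The unit norm of row i is multiplied by x_i before summing over i; this is the factor
  that turns the diagonal entry into th_i^2 G. The terms for (i, j) and (j, i) together have the
  coefficient (x_i + x_j)/(x_i - x_j).\<close>

lemma radial_equation:
  assumes "\<And>i j. i \<noteq> j \<Longrightarrow> (t i)\<^sup>2 \<noteq> (t j)\<^sup>2"
  shows "(real (Suc m))\<^sup>2 * (\<Sum>i\<in>UNIV. (t i)\<^sup>2) * moment m t =
    (\<Sum>i\<in>UNIV. wsum (Suc m) t (\<lambda>v. (real (count_list v i))\<^sup>2)) +
    (\<Sum>i\<in>UNIV. \<Sum>j\<in>UNIV - {i}. (t i)\<^sup>2 *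
      (wsum (Suc m) t (\<lambda>v. real (count_list v i)) - wsum (Suc m) t (\<lambda>v. real (count_list v j)))
      / ((t i)\<^sup>2 - (t j)\<^sup>2))"
proof -
  have "(real (Suc m))\<^sup>2 * (t i)\<^sup>2 * moment m t =
      wsum (Suc m) t (\<lambda>v. (real (count_list v i))\<^sup>2) +
      (\<Sum>j\<in>UNIV - {i}. (t i)\<^sup>2 * (wsum (Suc m) t (\<lambda>v. real (count_list v i))
        - wsum (Suc m) t (\<lambda>v. real (count_list v j))) / ((t i)\<^sup>2 - (t j)\<^sup>2))" for i
  proof -
    have "(real (Suc m))\<^sup>2 * (t i)\<^sup>2 * moment m t =
        (\<Sum>j\<in>UNIV. (real (Suc m))\<^sup>2 * (t i)\<^sup>2 * entry_moment m t i j)"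
      by (simp add: sum_distrib_left flip: sum_entry_moment[of m t i])
    also have "\<dots> = (real (Suc m))\<^sup>2 * (t i)\<^sup>2 * entry_moment m t i i +
        (\<Sum>j\<in>UNIV - {i}. (t i)\<^sup>2 * ((real (Suc m))\<^sup>2 * entry_moment m t i j))"
      by (subst sum.remove[of _ i]) (auto simp: mult_ac)
    also have "(real (Suc m))\<^sup>2 * (t i)\<^sup>2 * entry_moment m t i i =
        wsum (Suc m) t (\<lambda>v. (real (count_list v i))\<^sup>2)"
      using second_order_expansion[of "Suc m" t i] by simp
    also have "(\<Sum>j\<in>UNIV - {i}. (t i)\<^sup>2 * ((real (Suc m))\<^sup>2 * entry_moment m t i j)) =
        (\<Sum>j\<in>UNIV - {i}. (t i)\<^sup>2 * (wsum (Suc m) t (\<lambda>v. real (count_list v i))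
        - wsum (Suc m) t (\<lambda>v. real (count_list v j))) / ((t i)\<^sup>2 - (t j)\<^sup>2))"
      using assms by (intro sum.cong refl) (subst off_diagonal_moment, auto)
    finally show ?thesis .
  qed
  then show ?thesis
    by (simp add: sum_distrib_left sum_distrib_right flip: sum.distrib)
qed

text \<open>Conjugation by a permutation matrix permutes the diagonal; this gives the symmetry of
  G_n.\<close>

lemma moment_transpose: "moment n (t \<circ> Transposition.transpose i j) = moment n t"
proof -
  let ?p = "Transposition.transpose i j"
  define R :: "complex^'d^'d" where "R = (\<chi> a b. if ?p a = b then 1 else 0)"
  have R_left: "(R ** U) $ a $ b = U $ ?p a $ b" for U :: "complex^'d^'d" and a b
    unfolding R_def matrix_matrix_mult_def by (simp add: if_distrib[of "\<lambda>x. x * _"] cong: if_cong)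
  have R_right: "(U ** R) $ a $ b = U $ a $ ?p b" for U :: "complex^'d^'d" and a b
  proof -
    have "(U ** R) $ a $ b = (\<Sum>k\<in>UNIV. if ?p b = k then U $ a $ k else 0)"
      unfolding R_def matrix_matrix_mult_def vec_lambda_beta by (intro sum.cong) auto
    then show ?thesis by simp
  qed
  have "adjoint_matrix R = R"
    by (auto simp: vec_eq_iff R_def)
  moreover have "R ** R = mat 1"
    unfolding vec_eq_iff R_left by (auto simp: R_def mat_def)
  ultimately have R: "R \<in> unitary_group"
    by (simp add: unitary_group_def unitary_matrix_def)
  have "dtrace t (R ** U ** R) = dtrace (t \<circ> ?p) U" for U
    unfolding dtrace_def R_left R_right
    by (rule sum.reindex_bij_witness[of _ ?p ?p]) (auto simp: R_left)
  then show ?thesis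
    using integral_left[OF R, of "\<lambda>U. cmod (dtrace t (U ** R)) ^ (2 * n)"]
      integral_right[OF R, of "\<lambda>U. cmod (dtrace t U) ^ (2 * n)"]
    unfolding moment_def by (simp add: continuous_intros)
qed

end

section \<open>Alternants\<close>

text \<open>The determinant of the matrix \<open>\<phi> i (l j)\<close>, kept as a Leibniz sum
  because most identities below hold permutation by permutation; column operations go through
  \<open>alternant_det\<close>.\<close>

definition alternant :: "nat \<Rightarrow> (nat \<Rightarrow> nat \<Rightarrow> real) \<Rightarrow> (nat \<Rightarrow> nat) \<Rightarrow> real" where
  "alternant n \<phi> l = (\<Sum>p | p permutes {..<n}. of_int (sign p) * (\<Prod>i<n. \<phi> i (l (p i))))"

lemma alternant_cong:
  assumes "\<And>i j. i < n \<Longrightarrow> j < n \<Longrightarrow> \<phi> i (l j) = \<psi> i (m j)"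
  shows "alternant n \<phi> l = alternant n \<psi> m"
  unfolding alternant_def
  by (intro sum.cong refl arg_cong2[of _ _ _ _ "(*)"] prod.cong)
     (auto intro!: assms dest: permutes_in_image)

lemma alternant_det: "alternant n \<phi> l = Determinant.det (Matrix.mat n n (\<lambda>(i, j). \<phi> i (l j)))"
  unfolding alternant_def
  by (subst Determinant.det_def'[of _ n])
     (auto simp: atLeast0LessThan intro!: sum.cong prod.cong dest: permutes_in_image)

text \<open>The choices \<open>m\<close> are indexed by columns. Their range is then the same for
  every permutation, and the sum over them can be exchanged with the Leibniz sum.\<close>

lemma prod_sum_permuted:
  fixes \<psi> :: "nat \<Rightarrow> nat \<Rightarrow> real"
  assumes p: "p permutes {..<r}" and fin: "\<And>j. finite (I j)"
  shows "(\<Prod>i<r. \<Sum>k\<in>I (p i). \<psi> i k) = (\<Sum>m\<in>PiE {..<r} I. \<Prod>i<r. \<psi> i (m (p i)))"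
proof -
  have "(\<Prod>i<r. \<Sum>k\<in>I (p i). \<psi> i k) = (\<Prod>i<r. \<Sum>k\<in>I (p i). \<psi> (Hilbert_Choice.inv p (p i)) k)"
    using permutes_inverses(2)[OF p] by simp
  also have "\<dots> = (\<Prod>j<r. \<Sum>k\<in>I j. \<psi> (Hilbert_Choice.inv p j) k)"
    using prod.permute[OF p, of "\<lambda>j. \<Sum>k\<in>I j. \<psi> (Hilbert_Choice.inv p j) k"] by (simp add: comp_def)
  also have "\<dots> = (\<Sum>m\<in>PiE {..<r} I. \<Prod>j<r. \<psi> (Hilbert_Choice.inv p j) (m j))"
    by (rule prod_sum_PiE) (auto simp: fin)
  also have "\<dots> = (\<Sum>m\<in>PiE {..<r} I. \<Prod>i<r. \<psi> i (m (p i)))"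
    by (intro sum.cong refl, subst prod.permute[OF p])
       (simp add: comp_def permutes_inverses(2)[OF p])
  finally show ?thesis .
qed

text \<open>Subtracting adjacent columns turns the row of ones into a unit vector; the remaining
  entries telescope.\<close>

lemma alternant_ones:
  assumes ones: "\<And>k. \<phi> 0 k = 1" and mono: "\<And>j. j < r \<Longrightarrow> l j \<le> l (Suc j)"
  shows "alternant (Suc r) \<phi> l = (\<Sum>m\<in>PiE {..<r} (\<lambda>j. {l j..<l (Suc j)}).
      alternant r (\<lambda>i k. \<phi> (Suc i) (Suc k) - \<phi> (Suc i) k) m)"
proof -
  let ?\<psi> = "\<lambda>i k. \<phi> (Suc i) (Suc k) - \<phi> (Suc i) k"
  define A where "A = Matrix.mat (Suc r) (Suc r) (\<lambda>(i, j). \<phi> i (l j))"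
  define E :: "real Matrix.mat" where
    "E = Matrix.mat (Suc r) (Suc r) (\<lambda>(i, j). (if i = j then 1 else 0) + (if Suc i = j then - 1 else 0))"
  define B where "B = A * E"
  have A: "A \<in> carrier_mat (Suc r) (Suc r)" and E: "E \<in> carrier_mat (Suc r) (Suc r)"
    by (auto simp: A_def E_def)
  then have B: "B \<in> carrier_mat (Suc r) (Suc r)" by (simp add: B_def)
  have "Determinant.det E = 1"
    by (subst Determinant.det_upper_triangular[OF _ E])
       (auto simp: E_def upper_triangular_def prod_list_diag_prod)
  then have "Determinant.det A = Determinant.det B"
    unfolding B_def by (subst Determinant.det_mult[OF A E]) simp
  have Bij: "B $$ (i, j) = \<phi> i (l j) - (if j = 0 then 0 else \<phi> i (l (j - 1)))"
    if "i < Suc r" "j < Suc r" for i j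
  proof -
    have "B $$ (i, j) = (\<Sum>k<Suc r. \<phi> i (l k) * ((if k = j then 1 else 0) + (if Suc k = j then - 1 else 0)))"
      using that unfolding B_def A_def E_def
      by (simp add: scalar_prod_def atLeast0LessThan del: sum.lessThan_Suc)
    also have "\<dots> = (\<Sum>k<Suc r. if k = j then \<phi> i (l k) else 0) - (\<Sum>k<Suc r. if Suc k = j then \<phi> i (l k) else 0)"
      unfolding sum_subtractf[symmetric] by (intro sum.cong) auto
    also have "(\<Sum>k<Suc r. if k = j then \<phi> i (l k) else 0) = \<phi> i (l j)"
      using that by (simp del: sum.lessThan_Suc)
    also have "(\<Sum>k<Suc r. if Suc k = j then \<phi> i (l k) else 0) = (if j = 0 then 0 else \<phi> i (l (j - 1)))"
      using that by (cases j) (simp_all del: sum.lessThan_Suc)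
    finally show ?thesis .
  qed
  have "Determinant.det B = (\<Sum>j<Suc r. if j = 0 then cofactor B 0 0 else 0)"
    unfolding laplace_expansion_row[OF B zero_less_Suc]
    by (intro sum.cong refl) (auto simp: Bij ones)
  also have "\<dots> = Determinant.det (mat_delete B 0 0)"
    by (simp add: cofactor_def del: sum.lessThan_Suc)
  also have "mat_delete B 0 0 = Matrix.mat r r (\<lambda>(i, j). \<phi> (Suc i) (l (Suc j)) - \<phi> (Suc i) (l j))"
    using B by (auto simp: mat_delete_def Bij)
  also have "Determinant.det \<dots> = (\<Sum>p | p permutes {..<r}. of_int (sign p) *
      (\<Prod>i<r. \<phi> (Suc i) (l (Suc (p i))) - \<phi> (Suc i) (l (p i))))"
    by (subst Determinant.det_def'[of _ r])
       (auto simp: atLeast0LessThan intro!: sum.cong prod.cong dest: permutes_in_image)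
  also have "\<dots> = (\<Sum>p | p permutes {..<r}. of_int (sign p) *
      (\<Prod>i<r. \<Sum>k\<in>{l (p i)..<l (Suc (p i))}. ?\<psi> i k))"
  proof (intro sum.cong refl arg_cong2[of _ _ _ _ "(*)"] prod.cong)
    fix p i assume "p \<in> {p. p permutes {..<r}}" "i \<in> {..<r}"
    then have "p i < r" using permutes_in_image[of p "{..<r}" i] by auto
    then show "\<phi> (Suc i) (l (Suc (p i))) - \<phi> (Suc i) (l (p i)) =
        (\<Sum>k\<in>{l (p i)..<l (Suc (p i))}. ?\<psi> i k)"
      using sum_Suc_diff'[OF mono, of "p i" "\<phi> (Suc i)"] by simp
  qed
  also have "\<dots> = (\<Sum>p | p permutes {..<r}. \<Sum>m\<in>PiE {..<r} (\<lambda>j. {l j..<l (Suc j)}).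
      of_int (sign p) * (\<Prod>i<r. ?\<psi> i (m (p i))))"
    by (intro sum.cong refl)
       (simp add: prod_sum_permuted[where I="\<lambda>j. {l j..<l (Suc j)}" and \<psi>="?\<psi>"] sum_distrib_left)
  also have "\<dots> = (\<Sum>m\<in>PiE {..<r} (\<lambda>j. {l j..<l (Suc j)}). alternant r ?\<psi> m)"
    unfolding alternant_def by (rule sum.swap)
  finally show ?thesis
    using \<open>Determinant.det A = Determinant.det B\<close> by (simp add: alternant_det A_def)
qed

text \<open>Composing with the transposition reverses the sign and keeps \<open>f\<close>, so the
  sum equals its own negative.\<close>

lemma sum_sign_cancel:
  fixes f :: "('a \<Rightarrow> 'a) \<Rightarrow> real"
  assumes "finite S" "a \<in> S" "b \<in> S" "a \<noteq> b"
    and "\<And>p. p permutes S \<Longrightarrow> f (Transposition.transpose a b \<circ> p) = f p"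
  shows "(\<Sum>p | p permutes S. of_int (sign p) * f p) = 0"
proof -
  let ?t = "Transposition.transpose a b"
  have t: "?t permutes S" using assms by (simp add: permutes_swap_id)
  have "(\<Sum>p | p permutes S. of_int (sign p) * f p) =
      (\<Sum>p | p permutes S. of_int (sign (?t \<circ> p)) * f (?t \<circ> p))"
    by (rule setum_permutations_compose_left[OF t])
  also have "\<dots> = (\<Sum>p | p permutes S. - (of_int (sign p) * f p))"
  proof (intro sum.cong refl)
    fix p assume "p \<in> {p. p permutes S}"
    then have p: "p permutes S" by simp
    have "sign (?t \<circ> p) = - sign p"
      using assms p t
      by (subst sign_compose) (auto simp: sign_swap_id permutation_permutes)
    then show "of_int (sign (?t \<circ> p)) * f (?t \<circ> p) = - (of_int (sign p) * f p)"
      using assms(5)[OF p] by simp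
  qed
  finally show ?thesis by (simp add: sum_negf)
qed

lemma alternant_repeated:
  assumes "a < n" "b < n" "a \<noteq> b" "l a = l b"
  shows "alternant n \<phi> l = 0"
  unfolding alternant_def
  using assms
  by (intro sum_sign_cancel[where a=a and b=b]) (auto simp: Transposition.transpose_def intro!: prod.cong)

lemma alternant_swap:
  assumes "a < n" "b < n" "a \<noteq> b"
  shows "alternant n (\<lambda>i. \<phi> (Transposition.transpose a b i)) l = - alternant n \<phi> l"
proof -
  let ?t = "Transposition.transpose a b"
  have t: "?t permutes {..<n}" using assms by (simp add: permutes_swap_id)
  have "alternant n (\<lambda>i. \<phi> (?t i)) l =
      (\<Sum>p | p permutes {..<n}. of_int (sign (p \<circ> ?t)) * (\<Prod>i<n. \<phi> (?t i) (l ((p \<circ> ?t) i))))"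
    unfolding alternant_def by (rule sum_permutations_compose_right[OF t])
  also have "\<dots> = (\<Sum>p | p permutes {..<n}. - (of_int (sign p) * (\<Prod>i<n. \<phi> i (l (p i)))))"
  proof (intro sum.cong refl)
    fix p assume "p \<in> {p. p permutes {..<n}}"
    then have p: "p permutes {..<n}" by simp
    have "sign (p \<circ> ?t) = - sign p"
      using assms p t
      by (subst sign_compose) (auto simp: sign_swap_id permutation_permutes)
    moreover have "(\<Prod>i<n. \<phi> (?t i) (l ((p \<circ> ?t) i))) = (\<Prod>i<n. \<phi> i (l (p i)))"
      using prod.permute[OF t, of "\<lambda>i. \<phi> i (l (p i))"] by (simp add: comp_def)
    ultimately show "of_int (sign (p \<circ> ?t)) * (\<Prod>i<n. \<phi> (?t i) (l ((p \<circ> ?t) i))) =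
        - (of_int (sign p) * (\<Prod>i<n. \<phi> i (l (p i))))" by simp
  qed
  finally show ?thesis by (simp add: sum_negf alternant_def)
qed

section \<open>Gelfand-Tsetlin sums\<close>

text \<open>Partitions are functions on row indices. The shifted parts are listed increasingly, so that
  the alternants below have the sign of the Vandermonde product.\<close>

definition shifted :: "nat \<Rightarrow> (nat \<Rightarrow> nat) \<Rightarrow> nat \<Rightarrow> nat" where
  "shifted d \<nu> j = \<nu> (d - Suc j) + j"

text \<open>Consecutive rows of a Gelfand-Tsetlin pattern; for \<nu> with at most r + 1 rows,
  \<nu>/\<mu> is a horizontal strip. Padding with zeros makes the function representing a shape
  unique.\<close>

definition interlacing :: "nat \<Rightarrow> (nat \<Rightarrow> nat) \<Rightarrow> (nat \<Rightarrow> nat) set" where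
  "interlacing r \<nu> = {\<mu>. (\<forall>i<r. \<nu> (Suc i) \<le> \<mu> i \<and> \<mu> i \<le> \<nu> i) \<and> (\<forall>i\<ge>r. \<mu> i = 0)}"

lemma interlacing_decseq:
  assumes "decseq \<nu>" "\<mu> \<in> interlacing r \<nu>" shows "decseq \<mu>"
proof (rule decseq_SucI)
  fix i show "\<mu> (Suc i) \<le> \<mu> i"
    using assms(2) unfolding interlacing_def
    by (cases "Suc i < r") (auto intro: order.trans[of _ "\<nu> (Suc i)"])
qed

text \<open>Row i of \<mu> is column r - 1 - i of the choice function minus its shift. The shift
  grows by one per column, so a half-open interval between shifted parts is exactly a closed
  interlacing interval. The hypothesis \<open>cong\<close> makes the undefined values in
  \<open>PiE\<close> irrelevant.\<close>

lemma sum_interlacing: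
  assumes dec: "decseq \<nu>"
    and cong: "\<And>m m'. (\<And>j. j < r \<Longrightarrow> m j = m' j) \<Longrightarrow> F m = F m'"
  shows "(\<Sum>m\<in>PiE {..<r} (\<lambda>j. {shifted (Suc r) \<nu> j..<shifted (Suc r) \<nu> (Suc j)}). F m) =
    (\<Sum>\<mu>\<in>interlacing r \<nu>. F (shifted r \<mu>))"
proof (rule sum.reindex_bij_witness[where
    i="\<lambda>\<mu>. restrict (shifted r \<mu>) {..<r}" and
    j="\<lambda>m i. if i < r then m (r - Suc i) - (r - Suc i) else 0"])
  let ?P = "PiE {..<r} (\<lambda>j. {shifted (Suc r) \<nu> j..<shifted (Suc r) \<nu> (Suc j)})"
  have range: "m j - j \<in> {\<nu> (r - j)..\<nu> (r - Suc j)} \<and> m j - j + j = m j"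
    if "m \<in> ?P" "j < r" for m j
  proof -
    have "m j \<in> {shifted (Suc r) \<nu> j..<shifted (Suc r) \<nu> (Suc j)}"
      using that by (auto simp: PiE_iff)
    then show ?thesis by (auto simp: shifted_def)
  qed
  fix m assume m: "m \<in> ?P"
  show "restrict (shifted r (\<lambda>i. if i < r then m (r - Suc i) - (r - Suc i) else 0)) {..<r} = m"
  proof (rule ext)
    fix j show "restrict (shifted r (\<lambda>i. if i < r then m (r - Suc i) - (r - Suc i) else 0)) {..<r} j = m j"
      using m range[OF m, of j] by (cases "j < r") (auto simp: shifted_def PiE_iff extensional_def)
  qed
  show "(\<lambda>i. if i < r then m (r - Suc i) - (r - Suc i) else 0) \<in> interlacing r \<nu>"
    unfolding interlacing_def
  proof (intro CollectI conjI allI impI)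
    fix i assume i: "i < r"
    then have "r - (r - Suc i) = Suc i" "r - Suc (r - Suc i) = i" by auto
    with range[OF m, of "r - Suc i"] i
    show "\<nu> (Suc i) \<le> (if i < r then m (r - Suc i) - (r - Suc i) else 0)"
      "(if i < r then m (r - Suc i) - (r - Suc i) else 0) \<le> \<nu> i" by auto
  qed auto
  show "F (shifted r (\<lambda>i. if i < r then m (r - Suc i) - (r - Suc i) else 0)) = F m"
  proof (rule cong)
    fix j assume "j < r"
    then show "shifted r (\<lambda>i. if i < r then m (r - Suc i) - (r - Suc i) else 0) j = m j"
      using range[OF m, of j] by (auto simp: shifted_def)
  qed
next
  fix \<mu> assume \<mu>: "\<mu> \<in> interlacing r \<nu>"
  show "(\<lambda>i. if i < r then restrict (shifted r \<mu>) {..<r} (r - Suc i) - (r - Suc i) else 0) = \<mu>"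
    using \<mu> by (auto simp: fun_eq_iff interlacing_def shifted_def)
  show "restrict (shifted r \<mu>) {..<r} \<in>
      PiE {..<r} (\<lambda>j. {shifted (Suc r) \<nu> j..<shifted (Suc r) \<nu> (Suc j)})"
  proof (intro restrict_PiE_iff[THEN iffD2] ballI)
    fix j assume "j \<in> {..<r}"
    then have j: "r - Suc j < r" "Suc (r - Suc j) = r - j" by auto
    then have "\<nu> (Suc (r - Suc j)) \<le> \<mu> (r - Suc j)" "\<mu> (r - Suc j) \<le> \<nu> (r - Suc j)"
      using \<mu> unfolding interlacing_def by blast+
    then show "shifted r \<mu> j \<in> {shifted (Suc r) \<nu> j..<shifted (Suc r) \<nu> (Suc j)}"
      unfolding shifted_def using j by simp
  qed
qed

text \<open>The Schur polynomial of \<nu> in the first r variables, by branching: x_0 records the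
  boxes of the strip \<nu>/\<mu>. The subtraction does not truncate, by
  \<open>sum_interlacing_le\<close>.\<close>

fun gt_sum :: "nat \<Rightarrow> (nat \<Rightarrow> real) \<Rightarrow> (nat \<Rightarrow> nat) \<Rightarrow> real" where
  "gt_sum 0 x \<nu> = 1"
| "gt_sum (Suc r) x \<nu> = (\<Sum>\<mu>\<in>interlacing r \<nu>.
     x 0 ^ ((\<Sum>i<Suc r. \<nu> i) - (\<Sum>i<r. \<mu> i)) * gt_sum r (\<lambda>i. x (Suc i)) \<mu>)"

lemma shifted_mono:
  "decseq \<nu> \<Longrightarrow> shifted (Suc r) \<nu> j \<le> shifted (Suc r) \<nu> (Suc j)"
  unfolding shifted_def by (rule add_mono[OF decseqD]) auto

text \<open>The top row consists of ones, and by Pascal's rule the differences of the other rows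
  form the same kind of determinant of size one less. It therefore obeys the branching rule at x =
  1.\<close>

lemma alternant_binomial:
  "decseq \<nu> \<Longrightarrow> alternant d (\<lambda>i k. real (k choose i)) (shifted d \<nu>) = gt_sum d (\<lambda>_. 1) \<nu>"
proof (induction d arbitrary: \<nu>)
  case 0
  then show ?case by (simp add: alternant_def)
next
  case (Suc r)
  have "alternant (Suc r) (\<lambda>i k. real (k choose i)) (shifted (Suc r) \<nu>) =
    (\<Sum>m\<in>PiE {..<r} (\<lambda>j. {shifted (Suc r) \<nu> j..<shifted (Suc r) \<nu> (Suc j)}).
       alternant r (\<lambda>i k. real (k choose i)) m)"
    by (subst alternant_ones) (auto intro!: shifted_mono Suc.prems)
  also have "\<dots> = (\<Sum>\<mu>\<in>interlacing r \<nu>. alternant r (\<lambda>i k. real (k choose i)) (shifted r \<mu>))"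
    by (rule sum_interlacing[OF Suc.prems]) (auto intro: alternant_cong)
  also have "\<dots> = gt_sum (Suc r) (\<lambda>_. 1) \<nu>"
    using Suc by (auto intro!: sum.cong dest: interlacing_decseq)
  finally show ?case .
qed

text \<open>The product of x_j - x_i over i < j, peeled off at x_0 to match the recursion of
  \<open>gt_sum\<close>.\<close>

fun vandermonde :: "nat \<Rightarrow> (nat \<Rightarrow> real) \<Rightarrow> real" where
  "vandermonde 0 x = 1"
| "vandermonde (Suc r) x = (\<Prod>i<r. x (Suc i) - x 0) * vandermonde r (\<lambda>i. x (Suc i))"

lemma prod_pow_permuted:
  fixes c :: real
  assumes "p permutes {..<n}"
  shows "(\<Prod>i<n. c ^ l (p i)) = c ^ (\<Sum>i<n. l i)"
  using prod.permute[OF assms, of "\<lambda>i. c ^ l i"] by (simp add: comp_def power_sum)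

lemma alternant_scale:
  "alternant n (\<lambda>i k. a i * c ^ k * \<phi> i k) l = (\<Prod>i<n. a i) * c ^ (\<Sum>i<n. l i) * alternant n \<phi> l"
  unfolding alternant_def
  by (simp add: prod.distrib prod_pow_permuted sum_distrib_left mult_ac)

lemma sum_shifted: "(\<Sum>j<d. shifted d \<nu> j) = (\<Sum>i<d. \<nu> i) + (\<Sum>j<d. j)"
proof -
  have "(\<Sum>j<d. \<nu> (d - Suc j)) = (\<Sum>i<d. \<nu> i)"
    by (rule sum.nat_diff_reindex)
  then show ?thesis by (simp add: shifted_def sum.distrib)
qed

lemma sum_interlacing_le:
  "\<mu> \<in> interlacing r \<nu> \<Longrightarrow> (\<Sum>i<r. \<mu> i) \<le> (\<Sum>i<Suc r. \<nu> i)"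
  by (auto simp: interlacing_def intro!: trans_le_add1 sum_mono)

text \<open>The bialternant formula. Dividing all variables by x_0 creates a row of ones; for u =
  y/x_0 the difference of u^(k+1) and u^k is (y - x_0)/x_0 times u^k, which releases the Vandermonde
  factors and leaves a smaller alternant.\<close>

lemma alternant_power:
  "decseq \<nu> \<Longrightarrow> (\<And>i. i < d \<Longrightarrow> x i > 0) \<Longrightarrow>
    alternant d (\<lambda>i k. x i ^ k) (shifted d \<nu>) = vandermonde d x * gt_sum d x \<nu>"
proof (induction d arbitrary: x \<nu>)
  case 0
  then show ?case by (simp add: alternant_def)
next
  case (Suc r)
  have x0: "x 0 > 0" using Suc.prems by simp
  have rearrange: "a * (p / b / c * (v * g)) = p * v * (a / (b * c) * g)" for a b c p v g :: real
    by (simp add: divide_inverse)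
  let ?l = "shifted (Suc r) \<nu>" and ?y = "\<lambda>i. x (Suc i)"
  have "alternant (Suc r) (\<lambda>i k. x i ^ k) ?l =
      x 0 ^ (\<Sum>i<Suc r. ?l i) * alternant (Suc r) (\<lambda>i k. (x i / x 0) ^ k) ?l"
    using alternant_scale[of "Suc r" "\<lambda>_. 1" "x 0" "\<lambda>i k. (x i / x 0) ^ k" ?l] x0
    by (simp add: power_divide del: sum.lessThan_Suc)
  also have "alternant (Suc r) (\<lambda>i k. (x i / x 0) ^ k) ?l =
      (\<Sum>m\<in>PiE {..<r} (\<lambda>j. {?l j..<?l (Suc j)}).
        alternant r (\<lambda>i k. (?y i / x 0) ^ Suc k - (?y i / x 0) ^ k) m)"
    by (rule alternant_ones) (use x0 in \<open>simp, intro shifted_mono Suc.prems\<close>)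
  also have "\<dots> = (\<Sum>\<mu>\<in>interlacing r \<nu>.
        alternant r (\<lambda>i k. (?y i / x 0) ^ Suc k - (?y i / x 0) ^ k) (shifted r \<mu>))"
    by (rule sum_interlacing[OF Suc.prems(1)]) (auto intro: alternant_cong)
  also have "x 0 ^ (\<Sum>i<Suc r. ?l i) * \<dots> = (\<Sum>\<mu>\<in>interlacing r \<nu>. (\<Prod>i<r. ?y i - x 0) *
     vandermonde r ?y * (x 0 ^ ((\<Sum>i<Suc r. \<nu> i) - (\<Sum>i<r. \<mu> i)) * gt_sum r ?y \<mu>))"
    unfolding sum_distrib_left
  proof (intro sum.cong refl)
    fix \<mu> assume \<mu>: "\<mu> \<in> interlacing r \<nu>"
    have "alternant r (\<lambda>i k. (?y i / x 0) ^ Suc k - (?y i / x 0) ^ k) (shifted r \<mu>) =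
        alternant r (\<lambda>i k. (?y i - x 0) / x 0 * (1 / x 0) ^ k * ?y i ^ k) (shifted r \<mu>)"
      using x0 by (intro alternant_cong) (simp add: diff_divide_distrib power_divide left_diff_distrib)
    also have "\<dots> = (\<Prod>i<r. ?y i - x 0) / x 0 ^ r / x 0 ^ (\<Sum>i<r. shifted r \<mu> i) *
        (vandermonde r ?y * gt_sum r ?y \<mu>)"
    proof -
      have "alternant r (\<lambda>i k. ?y i ^ k) (shifted r \<mu>) = vandermonde r ?y * gt_sum r ?y \<mu>"
        using \<mu> Suc.prems by (intro Suc.IH) (auto dest: interlacing_decseq)
      then show ?thesis
        unfolding alternant_scale by (simp add: prod_dividef power_one_over)
    qed
    finally have A: "alternant r (\<lambda>i k. (?y i / x 0) ^ Suc k - (?y i / x 0) ^ k) (shifted r \<mu>) =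
        (\<Prod>i<r. ?y i - x 0) / x 0 ^ r / x 0 ^ (\<Sum>i<r. shifted r \<mu> i) *
        (vandermonde r ?y * gt_sum r ?y \<mu>)" .
    \<comment> \<open>The summand r is the difference of the staircase sums for r + 1 and r columns;
      it absorbs the r denominators x_0.\<close>
    have S: "(\<Sum>i<Suc r. ?l i) =
        ((\<Sum>i<Suc r. \<nu> i) - (\<Sum>i<r. \<mu> i)) + (r + (\<Sum>i<r. shifted r \<mu> i))"
      unfolding sum_shifted
      using sum_interlacing_le[OF \<mu>] sum.lessThan_Suc[of "\<lambda>j. j" r] by linarith
    have P: "x 0 ^ (\<Sum>i<Suc r. ?l i) / (x 0 ^ r * x 0 ^ (\<Sum>i<r. shifted r \<mu> i)) =
        x 0 ^ ((\<Sum>i<Suc r. \<nu> i) - (\<Sum>i<r. \<mu> i))"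
      unfolding S power_add using x0 by simp
    show "x 0 ^ (\<Sum>i<Suc r. ?l i) *
        alternant r (\<lambda>i k. (?y i / x 0) ^ Suc k - (?y i / x 0) ^ k) (shifted r \<mu>) =
        (\<Prod>i<r. ?y i - x 0) * vandermonde r ?y *
        (x 0 ^ ((\<Sum>i<Suc r. \<nu> i) - (\<Sum>i<r. \<mu> i)) * gt_sum r ?y \<mu>)"
      unfolding A rearrange P ..
  qed
  also have "\<dots> = vandermonde (Suc r) x * gt_sum (Suc r) x \<nu>"
    by (simp add: sum_distrib_left)
  finally show ?case .
qed

section \<open>Binomial alternants\<close>

abbreviation binomial_det :: "nat \<Rightarrow> (nat \<Rightarrow> nat) \<Rightarrow> real" where
  "binomial_det d l \<equiv> alternant d (\<lambda>i k. real (k choose i)) l"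

text \<open>Reindexing by the inverse permutation isolates column j in a single factor, as needed
  when one shifted part is lowered.\<close>

lemma alternant_columns:
  "alternant n \<phi> l = (\<Sum>p | p permutes {..<n}. of_int (sign p) * (\<Prod>j<n. \<phi> (p j) (l j)))"
proof -
  have "alternant n \<phi> l = (\<Sum>p | p permutes {..<n}.
      of_int (sign (Hilbert_Choice.inv p)) * (\<Prod>i<n. \<phi> i (l (Hilbert_Choice.inv p i))))"
    unfolding alternant_def by (rule sum_permutations_inverse)
  also have "\<dots> = (\<Sum>p | p permutes {..<n}. of_int (sign p) * (\<Prod>j<n. \<phi> (p j) (l j)))"
  proof (intro sum.cong refl)
    fix p assume "p \<in> {p. p permutes {..<n}}"
    then have p: "p permutes {..<n}" by simp
    have "(\<Prod>i<n. \<phi> i (l (Hilbert_Choice.inv p i))) = (\<Prod>j<n. \<phi> (p j) (l j))"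
      using prod.permute[OF p, of "\<lambda>i. \<phi> i (l (Hilbert_Choice.inv p i))"]
      by (simp add: comp_def permutes_inverses(2)[OF p])
    moreover have "sign (Hilbert_Choice.inv p) = sign p"
      using p by (intro sign_inverse) (auto simp: permutation_permutes)
    ultimately show "of_int (sign (Hilbert_Choice.inv p)) * (\<Prod>i<n. \<phi> i (l (Hilbert_Choice.inv p i))) =
        of_int (sign p) * (\<Prod>j<n. \<phi> (p j) (l j))" by simp
  qed
  finally show ?thesis .
qed

lemma real_binomial_absorb: "(real n - real k) * real (n choose k) = real n * real ((n - 1) choose k)"
proof (cases "k \<le> n")
  case True
  have "real ((n - k) * (n choose k)) = real (n * ((n - 1) choose k))"
    by (simp only: binomial_absorb_comp)
  then show ?thesis using True by (simp add: of_nat_diff)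
next
  case False
  then show ?thesis by (simp add: binomial_eq_0)
qed

lemma real_binomial_raise: "(real n - real k) * real (n choose k) = real (Suc k) * real (n choose Suc k)"
proof -
  have "real (Suc k * (n choose Suc k)) = real (n * ((n - 1) choose k))"
    by (simp only: binomial_absorption)
  then show ?thesis by (simp only: real_binomial_absorb of_nat_mult)
qed

lemma sum_permuted: "p permutes {..<n} \<Longrightarrow> (\<Sum>j<n. f (p j)) = (\<Sum>j<n. f j)"
  using sum.permute[of p "{..<n}" f] by (simp add: comp_def)

lemma prod_binomial_lower:
  fixes l p :: "nat \<Rightarrow> nat"
  assumes "j < d"
  shows "real (l j) * (\<Prod>a<d. real ((l(j := l j - 1)) a choose p a)) =
    (real (l j) - real (p j)) * (\<Prod>a<d. real (l a choose p a))"
proof -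
  have split: "(\<Prod>a<d. g a) = g j * (\<Prod>a\<in>{..<d} - {j}. g a)" for g :: "nat \<Rightarrow> real"
    using assms by (intro prod.remove) auto
  have "(\<Prod>a\<in>{..<d} - {j}. real ((l(j := l j - 1)) a choose p a)) =
      (\<Prod>a\<in>{..<d} - {j}. real (l a choose p a))"
    by (intro prod.cong) auto
  then show ?thesis
    unfolding split by (simp add: real_binomial_absorb flip: mult.assoc)
qed

text \<open>Absorption gives l (l - 1 choose p) = (l - p) (l choose p), including l = 0 where the
  subtraction truncates. The sum of l_j - p_j over the columns is the same for all permutations and
  factors out.\<close>

lemma binomial_det_lower:
  "(\<Sum>j<d. real (l j) * binomial_det d (l(j := l j - 1))) =
    (real (\<Sum>j<d. l j) - real (\<Sum>j<d. j)) * binomial_det d l"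
proof -
  have "(\<Sum>j<d. real (l j) * binomial_det d (l(j := l j - 1))) =
     (\<Sum>j<d. \<Sum>p | p permutes {..<d}. of_int (sign p) *
        (real (l j) * (\<Prod>a<d. real ((l(j := l j - 1)) a choose p a))))"
    unfolding alternant_columns by (simp add: sum_distrib_left mult_ac)
  also have "\<dots> = (\<Sum>j<d. \<Sum>p | p permutes {..<d}. of_int (sign p) *
        ((real (l j) - real (p j)) * (\<Prod>a<d. real (l a choose p a))))"
    by (intro sum.cong refl) (simp add: prod_binomial_lower del: fun_upd_apply One_nat_def)
  also have "\<dots> = (\<Sum>p | p permutes {..<d}. of_int (sign p) *
        ((\<Sum>j<d. real (l j) - real (p j)) * (\<Prod>a<d. real (l a choose p a))))"
    by (subst sum.swap) (simp add: sum_distrib_left sum_distrib_right)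
  also have "\<dots> = (\<Sum>p | p permutes {..<d}. of_int (sign p) *
        ((real (\<Sum>j<d. l j) - real (\<Sum>j<d. j)) * (\<Prod>a<d. real (l a choose p a))))"
    by (intro sum.cong refl) (simp add: sum_subtractf sum_permuted)
  also have "\<dots> = (real (\<Sum>j<d. l j) - real (\<Sum>j<d. j)) * binomial_det d l"
    unfolding alternant_columns by (simp add: sum_distrib_left mult_ac)
  finally show ?thesis .
qed

text \<open>Raising the exponent \<open>m\<close> to \<open>m + 1\<close> creates two equal rows unless \<open>m\<close> is the largest
  exponent.\<close>

lemma weighted_raise:
  fixes c :: "nat \<Rightarrow> real"
  assumes "d > 0"
  shows "(\<Sum>p | p permutes {..<d}. of_int (sign p) *
      (\<Sum>j<d. c (p j) * ((real (l j) - real (p j)) * (\<Prod>a<d. real (l a choose p a))))) =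
    c (d - 1) * (\<Sum>p | p permutes {..<d}. of_int (sign p) *
      (\<Sum>j<d. (real (l j) - real (p j)) * (\<Prod>a<d. real (l a choose p a))))"
proof -
  define Q where "Q m p = (\<Prod>a<d. real (l a choose (if p a = m then Suc m else p a)))" for m and p :: "nat \<Rightarrow> nat"
  define Z where "Z m = (\<Sum>p | p permutes {..<d}. of_int (sign p) * Q m p)" for m
  have main: "(\<Sum>p | p permutes {..<d}. of_int (sign p) *
      (\<Sum>j<d. c (p j) * ((real (l j) - real (p j)) * (\<Prod>a<d. real (l a choose p a))))) =
     c (d - 1) * (real d * Z (d - 1))" for c :: "nat \<Rightarrow> real"
  proof -
    have "(\<Sum>j<d. c (p j) * ((real (l j) - real (p j)) * (\<Prod>a<d. real (l a choose p a)))) =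
        (\<Sum>m<d. c m * (real (Suc m) * Q m p))" if p: "p permutes {..<d}" for p
    proof -
      have key: "(real (l j) - real (p j)) * (\<Prod>a<d. real (l a choose p a)) = real (Suc (p j)) * Q (p j) p"
        if j: "j \<in> {..<d}" for j
      proof -
        have "Q (p j) p = real (l j choose Suc (p j)) * (\<Prod>a\<in>{..<d} - {j}. real (l a choose p a))"
        proof -
          have inj: "p a = p j \<longleftrightarrow> a = j" for a
            using permutes_inj[OF p] by (simp add: inj_eq)
          show ?thesis
            unfolding Q_def inj using j by (subst prod.remove[of _ j]) auto
        qed
        then show ?thesis
          using j by (subst prod.remove[of _ j]) (simp_all add: real_binomial_raise flip: mult.assoc del: of_nat_Suc)
      qed
      have "(\<Sum>j<d. c (p j) * ((real (l j) - real (p j)) * (\<Prod>a<d. real (l a choose p a)))) =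
          (\<Sum>j<d. c (p j) * (real (Suc (p j)) * Q (p j) p))"
        by (intro sum.cong refl) (simp only: key)
      then show ?thesis
        using sum_permuted[OF p, of "\<lambda>m. c m * (real (Suc m) * Q m p)"] by simp
    qed
    then have "(\<Sum>p | p permutes {..<d}. of_int (sign p) *
      (\<Sum>j<d. c (p j) * ((real (l j) - real (p j)) * (\<Prod>a<d. real (l a choose p a))))) =
      (\<Sum>p | p permutes {..<d}. \<Sum>m<d. of_int (sign p) * (c m * (real (Suc m) * Q m p)))"
      by (intro sum.cong refl) (simp add: sum_distrib_left)
    also have "\<dots> = (\<Sum>m<d. c m * (real (Suc m) * Z m))"
      unfolding Z_def by (subst sum.swap) (simp add: sum_distrib_left mult_ac)
    also have "\<dots> = (\<Sum>m<d. if m = d - 1 then c (d - 1) * (real d * Z (d - 1)) else 0)"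
    proof (intro sum.cong refl)
      fix m assume m: "m \<in> {..<d}"
      have "Z m = 0" if "Suc m < d"
        unfolding Z_def
      proof (rule sum_sign_cancel[where a=m and b="Suc m"])
        fix p :: "nat \<Rightarrow> nat"
        show "Q m (Transposition.transpose m (Suc m) \<circ> p) = Q m p"
          unfolding Q_def by (intro prod.cong) (auto simp: Transposition.transpose_def)
      qed (use that in auto)
      then show "c m * (real (Suc m) * Z m) = (if m = d - 1 then c (d - 1) * (real d * Z (d - 1)) else 0)"
        using m by (cases "Suc m < d") (auto simp: not_less dest!: le_antisym[of d "Suc m"])
    qed
    also have "\<dots> = c (d - 1) * (real d * Z (d - 1))"
      using assms by simp
    finally show ?thesis .
  qed
  \<comment> \<open>Both sides are multiples of the one surviving determinant
    \<open>Z (d - 1)\<close>; the right side is the case of constant weight.\<close>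
  from main[of c] main[of "\<lambda>_. 1"] show ?thesis by simp
qed

text \<open>At the shifted parts of \<lambda> this is the sum of d + 2 content over the cells. The
  squares come from the sum of the th_j^2, the last sum is the eigenvalue of the Vandermonde
  product, and the factor d - 1 stems from symmetrising the first-order part.\<close>

definition casimir :: "nat \<Rightarrow> (nat \<Rightarrow> nat) \<Rightarrow> real" where
  "casimir d l = (\<Sum>j<d. (real (l j))\<^sup>2)
     - (real d - 1) * (real (\<Sum>j<d. l j) - real (\<Sum>j<d. j)) - (\<Sum>j<d. (real j)\<^sup>2)"

text \<open>After one absorption the weight is l (l - p) = l^2 - p (l - p) - p^2. The outer terms
  have sums independent of the permutation; only the middle one needs a further idea, namely
  \<open>weighted_raise\<close>.\<close>

lemma binomial_det_lower_square:
  assumes "d > 0"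
  shows "(\<Sum>j<d. (real (l j))\<^sup>2 * binomial_det d (l(j := l j - 1))) =
    casimir d l * binomial_det d l"
proof -
  define S where "S f = (\<Sum>p | p permutes {..<d}. of_int (sign p) * (\<Sum>j<d. f p j * (\<Prod>a<d. real (l a choose p a))))"
    for f :: "(nat \<Rightarrow> nat) \<Rightarrow> nat \<Rightarrow> real"
  have S_add: "S (\<lambda>p j. f p j + g p j) = S f + S g" and S_diff: "S (\<lambda>p j. f p j - g p j) = S f - S g"
    for f g
    by (simp_all add: S_def algebra_simps sum.distrib sum_subtractf)
  have const: "S f = k * binomial_det d l" if "\<And>p. p permutes {..<d} \<Longrightarrow> (\<Sum>j<d. f p j) = k" for f k
  proof -
    have "S f = (\<Sum>p | p permutes {..<d}. of_int (sign p) * (k * (\<Prod>a<d. real (l a choose p a))))"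
      unfolding S_def by (intro sum.cong refl) (simp add: that flip: sum_distrib_right)
    then show ?thesis
      unfolding alternant_columns by (simp add: sum_distrib_left mult_ac)
  qed
  let ?D = "real (\<Sum>j<d. l j) - real (\<Sum>j<d. j)"
  have D: "S (\<lambda>p j. real (l j) - real (p j)) = ?D * binomial_det d l"
    by (rule const) (simp add: sum_subtractf sum_permuted)
  \<comment> \<open>With the exponent itself as weight, the largest exponent d - 1 becomes the
    factor.\<close>
  have raise: "S (\<lambda>p j. real (p j) * (real (l j) - real (p j))) = (real d - 1) * (?D * binomial_det d l)"
    using weighted_raise[OF assms, of real l] assms
    unfolding D[symmetric] S_def by (simp add: mult.assoc of_nat_diff)
  have "(\<Sum>j<d. (real (l j))\<^sup>2 * binomial_det d (l(j := l j - 1))) =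
     (\<Sum>j<d. \<Sum>p | p permutes {..<d}. of_int (sign p) * (real (l j) *
        (real (l j) * (\<Prod>a<d. real ((l(j := l j - 1)) a choose p a)))))"
    unfolding alternant_columns by (simp add: sum_distrib_left mult_ac power2_eq_square)
  also have "\<dots> = (\<Sum>j<d. \<Sum>p | p permutes {..<d}. of_int (sign p) * (real (l j) *
        ((real (l j) - real (p j)) * (\<Prod>a<d. real (l a choose p a)))))"
    by (intro sum.cong refl) (simp add: prod_binomial_lower del: fun_upd_apply One_nat_def)
  also have "\<dots> = S (\<lambda>p j. real (l j) * (real (l j) - real (p j)))"
    unfolding S_def by (subst sum.swap) (simp add: sum_distrib_left mult.assoc)
  also have "\<dots> = S (\<lambda>p j. (real (l j))\<^sup>2 - (real (p j) * (real (l j) - real (p j)) + (real (p j))\<^sup>2))"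
    by (simp add: algebra_simps power2_eq_square)
  also have "\<dots> = (\<Sum>j<d. (real (l j))\<^sup>2) * binomial_det d l
     - ((real d - 1) * (?D * binomial_det d l) + (\<Sum>j<d. (real j)\<^sup>2) * binomial_det d l)"
    unfolding S_diff S_add raise
    by (simp add: const[of _ "\<Sum>j<d. (real (l j))\<^sup>2"] const[of _ "\<Sum>j<d. (real j)\<^sup>2"]
        sum_permuted[of _ _ "\<lambda>j. (real j)\<^sup>2"])
  also have "\<dots> = casimir d l * binomial_det d l"
    by (simp add: casimir_def algebra_simps)
  finally show ?thesis .
qed

text \<open>The function \<open>m \<mapsto> m (m - (d - 1))\<close> is nonpositive below \<open>d\<close> and positive from \<open>d\<close> on.\<close>

lemma casimir_pos:
  assumes inj: "inj_on l {..<d}" and sum: "(\<Sum>j<d. l j) = n + (\<Sum>j<d. j)" and "n > 0"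
  shows "casimir d l > 0"
proof -
  define h where "h m = real m * (real m - (real d - 1))" for m :: nat
  let ?S = "l ` {..<d}" and ?T = "{..<d}"
  have cas: "casimir d l = (\<Sum>m\<in>?S. h m) - (\<Sum>m\<in>?T. h m)"
  proof -
    have "(\<Sum>j<d. h (f j)) = (\<Sum>j<d. (real (f j))\<^sup>2) - (real d - 1) * real (\<Sum>j<d. f j)" for f
    proof -
      have "h m = (real m)\<^sup>2 - (real d - 1) * real m" for m
        by (simp add: h_def algebra_simps power2_eq_square)
      then show ?thesis by (simp add: sum_subtractf flip: sum_distrib_left)
    qed
    from this[of l] this[of "\<lambda>j. j"] show ?thesis
      using inj by (simp add: casimir_def sum.reindex right_diff_distrib)
  qed
  have pos: "h m > 0" if "m \<ge> d" "m > 0" for m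
    using that unfolding h_def by (intro mult_pos_pos) auto
  have neg: "h m \<le> 0" if "m < d" for m
    using that unfolding h_def by (intro mult_nonneg_nonpos) auto
  have "?S \<noteq> ?T"
  proof
    assume "?S = ?T"
    then have "(\<Sum>j<d. l j) = (\<Sum>j<d. j)"
      using sum.reindex[OF inj, of "\<lambda>x. x"] by simp
    with sum \<open>n > 0\<close> show False by simp
  qed
  have "card ?S = card ?T" using inj by (simp add: card_image)
  \<comment> \<open>Two different sets of the same size d: some shifted part must be at least d,
    which makes the inequality strict.\<close>
  have "?S - ?T \<noteq> {}"
  proof
    assume "?S - ?T = {}"
    then have "?S \<subseteq> ?T" by blast
    from card_subset_eq[OF _ this \<open>card ?S = card ?T\<close>] \<open>?S \<noteq> ?T\<close> show False by simp
  qed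
  moreover have "d > 0" using \<open>?S - ?T \<noteq> {}\<close> by auto
  ultimately have "(\<Sum>m\<in>?S - ?T. h m) > 0"
    by (intro sum_pos) (auto intro!: pos)
  moreover have "(\<Sum>m\<in>?T - ?S. h m) \<le> 0"
    by (intro sum_nonpos) (auto intro: neg)
  moreover have "(\<Sum>m\<in>?S. h m) = (\<Sum>m\<in>?S - ?T. h m) + (\<Sum>m\<in>?S \<inter> ?T. h m)"
    "(\<Sum>m\<in>?T. h m) = (\<Sum>m\<in>?T - ?S. h m) + (\<Sum>m\<in>?S \<inter> ?T. h m)"
    by (simp_all add: sum.Int_Diff[of ?S h ?T] sum.Int_Diff[of ?T h ?S] Int_commute)
  ultimately show ?thesis using cas by linarith
qed

section \<open>Monomial expansions\<close>

definition monomial :: "nat \<Rightarrow> (nat \<Rightarrow> real) \<Rightarrow> (nat \<Rightarrow> nat) \<Rightarrow> real" where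
  "monomial d x l = (\<Prod>i<d. x i ^ l i)"

lemma digits_unique:
  fixes a b :: "nat \<Rightarrow> nat" and d :: nat
  assumes "\<And>i. i < d \<Longrightarrow> a i < N" "\<And>i. i < d \<Longrightarrow> b i < N"
    and "(\<Sum>i<d. a i * N ^ i) = (\<Sum>i<d. b i * N ^ i)" "i < d"
  shows "a i = b i"
  using assms
proof (induction d arbitrary: a b i)
  case (Suc d)
  have expand: "(\<Sum>i<Suc d. c i * N ^ i) = c 0 + N * (\<Sum>i<d. c (Suc i) * N ^ i)" for c :: "nat \<Rightarrow> nat"
    unfolding sum.lessThan_Suc_shift by (simp add: sum_distrib_left mult_ac)
  have eq: "a 0 + N * (\<Sum>i<d. a (Suc i) * N ^ i) = b 0 + N * (\<Sum>i<d. b (Suc i) * N ^ i)"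
    using Suc.prems(3) unfolding expand .
  have lt: "a 0 < N" "b 0 < N" using Suc.prems by auto
  have "a 0 = b 0" using arg_cong[OF eq, of "\<lambda>x. x mod N"] lt by simp
  moreover have S: "(\<Sum>i<d. a (Suc i) * N ^ i) = (\<Sum>i<d. b (Suc i) * N ^ i)"
    using eq \<open>a 0 = b 0\<close> lt by simp
  have "a (Suc i) = b (Suc i)" if "i < d" for i
    by (rule Suc.IH[OF _ _ S that]) (simp_all add: Suc.prems(1,2))
  ultimately show ?case using Suc.prems(4) by (cases i) auto
qed simp

text \<open>Kronecker substitution \<open>x\<^sub>i = y ^ (N ^ i)\<close> with \<open>N\<close> larger than all exponents.\<close>

lemma monomial_coeffs_eq:
  fixes c :: "'p \<Rightarrow> real" and c' :: "'q \<Rightarrow> real"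
  assumes fin: "finite P" "finite Q"
    and eq: "\<And>x. (\<And>i. i < d \<Longrightarrow> x i > 0) \<Longrightarrow> inj_on x {..<d} \<Longrightarrow>
      (\<Sum>p\<in>P. c p * monomial d x (\<alpha> p)) = (\<Sum>q\<in>Q. c' q * monomial d x (\<beta> q))"
  shows "(\<Sum>p | p \<in> P \<and> (\<forall>i<d. \<alpha> p i = l i). c p) = (\<Sum>q | q \<in> Q \<and> (\<forall>i<d. \<beta> q i = l i). c' q)"
proof -
  define X where "X = (\<lambda>(p, i). \<alpha> p i) ` (P \<times> {..<d}) \<union> (\<lambda>(q, i). \<beta> q i) ` (Q \<times> {..<d}) \<union> l ` {..<d}"
  \<comment> \<open>Besides exceeding every exponent, including those of \<open>l\<close>, N is at
    least 2; so the powers of N are distinct and the substituted x is injective.\<close>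
  define N where "N = Suc (Suc (Max (insert 0 X)))"
  have "finite X" using fin by (simp add: X_def)
  have N: "k < N" if "k \<in> X" for k
  proof -
    have "k \<le> Max (insert 0 X)" by (rule Max_ge) (use \<open>finite X\<close> that in auto)
    then show ?thesis by (simp only: N_def less_Suc_eq_le le_SucI)
  qed
  have NP: "\<alpha> p i < N" if "p \<in> P" "i < d" for p i
    by (rule N) (use that in \<open>force simp: X_def\<close>)
  have NQ: "\<beta> q i < N" if "q \<in> Q" "i < d" for q i
    by (rule N) (use that in \<open>force simp: X_def\<close>)
  have Nl: "l i < N" if "i < d" for i
    by (rule N) (use that in \<open>force simp: X_def\<close>)
  define e where "e a = (\<Sum>i<d. a i * N ^ i)" for a :: "nat \<Rightarrow> nat"
  have e_eq: "e a = e b \<longleftrightarrow> (\<forall>i<d. a i = b i)" if "\<And>i. i < d \<Longrightarrow> a i < N" "\<And>i. i < d \<Longrightarrow> b i < N" for a b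
    using digits_unique[of d a N b] that by (auto simp: e_def intro!: sum.cong)
  define f where "f = (\<Sum>p\<in>P. Polynomial.monom (c p) (e (\<alpha> p)))"
  define g where "g = (\<Sum>q\<in>Q. Polynomial.monom (c' q) (e (\<beta> q)))"
  have "poly (f - g) y = 0" if "y > 1" for y
  proof -
    define x where "x i = y ^ (N ^ i)" for i
    have mon: "monomial d x a = y ^ e a" for a
      by (simp add: monomial_def x_def e_def power_sum mult.commute flip: power_mult)
    have "inj_on x {..<d}"
      using that by (auto simp: inj_on_def x_def N_def power_inject_exp)
    moreover have "x i > 0" for i using that by (simp add: x_def)
    ultimately show ?thesis
      using eq[of x] by (simp add: f_def g_def mon poly_sum poly_monom)
  qed
  then have "{1<..} \<subseteq> {y. poly (f - g) y = 0}" by auto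
  moreover have "infinite {1::real<..}" by (rule infinite_Ioi)
  ultimately have "f - g = 0"
    using poly_roots_finite finite_subset by blast
  then have "coeff f (e l) = coeff g (e l)" by simp
  moreover have "coeff f (e l) = (\<Sum>p | p \<in> P \<and> (\<forall>i<d. \<alpha> p i = l i). c p)"
    unfolding f_def coeff_sum coeff_monom
    using fin by (subst sum.inter_filter) (auto simp: e_eq NP Nl intro!: sum.cong)
  moreover have "coeff g (e l) = (\<Sum>q | q \<in> Q \<and> (\<forall>i<d. \<beta> q i = l i). c' q)"
    unfolding g_def coeff_sum coeff_monom
    using fin by (subst sum.inter_filter) (auto simp: e_eq NQ Nl intro!: sum.cong)
  ultimately show ?thesis by simp
qed

lemma monomial_transpose:
  assumes "a < d" "b < d"
  shows "monomial d (\<lambda>i. x (Transposition.transpose a b i)) l = monomial d x (\<lambda>i. l (Transposition.transpose a b i))"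
proof -
  let ?t = "Transposition.transpose a b"
  have "?t permutes {..<d}" using assms by (simp add: permutes_swap_id)
  from prod.permute[OF this, of "\<lambda>i. x (?t i) ^ l i"] show ?thesis
    by (simp add: monomial_def comp_def)
qed

text \<open>Exponents with a repetition have coefficient zero by antisymmetry, and on the others the
  operator acts by a positive scalar.\<close>

lemma antisymmetric_casimir_zero:
  fixes c :: "'p \<Rightarrow> real"
  assumes fin: "finite P"
    and deg: "\<And>p. p \<in> P \<Longrightarrow> (\<Sum>i<d. \<beta> p i) = n + (\<Sum>j<d. j)" and "n > 0"
    and anti: "\<And>x a b. (\<And>i. i < d \<Longrightarrow> x i > 0) \<Longrightarrow> inj_on x {..<d} \<Longrightarrow> a < d \<Longrightarrow> b < d \<Longrightarrow> a \<noteq> b \<Longrightarrow>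
      (\<Sum>p\<in>P. c p * monomial d (\<lambda>i. x (Transposition.transpose a b i)) (\<beta> p)) = - (\<Sum>p\<in>P. c p * monomial d x (\<beta> p))"
    and cas: "\<And>x. (\<And>i. i < d \<Longrightarrow> x i > 0) \<Longrightarrow> inj_on x {..<d} \<Longrightarrow>
      (\<Sum>p\<in>P. c p * casimir d (\<beta> p) * monomial d x (\<beta> p)) = 0"
  shows "(\<Sum>p\<in>P. c p * monomial d x (\<beta> p)) = 0"
proof -
  have coeff: "(\<Sum>p | p \<in> P \<and> (\<forall>i<d. \<beta> p i = l i). c p) = 0" (is "?r = 0") for l
  proof (cases "{p \<in> P. \<forall>i<d. \<beta> p i = l i} = {}")
    case True
    then show ?thesis by (simp only: sum.empty)
  next
    case False
    then obtain q where q: "q \<in> P" "\<And>i. i < d \<Longrightarrow> \<beta> q i = l i" by auto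
    then have sum: "(\<Sum>i<d. l i) = n + (\<Sum>j<d. j)" using deg[of q] by simp
    show ?thesis
    proof (cases "inj_on l {..<d}")
      case True
      have "(\<Sum>p | p \<in> P \<and> (\<forall>i<d. \<beta> p i = l i). c p * casimir d (\<beta> p)) =
          (\<Sum>p | p \<in> {} \<and> (\<forall>i<d. \<beta> p i = l i). c p)"
        by (rule monomial_coeffs_eq) (use fin cas in auto)
      moreover have "(\<Sum>p | p \<in> P \<and> (\<forall>i<d. \<beta> p i = l i). c p * casimir d (\<beta> p)) = ?r * casimir d l"
        unfolding sum_distrib_right by (intro sum.cong) (auto simp: casimir_def)
      ultimately show ?thesis
        using casimir_pos[OF True sum \<open>n > 0\<close>] by simp
    next
      case False
      then obtain a b where ab: "a < d" "b < d" "a \<noteq> b" "l a = l b" by (auto simp: inj_on_def)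
      let ?t = "Transposition.transpose a b"
      \<comment> \<open>Swapping variables amounts to swapping positions in the exponent, and
        \<open>l\<close> is fixed by exchanging its two equal entries. The coefficient therefore
        equals its negative.\<close>
      have "(\<Sum>p | p \<in> P \<and> (\<forall>i<d. \<beta> p (?t i) = l i). c p) =
          (\<Sum>p | p \<in> P \<and> (\<forall>i<d. \<beta> p i = l i). - c p)"
        by (rule monomial_coeffs_eq[OF fin fin])
           (use anti ab in \<open>simp add: monomial_transpose sum_negf\<close>)
      moreover have "(\<forall>i<d. \<beta> p (?t i) = l i) \<longleftrightarrow> (\<forall>i<d. \<beta> p i = l i)" for p
      proof -
        have "l (?t i) = l i" "i < d \<Longrightarrow> ?t i < d" "?t (?t i) = i" for i
          using ab by (auto simp: Transposition.transpose_def)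
        then show ?thesis by metis
      qed
      ultimately show ?thesis by (simp add: sum_negf)
    qed
  qed
  \<comment> \<open>Several indices may share an exponent, so terms are collected first; restriction
    makes exponents comparable that differ only outside \<open>{..<d}\<close>.\<close>
  have "(\<Sum>p\<in>P. c p * monomial d x (\<beta> p)) =
      (\<Sum>l\<in>(\<lambda>p. restrict (\<beta> p) {..<d}) ` P. \<Sum>p | p \<in> P \<and> restrict (\<beta> p) {..<d} = l. c p * monomial d x (\<beta> p))"
    by (rule sum.image_gen[OF fin])
  also have "\<dots> = (\<Sum>l\<in>(\<lambda>p. restrict (\<beta> p) {..<d}) ` P.
      (\<Sum>p | p \<in> P \<and> (\<forall>i<d. \<beta> p i = l i). c p) * monomial d x l)"
    unfolding sum_distrib_right
  proof (intro sum.cong refl)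
    fix l assume "l \<in> (\<lambda>p. restrict (\<beta> p) {..<d}) ` P"
    then show "{p \<in> P. restrict (\<beta> p) {..<d} = l} = {p \<in> P. \<forall>i<d. \<beta> p i = l i}"
      by (auto simp: restrict_def fun_eq_iff)
  qed (auto simp: monomial_def intro!: prod.cong)
  also have "\<dots> = 0" by (simp add: coeff)
  finally show ?thesis .
qed

section \<open>Adding and removing boxes\<close>

text \<open>Thanks to the zero padding, a partition with few rows is the same function for every
  larger bound on the number of rows.\<close>

definition row_functions :: "nat \<Rightarrow> nat \<Rightarrow> (nat \<Rightarrow> nat) set" where
  "row_functions d n = {\<nu>. decseq \<nu> \<and> (\<forall>i\<ge>d. \<nu> i = 0) \<and> (\<Sum>i<d. \<nu> i) = n}"

lemma finite_row_functions [simp]: "finite (row_functions d n)"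
proof (rule finite_subset)
  show "row_functions d n \<subseteq> {\<nu>. \<forall>i. (i \<in> {..<d} \<longrightarrow> \<nu> i \<in> {..n}) \<and> (i \<notin> {..<d} \<longrightarrow> \<nu> i = 0)}"
    by (auto simp: row_functions_def intro: member_le_sum)
  show "finite {\<nu>. \<forall>i. (i \<in> {..<d} \<longrightarrow> \<nu> i \<in> {..n}) \<and> (i \<notin> {..<d} \<longrightarrow> \<nu> i = (0::nat))}"
    by (rule finite_set_of_finite_funs) auto
qed

definition removable :: "nat \<Rightarrow> (nat \<Rightarrow> nat) \<Rightarrow> nat set" where
  "removable d \<nu> = {i. i < d \<and> \<nu> (Suc i) < \<nu> i}"

definition addable :: "nat \<Rightarrow> (nat \<Rightarrow> nat) \<Rightarrow> nat set" where
  "addable d \<mu> = {i. i < d \<and> (i = 0 \<or> \<mu> i < \<mu> (i - 1))}"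

lemma finite_removable [simp]: "finite (removable d \<nu>)"
  and finite_addable [simp]: "finite (addable d \<nu>)"
  by (auto simp: removable_def addable_def)

lemma sum_upd:
  fixes \<nu> :: "nat \<Rightarrow> nat"
  assumes "i < d"
  shows "(\<Sum>j<d. (\<nu>(i := y)) j) + \<nu> i = (\<Sum>j<d. \<nu> j) + y"
proof -
  have split: "(\<Sum>j<d. f j) = f i + (\<Sum>j\<in>{..<d} - {i}. f j)" for f :: "nat \<Rightarrow> nat"
    using assms by (intro sum.remove) auto
  have "(\<Sum>j\<in>{..<d} - {i}. (\<nu>(i := y)) j) = (\<Sum>j\<in>{..<d} - {i}. \<nu> j)"
    by (intro sum.cong) auto
  then show ?thesis unfolding split[of \<nu>] split[of "\<nu>(i := y)"] by simp
qed

lemma add_box: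
  assumes \<mu>: "\<mu> \<in> row_functions d m" and i: "i \<in> addable d \<mu>"
  shows "\<mu>(i := Suc (\<mu> i)) \<in> row_functions d (Suc m)"
    "i \<in> removable d (\<mu>(i := Suc (\<mu> i)))"
proof -
  have dec: "decseq \<mu>" and id: "i < d" using \<mu> i by (auto simp: row_functions_def addable_def)
  have le: "\<mu> (Suc j) \<le> \<mu> j" for j using dec by (rule decseq_SucD)
  have "decseq (\<mu>(i := Suc (\<mu> i)))"
  proof (rule decseq_SucI)
    fix j show "(\<mu>(i := Suc (\<mu> i))) (Suc j) \<le> (\<mu>(i := Suc (\<mu> i))) j"
      using le[of j] i by (auto simp: addable_def)
  qed
  then show "\<mu>(i := Suc (\<mu> i)) \<in> row_functions d (Suc m)"
    using \<mu> id sum_upd[OF id, of \<mu> "Suc (\<mu> i)"] by (auto simp: row_functions_def)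
  show "i \<in> removable d (\<mu>(i := Suc (\<mu> i)))"
    using le[of i] id by (auto simp: removable_def)
qed

lemma remove_box:
  assumes \<nu>: "\<nu> \<in> row_functions d (Suc m)" and i: "i \<in> removable d \<nu>"
  shows "\<nu>(i := \<nu> i - 1) \<in> row_functions d m"
    "i \<in> addable d (\<nu>(i := \<nu> i - 1))"
proof -
  have dec: "decseq \<nu>" and id: "i < d" and pos: "\<nu> (Suc i) < \<nu> i"
    using \<nu> i by (auto simp: row_functions_def removable_def)
  have le: "\<nu> (Suc j) \<le> \<nu> j" for j using dec by (rule decseq_SucD)
  have "decseq (\<nu>(i := \<nu> i - 1))"
  proof (rule decseq_SucI)
    fix j show "(\<nu>(i := \<nu> i - 1)) (Suc j) \<le> (\<nu>(i := \<nu> i - 1)) j"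
      using le[of j] pos by auto
  qed
  then show "\<nu>(i := \<nu> i - 1) \<in> row_functions d m"
    using \<nu> id pos sum_upd[OF id, of \<nu> "\<nu> i - 1"] by (auto simp: row_functions_def)
  show "i \<in> addable d (\<nu>(i := \<nu> i - 1))"
    using le[of "i - 1"] id pos by (cases i) (auto simp: addable_def)
qed

text \<open>Both sides run over the edges of Young's lattice between sizes m and m + 1;
  \<open>F\<close> sees the lower end, the row of the box and the upper end.\<close>

lemma sum_add_remove:
  "(\<Sum>\<mu>\<in>row_functions d m. \<Sum>i\<in>addable d \<mu>. F \<mu> i (\<mu>(i := Suc (\<mu> i)))) =
   (\<Sum>\<nu>\<in>row_functions d (Suc m). \<Sum>i\<in>removable d \<nu>. F (\<nu>(i := \<nu> i - 1)) i \<nu>)"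
proof -
  have pos: "\<nu> i > 0" if "i \<in> removable d \<nu>" for \<nu> i
    using that by (auto simp: removable_def)
  have "(\<Sum>(\<mu>, i)\<in>Sigma (row_functions d m) (addable d). F \<mu> i (\<mu>(i := Suc (\<mu> i)))) =
    (\<Sum>(\<nu>, i)\<in>Sigma (row_functions d (Suc m)) (removable d). F (\<nu>(i := \<nu> i - 1)) i \<nu>)"
    by (rule sum.reindex_bij_witness[where i="\<lambda>(\<nu>, i). (\<nu>(i := \<nu> i - 1), i)"
          and j="\<lambda>(\<mu>, i). (\<mu>(i := Suc (\<mu> i)), i)"])
       (auto simp: add_box remove_box[simplified] dest: pos)
  then show ?thesis by (simp add: sum.Sigma)
qed

lemma shifted_upd:
  assumes "i < d" "a < d"
  shows "shifted d (\<nu>(i := y)) a = (if a = d - Suc i then y + (d - Suc i) else shifted d \<nu> a)"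
proof -
  have "d - Suc a = i \<longleftrightarrow> a = d - Suc i" using assms by auto
  then show ?thesis by (auto simp: shifted_def)
qed

section \<open>Pieri rule and weights\<close>

text \<open>In the term of a permutation p, the factor x_i raises the exponent of row i, that is,
  the shifted part number p i.\<close>

lemma alternant_pieri:
  "(\<Sum>i<d. x i) * alternant d (\<lambda>i k. x i ^ k) l =
    (\<Sum>j<d. alternant d (\<lambda>i k. x i ^ k) (l(j := Suc (l j))))"
proof -
  have eq: "(\<Sum>j<d. \<Prod>a<d. x a ^ (l(j := Suc (l j))) (p a)) = (\<Sum>i<d. x i) * (\<Prod>a<d. x a ^ l (p a))"
    if p: "p permutes {..<d}" for p
  proof -
    have inj: "p a = p i \<longleftrightarrow> a = i" for a i using permutes_inj[OF p] by (simp add: inj_eq)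
    have "(\<Sum>j<d. \<Prod>a<d. x a ^ (l(j := Suc (l j))) (p a)) =
        (\<Sum>i<d. \<Prod>a<d. x a ^ (l(p i := Suc (l (p i)))) (p a))"
      by (rule sum_permuted[OF p, symmetric])
    also have "\<dots> = (\<Sum>i<d. x i * (\<Prod>a<d. x a ^ l (p a)))"
    proof (intro sum.cong refl)
      fix i assume i: "i \<in> {..<d}"
      have "(\<Prod>a<d. x a ^ (l(p i := Suc (l (p i)))) (p a)) = (\<Prod>a<d. (if a = i then x a else 1) * x a ^ l (p a))"
        by (intro prod.cong) (auto simp: inj)
      then show "(\<Prod>a<d. x a ^ (l(p i := Suc (l (p i)))) (p a)) = x i * (\<Prod>a<d. x a ^ l (p a))"
        using i by (simp add: prod.distrib)
    qed
    finally show ?thesis by (simp add: sum_distrib_right)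
  qed
  have "(\<Sum>j<d. alternant d (\<lambda>i k. x i ^ k) (l(j := Suc (l j)))) =
      (\<Sum>p | p permutes {..<d}. of_int (sign p) * (\<Sum>j<d. \<Prod>a<d. x a ^ (l(j := Suc (l j))) (p a)))"
    unfolding alternant_def sum_distrib_left by (rule sum.swap)
  also have "\<dots> = (\<Sum>p | p permutes {..<d}. of_int (sign p) * ((\<Sum>i<d. x i) * (\<Prod>a<d. x a ^ l (p a))))"
    by (intro sum.cong refl) (simp only: eq mem_Collect_eq)
  also have "\<dots> = (\<Sum>i<d. x i) * alternant d (\<lambda>i k. x i ^ k) l"
    unfolding alternant_def sum_distrib_left[of "\<Sum>i<d. x i"] by (simp only: mult.left_commute)
  finally show ?thesis ..
qed

text \<open>Adding a box where it does not fit makes two neighbouring shifted parts equal, and the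
  alternant vanishes.\<close>

lemma alternant_pieri_partition:
  assumes "\<mu> \<in> row_functions d m"
  shows "(\<Sum>i<d. x i) * alternant d (\<lambda>i k. x i ^ k) (shifted d \<mu>) =
    (\<Sum>i\<in>addable d \<mu>. alternant d (\<lambda>i k. x i ^ k) (shifted d (\<mu>(i := Suc (\<mu> i)))))"
proof -
  let ?A = "alternant d (\<lambda>i k. x i ^ k)" and ?l = "shifted d \<mu>"
  have dec: "decseq \<mu>" using assms by (simp add: row_functions_def)
  have "(\<Sum>i<d. x i) * ?A ?l = (\<Sum>j<d. ?A (?l(j := Suc (?l j))))"
    by (rule alternant_pieri)
  also have "\<dots> = (\<Sum>i<d. ?A (?l(d - Suc i := Suc (?l (d - Suc i)))))"
    by (rule sum.nat_diff_reindex[symmetric])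
  also have "\<dots> = (\<Sum>i<d. ?A (shifted d (\<mu>(i := Suc (\<mu> i)))))"
    by (intro sum.cong refl alternant_cong) (auto simp: shifted_upd, auto simp: shifted_def)
  also have "\<dots> = (\<Sum>i\<in>addable d \<mu>. ?A (shifted d (\<mu>(i := Suc (\<mu> i)))))"
  proof (rule sum.mono_neutral_right)
    show "\<forall>i\<in>{..<d} - addable d \<mu>. ?A (shifted d (\<mu>(i := Suc (\<mu> i)))) = 0"
    proof
      fix i assume "i \<in> {..<d} - addable d \<mu>"
      then have i: "i < d" "i \<noteq> 0" "\<mu> (i - 1) \<le> \<mu> i" by (auto simp: addable_def)
      moreover have "\<mu> i \<le> \<mu> (i - 1)" using dec by (rule decseqD) simp
      ultimately have "\<mu> i = \<mu> (i - 1)" by simp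
      then have "shifted d (\<mu>(i := Suc (\<mu> i))) (d - Suc i) = shifted d (\<mu>(i := Suc (\<mu> i))) (d - i)"
        using i by (auto simp: shifted_upd) (auto simp: shifted_def)
      then show "?A (shifted d (\<mu>(i := Suc (\<mu> i)))) = 0"
        using i by (intro alternant_repeated[of "d - Suc i" d "d - i"]) auto
    qed
  qed (auto simp: addable_def)
  finally show ?thesis .
qed

text \<open>Lowering a part that is not removable produces two equal shifted parts, except in an
  empty last row. There the shifted part is 0 and the truncated subtraction leaves the determinant
  unchanged; \<open>c 0 = 0\<close> removes this term.\<close>

lemma sum_removable:
  fixes c :: "nat \<Rightarrow> real"
  assumes \<nu>: "\<nu> \<in> row_functions d n" and "c 0 = 0"
  shows "(\<Sum>i\<in>removable d \<nu>. c (shifted d \<nu> (d - Suc i)) *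
      binomial_det d (shifted d (\<nu>(i := \<nu> i - 1)))) =
    (\<Sum>j<d. c (shifted d \<nu> j) *
      binomial_det d ((shifted d \<nu>)(j := shifted d \<nu> j - 1)))"
proof -
  let ?l = "shifted d \<nu>"
  have dec: "decseq \<nu>" and zero: "\<nu> d = 0" using \<nu> by (auto simp: row_functions_def)
  have "(\<Sum>j<d. c (?l j) * binomial_det d (?l(j := ?l j - 1))) =
      (\<Sum>i<d. c (?l (d - Suc i)) * binomial_det d (?l(d - Suc i := ?l (d - Suc i) - 1)))"
    by (rule sum.nat_diff_reindex[symmetric])
  also have "\<dots> = (\<Sum>i\<in>removable d \<nu>. c (?l (d - Suc i)) *
      binomial_det d (?l(d - Suc i := ?l (d - Suc i) - 1)))"
  proof (rule sum.mono_neutral_right)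
    show "\<forall>i\<in>{..<d} - removable d \<nu>.
        c (?l (d - Suc i)) * binomial_det d (?l(d - Suc i := ?l (d - Suc i) - 1)) = 0"
    proof
      fix i assume "i \<in> {..<d} - removable d \<nu>"
      then have i: "i < d" "\<nu> i \<le> \<nu> (Suc i)" by (auto simp: removable_def)
      moreover have "\<nu> (Suc i) \<le> \<nu> i" using dec by (rule decseq_SucD)
      ultimately have eq: "\<nu> i = \<nu> (Suc i)" by simp
      show "c (?l (d - Suc i)) * binomial_det d (?l(d - Suc i := ?l (d - Suc i) - 1)) = 0"
      proof (cases "Suc i = d")
        case True
        then have "?l (d - Suc i) = 0" using eq zero by (simp add: shifted_def flip: True)
        then show ?thesis using \<open>c 0 = 0\<close> by simp
      next
        case False
        then have "(?l(d - Suc i := ?l (d - Suc i) - 1)) (d - Suc i) =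
            (?l(d - Suc i := ?l (d - Suc i) - 1)) (d - Suc (Suc i))"
          using eq i by (auto simp: shifted_def Suc_diff_Suc)
        then have "binomial_det d (?l(d - Suc i := ?l (d - Suc i) - 1)) = 0"
          using False i by (intro alternant_repeated[of "d - Suc i" d "d - Suc (Suc i)"]) auto
        then show ?thesis by simp
      qed
    qed
  qed (auto simp: removable_def)
  also have "\<dots> = (\<Sum>i\<in>removable d \<nu>. c (?l (d - Suc i)) * binomial_det d (shifted d (\<nu>(i := \<nu> i - 1))))"
    by (intro sum.cong refl arg_cong[of _ _ "\<lambda>y. _ * y"] alternant_cong)
       (auto simp: removable_def shifted_upd, auto simp: shifted_def)
  finally show ?thesis by simp
qed

section \<open>Closed forms for tableau counts and Schur coefficients\<close>

definition fact_parts :: "nat \<Rightarrow> (nat \<Rightarrow> nat) \<Rightarrow> real" where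
  "fact_parts d \<nu> = (\<Prod>j<d. fact (shifted d \<nu> j))"

lemma fact_parts_remove:
  assumes "i \<in> removable d \<nu>"
  shows "fact_parts d \<nu> = real (shifted d \<nu> (d - Suc i)) * fact_parts d (\<nu>(i := \<nu> i - 1))"
    and "shifted d \<nu> (d - Suc i) > 0"
proof -
  let ?j = "d - Suc i" and ?l = "shifted d \<nu>"
  have i: "i < d" "\<nu> i > 0" using assms by (auto simp: removable_def)
  then show pos: "?l ?j > 0" by (simp add: shifted_def)
  have j: "?j \<in> {..<d}" using i by auto
  have "(\<Prod>a\<in>{..<d} - {?j}. fact (shifted d (\<nu>(i := \<nu> i - 1)) a)) = (\<Prod>a\<in>{..<d} - {?j}. fact (?l a) :: real)"
    using i by (intro prod.cong) (auto simp: shifted_upd)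
  moreover have "shifted d (\<nu>(i := \<nu> i - 1)) ?j = ?l ?j - 1"
    using i by (simp add: shifted_def)
  moreover have "fact (?l ?j) = real (?l ?j) * fact (?l ?j - 1)"
    using pos by (rule fact_reduce)
  ultimately show "fact_parts d \<nu> = real (?l ?j) * fact_parts d (\<nu>(i := \<nu> i - 1))"
    unfolding fact_parts_def prod.remove[OF finite_lessThan j] by simp
qed

definition fact_below :: "nat \<Rightarrow> real" where
  "fact_below d = (\<Prod>m<d. fact m)"

text \<open>Frobenius' formula for the number of standard tableaux: \<open>fact_below d\<close>
  times the binomial determinant is the product of the differences of the shifted parts.\<close>

definition syt_weight :: "nat \<Rightarrow> nat \<Rightarrow> (nat \<Rightarrow> nat) \<Rightarrow> real" where
  "syt_weight d n \<nu> = fact n * fact_below d * binomial_det d (shifted d \<nu>) / fact_parts d \<nu>"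

text \<open>The coefficient of the Schur polynomial, with one factor of the binomial determinant
  already cancelled; its recursion then involves that determinant linearly.\<close>

definition schur_weight :: "nat \<Rightarrow> nat \<Rightarrow> (nat \<Rightarrow> nat) \<Rightarrow> real" where
  "schur_weight d n \<nu> = (fact n)\<^sup>2 * (fact_below d)\<^sup>2 * binomial_det d (shifted d \<nu>) / (fact_parts d \<nu>)\<^sup>2"

lemma schur_weight_eq:
  assumes "decseq \<nu>"
  shows "schur_weight d n \<nu> = (syt_weight d n \<nu>)\<^sup>2 / gt_sum d (\<lambda>_. 1) \<nu>"
  unfolding schur_weight_def syt_weight_def alternant_binomial[OF assms]
  by (simp add: power2_eq_square field_simps)

text \<open>Removing a box divides \<open>fact_parts\<close> by its shifted part l, so the summands
  acquire the weight l of \<open>binomial_det_lower\<close>; the resulting scalar m + 1 completes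
  the factorial.\<close>

lemma syt_weight_rec:
  assumes \<nu>: "\<nu> \<in> row_functions d (Suc m)"
  shows "syt_weight d (Suc m) \<nu> = (\<Sum>i\<in>removable d \<nu>. syt_weight d m (\<nu>(i := \<nu> i - 1)))"
proof -
  let ?l = "shifted d \<nu>"
  have "(\<Sum>i\<in>removable d \<nu>. syt_weight d m (\<nu>(i := \<nu> i - 1))) =
    (\<Sum>i\<in>removable d \<nu>. fact m * fact_below d / fact_parts d \<nu> *
       (real (?l (d - Suc i)) * binomial_det d (shifted d (\<nu>(i := \<nu> i - 1)))))"
  proof (intro sum.cong refl)
    fix i assume i: "i \<in> removable d \<nu>"
    show "syt_weight d m (\<nu>(i := \<nu> i - 1)) = fact m * fact_below d / fact_parts d \<nu> *
       (real (?l (d - Suc i)) * binomial_det d (shifted d (\<nu>(i := \<nu> i - 1))))"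
      unfolding syt_weight_def fact_parts_remove(1)[OF i] using fact_parts_remove(2)[OF i] by simp
  qed
  also have "\<dots> = fact m * fact_below d / fact_parts d \<nu> * ((real (\<Sum>j<d. ?l j) - real (\<Sum>j<d. j)) * binomial_det d ?l)"
    unfolding sum_distrib_left[symmetric]
      sum_removable[OF \<nu>, where c=real, OF of_nat_0] binomial_det_lower ..
  also have "real (\<Sum>j<d. ?l j) - real (\<Sum>j<d. j) = real (Suc m)"
    using \<nu> by (simp add: sum_shifted row_functions_def)
  also have "fact m * fact_below d / fact_parts d \<nu> * (real (Suc m) * binomial_det d ?l) = syt_weight d (Suc m) \<nu>"
    by (simp add: syt_weight_def)
  finally show ?thesis ..
qed

text \<open>The squared denominator now gives the weight l^2, so
  \<open>binomial_det_lower_square\<close> applies and produces the eigenvalue of the radial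
  operator.\<close>

lemma schur_weight_rec:
  assumes \<nu>: "\<nu> \<in> row_functions d (Suc m)" and "d > 0"
  shows "(real (Suc m))\<^sup>2 * (\<Sum>i\<in>removable d \<nu>. schur_weight d m (\<nu>(i := \<nu> i - 1))) =
    casimir d (shifted d \<nu>) * schur_weight d (Suc m) \<nu>"
proof -
  let ?l = "shifted d \<nu>"
  have "(\<Sum>i\<in>removable d \<nu>. schur_weight d m (\<nu>(i := \<nu> i - 1))) =
    (\<Sum>i\<in>removable d \<nu>. (fact m)\<^sup>2 * (fact_below d)\<^sup>2 / (fact_parts d \<nu>)\<^sup>2 *
       ((real (?l (d - Suc i)))\<^sup>2 * binomial_det d (shifted d (\<nu>(i := \<nu> i - 1)))))"
  proof (intro sum.cong refl)
    fix i assume i: "i \<in> removable d \<nu>"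
    show "schur_weight d m (\<nu>(i := \<nu> i - 1)) = (fact m)\<^sup>2 * (fact_below d)\<^sup>2 / (fact_parts d \<nu>)\<^sup>2 *
       ((real (?l (d - Suc i)))\<^sup>2 * binomial_det d (shifted d (\<nu>(i := \<nu> i - 1))))"
      unfolding schur_weight_def fact_parts_remove(1)[OF i] using fact_parts_remove(2)[OF i]
      by (simp add: power_mult_distrib)
  qed
  also have "\<dots> = (fact m)\<^sup>2 * (fact_below d)\<^sup>2 / (fact_parts d \<nu>)\<^sup>2 * (casimir d ?l * binomial_det d ?l)"
  proof -
    have "(real 0)\<^sup>2 = 0" by simp
    from sum_removable[OF \<nu>, where c="\<lambda>k. (real k)\<^sup>2", OF this] show ?thesis
      unfolding sum_distrib_left[symmetric] binomial_det_lower_square[OF \<open>d > 0\<close>] by simp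
  qed
  finally show ?thesis
    by (simp add: schur_weight_def power_mult_distrib)
qed

section \<open>The Vandermonde product\<close>

text \<open>As a polynomial in one variable the product has the other variables as roots.
  \<open>C\<close> absorbs the sign and all other factors, which do not affect the logarithmic
  derivative.\<close>

lemma vandermonde_update:
  assumes "i < d"
  shows "\<exists>C. \<forall>z. vandermonde d (x(i := z)) = C * (\<Prod>j\<in>{..<d} - {i}. z - x j)"
  using assms
proof (induction d arbitrary: x i)
  case (Suc r)
  have sets: "{..<Suc r} - {0} = Suc ` {..<r}"
    "{..<Suc r} - {Suc k} = insert 0 (Suc ` ({..<r} - {k}))" for k
    by (auto simp: lessThan_Suc_eq_insert_0)
  show ?case
  proof (cases i)
    case 0
    have "vandermonde (Suc r) (x(i := z)) =
        ((- 1) ^ r * vandermonde r (\<lambda>j. x (Suc j))) * (\<Prod>j\<in>{..<Suc r} - {i}. z - x j)" for z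
    proof -
      have "(\<Prod>j<r. x (Suc j) - z) = (\<Prod>j<r. (- 1) * (z - x (Suc j)))"
        by (intro prod.cong) auto
      also have "\<dots> = (- 1) ^ r * (\<Prod>j\<in>{..<Suc r} - {i}. z - x j)"
        unfolding prod.distrib by (simp add: 0 sets prod.reindex)
      finally show ?thesis by (simp add: 0)
    qed
    then show ?thesis by blast
  next
    case (Suc k)
    then have k: "k < r" using Suc.prems by simp
    from Suc.IH[OF k, of "\<lambda>j. x (Suc j)"] obtain C where
      C: "\<And>z. vandermonde r ((\<lambda>j. x (Suc j))(k := z)) = C * (\<Prod>j\<in>{..<r} - {k}. z - x (Suc j))" by blast
    have "vandermonde (Suc r) (x(i := z)) =
        (C * (\<Prod>j\<in>{..<r} - {k}. x (Suc j) - x 0)) * (\<Prod>j\<in>{..<Suc r} - {i}. z - x j)" for z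
    proof -
      have "(\<lambda>j. (x(i := z)) (Suc j)) = (\<lambda>j. x (Suc j))(k := z)" by (auto simp: Suc fun_eq_iff)
      moreover have "(\<Prod>j<r. (x(i := z)) (Suc j) - (x(i := z)) 0) =
          (z - x 0) * (\<Prod>j\<in>{..<r} - {k}. x (Suc j) - x 0)"
        using k by (subst prod.remove[of _ k]) (auto simp: Suc intro!: prod.cong)
      moreover have "(\<Prod>j\<in>{..<Suc r} - {i}. z - x j) = (z - x 0) * (\<Prod>j\<in>{..<r} - {k}. z - x (Suc j))"
        unfolding Suc sets by (subst prod.insert) (auto simp: prod.reindex)
      ultimately show ?thesis
        by (simp only: vandermonde.simps C) (simp add: mult_ac)
    qed
    then show ?thesis by blast
  qed
qed simp

lemma vandermonde_nonzero:
  "inj_on x {..<d} \<Longrightarrow> vandermonde d x \<noteq> 0"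
proof (induction d arbitrary: x)
  case (Suc r)
  have "x (Suc j) \<noteq> x 0" if "j < r" for j
    using inj_onD[OF Suc.prems, of "Suc j" 0] that by auto
  moreover have "inj_on (\<lambda>j. x (Suc j)) {..<r}"
    using Suc.prems by (auto simp: inj_on_def)
  ultimately show ?case using Suc.IH by simp
qed simp

lemma gt_sum_zero: "gt_sum d x (\<lambda>_. 0) = 1"
proof (induction d arbitrary: x)
  case (Suc r)
  have "interlacing r (\<lambda>_. 0) = {\<lambda>_. 0}"
    by (auto simp: interlacing_def fun_eq_iff not_less) (metis not_less le_zero_eq)
  then show ?case using Suc by simp
qed simp

lemma vandermonde_expansion:
  assumes "\<And>i. i < d \<Longrightarrow> x i > 0"
  shows "(\<Sum>p | p permutes {..<d}. of_int (sign p) * monomial d x p) = vandermonde d x"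
proof -
  have "shifted d (\<lambda>_. 0) = (\<lambda>j. j)" by (auto simp: shifted_def)
  then show ?thesis
    using alternant_power[of "\<lambda>_. 0" d x] assms
    by (simp add: gt_sum_zero alternant_def monomial_def decseq_def)
qed

text \<open>Both sides are th_i of the Vandermonde product, computed from its Leibniz expansion and
  as a logarithmic derivative of its factors.\<close>

lemma vandermonde_euler:
  assumes pos: "\<And>i. i < d \<Longrightarrow> x i > 0" and inj: "inj_on x {..<d}" and i: "i < d"
  shows "(\<Sum>p | p permutes {..<d}. of_int (sign p) * (real (p i) * monomial d x p)) =
    vandermonde d x * (\<Sum>j\<in>{..<d} - {i}. x i / (x i - x j))"
proof -
  define R where "R p = (\<Prod>a\<in>{..<d} - {i}. x a ^ p a)" for p :: "nat \<Rightarrow> nat"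
  have mon: "monomial d (x(i := z)) p = z ^ p i * R p" for z p
    unfolding monomial_def R_def using i
    by (subst prod.remove[of _ i]) (auto intro!: prod.cong)
  define f where "f z = (\<Sum>p | p permutes {..<d}. of_int (sign p) * (z ^ p i * R p))" for z
  have f: "f z = vandermonde d (x(i := z))" if "z > 0" for z
    using vandermonde_expansion[of d "x(i := z)"] pos that by (simp add: f_def mon)
  obtain C where C: "\<And>z. vandermonde d (x(i := z)) = C * (\<Prod>j\<in>{..<d} - {i}. z - x j)"
    using vandermonde_update[OF i] by blast
  have ne: "x i - x j \<noteq> 0" if "j \<in> {..<d} - {i}" for j
    using inj_onD[OF inj, of i j] i that by auto
  have "((\<lambda>z. \<Prod>j\<in>{..<d} - {i}. z - x j) has_real_derivative
      (\<Prod>j\<in>{..<d} - {i}. x i - x j) * (\<Sum>j\<in>{..<d} - {i}. 1 / (x i - x j))) (at (x i))"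
    by (rule has_field_derivative_prod'[where f="\<lambda>j z. z - x j" and f'="\<lambda>_. 1"])
       (use ne in \<open>auto intro!: derivative_eq_intros\<close>)
  from DERIV_cmult[OF this, of C]
  have "((\<lambda>z. vandermonde d (x(i := z))) has_real_derivative
      vandermonde d (x(i := x i)) * (\<Sum>j\<in>{..<d} - {i}. 1 / (x i - x j))) (at (x i))"
    unfolding C by (simp add: mult.assoc)
  \<comment> \<open>The expansion is known at positive arguments, an open set containing x_i, which
    suffices for the derivatives.\<close>
  from has_field_derivative_transform_within_open[OF this, of "{0<..}" f]
  have "(f has_real_derivative vandermonde d x * (\<Sum>j\<in>{..<d} - {i}. 1 / (x i - x j))) (at (x i))"
    using f pos[OF i] by simp
  moreover have "(f has_real_derivative
      (\<Sum>p | p permutes {..<d}. of_int (sign p) * (real (p i) * x i ^ (p i - Suc 0) * R p))) (at (x i))"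
    unfolding f_def by (auto intro!: derivative_eq_intros sum.cong simp: mult_ac)
  ultimately have "(\<Sum>p | p permutes {..<d}. of_int (sign p) * (real (p i) * x i ^ (p i - Suc 0) * R p)) =
      vandermonde d x * (\<Sum>j\<in>{..<d} - {i}. 1 / (x i - x j))"
    by (rule DERIV_unique[rotated])
  moreover have "real (p i) * monomial d x p = x i * (real (p i) * x i ^ (p i - Suc 0) * R p)" for p
    using mon[of "x i" p] by (cases "p i") auto
  then have "(\<Sum>p | p permutes {..<d}. of_int (sign p) * (real (p i) * monomial d x p)) =
      x i * (\<Sum>p | p permutes {..<d}. of_int (sign p) * (real (p i) * x i ^ (p i - Suc 0) * R p))"
    unfolding sum_distrib_left by (intro sum.cong refl) simp
  moreover have "(\<Sum>j\<in>{..<d} - {i}. x i / (x i - x j)) = x i * (\<Sum>j\<in>{..<d} - {i}. 1 / (x i - x j))"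
    by (simp add: sum_distrib_left)
  ultimately show ?thesis by simp
qed

section \<open>Solving the radial equation\<close>

lemma sum_offdiag_swap:
  fixes h :: "nat \<Rightarrow> nat \<Rightarrow> real"
  shows "(\<Sum>i<d. \<Sum>j\<in>{..<d} - {i}. h i j) = (\<Sum>i<d. \<Sum>j\<in>{..<d} - {i}. h j i)"
proof -
  have rest: "(\<Sum>j\<in>{..<d} - {i}. g j) = (\<Sum>j<d. if i = j then 0 else g j)" for i and g :: "nat \<Rightarrow> real"
    by (rule sum.mono_neutral_cong_left) auto
  have "(\<Sum>i<d. \<Sum>j<d. if i = j then 0 else h i j) = (\<Sum>j<d. \<Sum>i<d. if i = j then 0 else h i j)"
    by (rule sum.swap)
  then show ?thesis unfolding rest by (simp add: eq_commute)
qed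

text \<open>For s_ij = x_i/(x_i - x_j) one has s_ij + s_ji = 1. Hence the cross term from
  conjugation by the Vandermonde product is the first-order part of the radial operator plus d - 1
  times the Euler operator.\<close>

lemma euler_vandermonde_identity:
  assumes inj: "inj_on x {..<d}"
  shows "2 * (\<Sum>i<d. (\<Sum>j\<in>{..<d} - {i}. x i / (x i - x j)) * E i) - (real d - 1) * (\<Sum>i<d. E i) =
    (\<Sum>i<d. \<Sum>j\<in>{..<d} - {i}. x i * (E i - E j) / (x i - x j) :: real)"
proof -
  define s where "s i j = x i / (x i - x j)" for i j
  have s: "s j i = 1 - s i j" if "i < d" "j \<in> {..<d} - {i}" for i j
  proof -
    have "x i - x j \<noteq> 0" using inj_onD[OF inj, of i j] that by auto
    then show ?thesis by (simp add: s_def field_simps)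
  qed
  have "(\<Sum>i<d. \<Sum>j\<in>{..<d} - {i}. x i * (E i - E j) / (x i - x j)) =
      (\<Sum>i<d. \<Sum>j\<in>{..<d} - {i}. s i j * E i) - (\<Sum>i<d. \<Sum>j\<in>{..<d} - {i}. s i j * E j)"
    by (simp add: s_def sum_subtractf[symmetric] right_diff_distrib diff_divide_distrib)
  also have "(\<Sum>i<d. \<Sum>j\<in>{..<d} - {i}. s i j * E j) = (\<Sum>i<d. \<Sum>j\<in>{..<d} - {i}. s j i * E i)"
    by (rule sum_offdiag_swap)
  also have "\<dots> = (\<Sum>i<d. \<Sum>j\<in>{..<d} - {i}. E i - s i j * E i)"
  proof (intro sum.cong refl)
    fix i j assume "i \<in> {..<d}" "j \<in> {..<d} - {i}"
    then have "s j i = 1 - s i j" by (intro s) auto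
    then show "s j i * E i = E i - s i j * E i" by (simp only: left_diff_distrib mult_1_left)
  qed
  also have "\<dots> = (real d - 1) * (\<Sum>i<d. E i) - (\<Sum>i<d. \<Sum>j\<in>{..<d} - {i}. s i j * E i)"
    by (simp add: sum_subtractf sum_distrib_left card_Diff_singleton of_nat_diff Suc_le_eq)
  finally show ?thesis
    by (simp add: s_def sum_distrib_right)
qed

lemma monomial_add: "monomial d x (\<lambda>i. a i + b i) = monomial d x a * monomial d x b"
  by (simp add: monomial_def power_add prod.distrib)

lemma alternant_monomial:
  "alternant d (\<lambda>i k. x i ^ k) l = (\<Sum>p | p permutes {..<d}. of_int (sign p) * monomial d x (\<lambda>i. l (p i)))"
  by (simp add: alternant_def monomial_def)

lemma casimir_permuted:
  assumes "p permutes {..<d}" shows "casimir d (\<lambda>i. l (p i)) = casimir d l"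
  using sum_permuted[OF assms, of l] sum_permuted[OF assms, of "\<lambda>i. (real (l i))\<^sup>2"]
  by (simp add: casimir_def flip: of_nat_sum)

lemma row_functions_0: "row_functions d 0 = {\<lambda>_. 0}"
  by (auto simp: row_functions_def decseq_def fun_eq_iff) (metis leI lessThan_iff)

lemma syt_weight_0: "syt_weight d 0 (\<lambda>_. 0) = 1"
proof -
  have "fact_parts d (\<lambda>_. 0) = fact_below d"
    by (simp add: fact_parts_def fact_below_def shifted_def)
  moreover have "fact_below d \<noteq> 0" by (simp add: fact_below_def)
  ultimately show ?thesis
    by (simp add: syt_weight_def alternant_binomial decseq_def gt_sum_zero)
qed

text \<open>The measure is abstracted away: G n is a symmetric homogeneous polynomial given by its
  monomials, and \<open>E f\<close> is that polynomial with the additional weight f, so exponents as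
  weights stand for derivatives.\<close>

lemma radial_solution:
  fixes G :: "nat \<Rightarrow> (nat \<Rightarrow> real) \<Rightarrow> real" and P :: "nat \<Rightarrow> 'p set"
    and e :: "'p \<Rightarrow> real" and \<alpha> :: "'p \<Rightarrow> nat \<Rightarrow> nat"
  assumes d: "d > 0" and fin: "\<And>n. finite (P n)"
    and expansion: "\<And>n x. (\<And>i. i < d \<Longrightarrow> x i > 0) \<Longrightarrow> G n x = (\<Sum>p\<in>P n. e p * monomial d x (\<alpha> p))"
    and deg: "\<And>n p. p \<in> P n \<Longrightarrow> (\<Sum>i<d. \<alpha> p i) = n"
    and G0: "\<And>x. (\<And>i. i < d \<Longrightarrow> x i > 0) \<Longrightarrow> G 0 x = 1"
    and sym: "\<And>n x a b. (\<And>i. i < d \<Longrightarrow> x i > 0) \<Longrightarrow> a < d \<Longrightarrow> b < d \<Longrightarrow>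
      G n (\<lambda>i. x (Transposition.transpose a b i)) = G n x"
    and pde: "\<And>m x E. (\<And>i. i < d \<Longrightarrow> x i > 0) \<Longrightarrow> inj_on x {..<d} \<Longrightarrow>
      E = (\<lambda>f. \<Sum>p\<in>P (Suc m). f p * (e p * monomial d x (\<alpha> p))) \<Longrightarrow>
      (real (Suc m))\<^sup>2 * (\<Sum>i<d. x i) * G m x =
      (\<Sum>i<d. E (\<lambda>p. (real (\<alpha> p i))\<^sup>2)) +
      (\<Sum>i<d. \<Sum>j\<in>{..<d} - {i}. x i * (E (\<lambda>p. real (\<alpha> p i)) - E (\<lambda>p. real (\<alpha> p j))) / (x i - x j))"
    and pos: "\<And>i. i < d \<Longrightarrow> x i > 0"
  shows "vandermonde d x * G n x = (\<Sum>\<nu>\<in>row_functions d n. schur_weight d n \<nu> *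
    alternant d (\<lambda>i k. x i ^ k) (shifted d \<nu>))"
  using pos
proof (induction n arbitrary: x)
  case 0
  have "decseq (\<lambda>_::nat. 0::nat)" by (simp add: decseq_def)
  then show ?case
    using alternant_power[of "\<lambda>_. 0" d x] 0
    by (simp add: row_functions_0 schur_weight_eq syt_weight_0 gt_sum_zero G0)
next
  case (Suc m)
  let ?n = "Suc m" and ?S = "{p :: nat \<Rightarrow> nat. p permutes {..<d}}"
  let ?A = "\<lambda>x \<nu>. alternant d (\<lambda>i k. x i ^ k) (shifted d \<nu>)"
  \<comment> \<open>The difference of both sides becomes one monomial sum over a disjoint union, as
    \<open>antisymmetric_casimir_zero\<close> requires: \<open>P1\<close> carries the product of the
    Vandermonde expansion with G, \<open>P2\<close> the alternants with a minus sign.\<close>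
  define P1 where "P1 = ?S \<times> P ?n"
  define P2 where "P2 = row_functions d ?n \<times> ?S"
  define c1 where "c1 = (\<lambda>(p :: nat \<Rightarrow> nat, q). of_int (sign p) * e q :: real)"
  define b1 where "b1 = (\<lambda>(p, q) i. p i + \<alpha> q i :: nat)"
  define c2 where "c2 = (\<lambda>(\<nu>, p :: nat \<Rightarrow> nat). - schur_weight d ?n \<nu> * of_int (sign p) :: real)"
  define b2 where "b2 = (\<lambda>(\<nu>, p :: nat \<Rightarrow> nat) i. shifted d \<nu> (p i))"
  define I where "I = P1 <+> P2"
  define c where "c = case_sum c1 c2"
  define b where "b = case_sum b1 b2"
  have fin1: "finite P1" and fin2: "finite P2"
    using fin by (auto simp: P1_def P2_def finite_permutations)
  have split: "(\<Sum>p\<in>I. c p * f (b p)) = (\<Sum>p\<in>P1. c1 p * f (b1 p)) + (\<Sum>p\<in>P2. c2 p * f (b2 p))"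
    for f :: "(nat \<Rightarrow> nat) \<Rightarrow> real"
    unfolding I_def by (subst sum.Plus[OF fin1 fin2]) (simp add: c_def b_def)
  have sum1: "(\<Sum>p\<in>P1. c1 p * monomial d x (b1 p)) = vandermonde d x * G ?n x"
    if "\<And>i. i < d \<Longrightarrow> x i > 0" for x
  proof -
    have "(\<Sum>p\<in>P1. c1 p * monomial d x (b1 p)) =
        (\<Sum>p\<in>?S. \<Sum>q\<in>P ?n. (of_int (sign p) * monomial d x p) * (e q * monomial d x (\<alpha> q)))"
      unfolding P1_def sum.cartesian_product
      by (intro sum.cong refl) (auto simp: c1_def b1_def monomial_add)
    moreover have "G ?n x = (\<Sum>q\<in>P ?n. e q * monomial d x (\<alpha> q))"
      by (rule expansion) (rule that)
    moreover have "vandermonde d x = (\<Sum>p\<in>?S. of_int (sign p) * monomial d x p)"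
      by (rule vandermonde_expansion[symmetric]) (rule that)
    ultimately show ?thesis by (simp only: sum_product)
  qed
  have sum2: "(\<Sum>p\<in>P2. c2 p * f (b2 p)) =
      - (\<Sum>\<nu>\<in>row_functions d ?n. schur_weight d ?n \<nu> *
        (\<Sum>p\<in>?S. of_int (sign p) * f (\<lambda>i. shifted d \<nu> (p i))))" for f
  proof -
    have "(\<Sum>p\<in>P2. c2 p * f (b2 p)) = (\<Sum>\<nu>\<in>row_functions d ?n. \<Sum>p\<in>?S.
        - (schur_weight d ?n \<nu> * (of_int (sign p) * f (\<lambda>i. shifted d \<nu> (p i)))))"
      unfolding P2_def sum.cartesian_product
      by (intro sum.cong refl) (auto simp: c2_def b2_def)
    then show ?thesis
      unfolding sum_negf sum_distrib_left .
  qed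
  have sum2': "(\<Sum>p\<in>P2. c2 p * monomial d x (b2 p)) =
      - (\<Sum>\<nu>\<in>row_functions d ?n. schur_weight d ?n \<nu> * ?A x \<nu>)" for x
    unfolding sum2 alternant_monomial ..
  have degree: "(\<Sum>i<d. b p i) = ?n + (\<Sum>j<d. j)" if "p \<in> I" for p
    using that unfolding I_def
  proof (elim PlusE)
    fix r assume "r \<in> P1" "p = Inl r"
    then show ?thesis
      using deg[of "snd r" ?n] sum_permuted[of "fst r" d "\<lambda>j. j"]
      by (auto simp: b_def b1_def P1_def case_prod_unfold sum.distrib)
  next
    fix r assume r: "r \<in> P2" "p = Inr r"
    then have "snd r permutes {..<d}" by (auto simp: P2_def)
    from sum_permuted[OF this, of "shifted d (fst r)"] r show ?thesis
      by (auto simp: b_def b2_def P2_def case_prod_unfold sum_shifted row_functions_def)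
  qed
  have "(\<Sum>p\<in>I. c p * monomial d x (b p)) = 0"
  proof (rule antisymmetric_casimir_zero[where n="?n"])
    show "finite I" unfolding I_def using fin1 fin2 by (rule finite_Plus)
    show "(\<Sum>i<d. b p i) = ?n + (\<Sum>j<d. j)" if "p \<in> I" for p by (rule degree[OF that])
  next
    fix x :: "nat \<Rightarrow> real" and a a' :: nat
    let ?t = "Transposition.transpose a a'"
    assume x: "\<And>i. i < d \<Longrightarrow> x i > 0" and a: "a < d" "a' < d" "a \<noteq> a'"
    have xt: "x (?t i) > 0" if "i < d" for i
      using x a that by (auto simp: Transposition.transpose_def)
    have anti: "?A (\<lambda>i. x (?t i)) \<nu> = - ?A x \<nu>" for \<nu>
      using alternant_swap[OF a, of "\<lambda>i k. x i ^ k"] by simp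
    have "vandermonde d (\<lambda>i. x (?t i)) = - vandermonde d x"
      using anti[of "\<lambda>_. 0"] alternant_power[of "\<lambda>_. 0" d x] alternant_power[of "\<lambda>_. 0" d "\<lambda>i. x (?t i)"] x xt
      by (simp add: gt_sum_zero decseq_def)
    moreover have "(\<Sum>p\<in>P1. c1 p * monomial d x (b1 p)) = vandermonde d x * G ?n x"
      by (rule sum1) (rule x)
    moreover have "(\<Sum>p\<in>P1. c1 p * monomial d (\<lambda>i. x (?t i)) (b1 p)) = vandermonde d (\<lambda>i. x (?t i)) * G ?n (\<lambda>i. x (?t i))"
      by (rule sum1) (rule xt)
    moreover have "G ?n (\<lambda>i. x (?t i)) = G ?n x"
      by (rule sym) (use x a in auto)
    ultimately show "(\<Sum>p\<in>I. c p * monomial d (\<lambda>i. x (?t i)) (b p)) = - (\<Sum>p\<in>I. c p * monomial d x (b p))"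
      unfolding split sum2' anti by (simp add: sum_negf)
  next
    fix x :: "nat \<Rightarrow> real"
    assume x: "\<And>i. i < d \<Longrightarrow> x i > 0" and inj: "inj_on x {..<d}"
    define V where "V = vandermonde d x"
    define E where "E = (\<lambda>f. \<Sum>p\<in>P ?n. f p * (e p * monomial d x (\<alpha> p)))"
    define T where "T i = (\<Sum>p\<in>?S. of_int (sign p) * (real (p i) * monomial d x p))" for i
    have V: "V = (\<Sum>p\<in>?S. of_int (sign p) * monomial d x p)"
      unfolding V_def by (rule vandermonde_expansion[symmetric]) (rule x)
    have T: "T i = V * (\<Sum>j\<in>{..<d} - {i}. x i / (x i - x j))" if "i < d" for i
      unfolding T_def V_def by (rule vandermonde_euler) (use x inj that in auto)
    \<comment> \<open>Euler's identity for homogeneous polynomials: it trades the scalar (d - 1) n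
      in \<open>casimir\<close> for the first-order term of
      \<open>euler_vandermonde_identity\<close>.\<close>
    have nE: "(\<Sum>i<d. E (\<lambda>p. real (\<alpha> p i))) = real ?n * E (\<lambda>_. 1)"
    proof -
      have "(\<Sum>i<d. E (\<lambda>p. real (\<alpha> p i))) = (\<Sum>p\<in>P ?n. real (\<Sum>i<d. \<alpha> p i) * (e p * monomial d x (\<alpha> p)))"
        unfolding E_def by (subst sum.swap) (simp add: sum_distrib_right)
      also have "\<dots> = (\<Sum>p\<in>P ?n. real ?n * (e p * monomial d x (\<alpha> p)))"
        by (intro sum.cong refl) (simp only: deg)
      finally show ?thesis by (simp add: E_def sum_distrib_left)
    qed
    \<comment> \<open>Expanding the square of p i + \<alpha> q i: the squares of p cancel the
      constant in \<open>casimir\<close>, the squares of \<alpha> give th_i^2 G, and the mixed terms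
      pair th_i of the Vandermonde product with th_i G.\<close>
    have cas1: "casimir d (b1 (p, q)) = 2 * (\<Sum>i<d. real (p i) * real (\<alpha> q i)) + (\<Sum>i<d. (real (\<alpha> q i))\<^sup>2)
        - (real d - 1) * real ?n" if "p \<in> ?S" "q \<in> P ?n" for p q
    proof -
      have p: "p permutes {..<d}" using that by simp
      have "(\<Sum>i<d. b1 (p, q) i) = ?n + (\<Sum>j<d. j)"
        using deg[OF that(2)] sum_permuted[OF p, of "\<lambda>j. j"] by (simp add: b1_def sum.distrib)
      moreover have "(\<Sum>i<d. (real (b1 (p, q) i))\<^sup>2) = (\<Sum>j<d. (real j)\<^sup>2)
         + 2 * (\<Sum>i<d. real (p i) * real (\<alpha> q i)) + (\<Sum>i<d. (real (\<alpha> q i))\<^sup>2)"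
        using sum_permuted[OF p, of "\<lambda>j. (real j)\<^sup>2"]
        by (simp add: b1_def power2_sum sum.distrib sum_distrib_left mult.assoc)
      ultimately show ?thesis by (simp add: casimir_def)
    qed
    define w where "w p q = (of_int (sign p) * monomial d x p) * (e q * monomial d x (\<alpha> q))" for p q
    have "(\<Sum>p\<in>P1. c1 p * (casimir d (b1 p) * monomial d x (b1 p))) =
        (\<Sum>p\<in>?S. \<Sum>q\<in>P ?n. w p q *
          (2 * (\<Sum>i<d. real (p i) * real (\<alpha> q i)) + (\<Sum>i<d. (real (\<alpha> q i))\<^sup>2) - (real d - 1) * real ?n))"
      unfolding P1_def sum.cartesian_product
      by (intro sum.cong refl)
         (auto simp: cas1 simp del: of_nat_Suc, simp add: c1_def b1_def w_def monomial_add mult_ac)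
    also have "\<dots> = 2 * (\<Sum>i<d. T i * E (\<lambda>p. real (\<alpha> p i))) + V * (\<Sum>i<d. E (\<lambda>p. (real (\<alpha> p i))\<^sup>2))
        - (real d - 1) * real ?n * (V * E (\<lambda>_. 1))"
    proof -
      have linear: "(\<Sum>p\<in>A. \<Sum>q\<in>B. w p q * (2 * f p q + g q - h)) =
          2 * (\<Sum>p\<in>A. \<Sum>q\<in>B. w p q * f p q) + (\<Sum>p\<in>A. \<Sum>q\<in>B. w p q * g q) - (\<Sum>p\<in>A. \<Sum>q\<in>B. w p q * h)"
        for A :: "(nat \<Rightarrow> nat) set" and B :: "'p set" and w f g and h :: real
        by (simp add: sum.distrib sum_subtractf sum_distrib_left algebra_simps)
      have 1: "(\<Sum>p\<in>?S. \<Sum>q\<in>P ?n. w p q *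
          (\<Sum>i<d. real (p i) * real (\<alpha> q i))) = (\<Sum>i<d. T i * E (\<lambda>p. real (\<alpha> p i)))"
      proof -
        have "(\<Sum>i<d. T i * E (\<lambda>p. real (\<alpha> p i))) = (\<Sum>i<d. \<Sum>p\<in>?S. \<Sum>q\<in>P ?n.
            w p q * (real (p i) * real (\<alpha> q i)))"
          unfolding T_def E_def w_def sum_product by (simp add: mult_ac)
        also have "\<dots> = (\<Sum>p\<in>?S. \<Sum>i<d. \<Sum>q\<in>P ?n.
            w p q * (real (p i) * real (\<alpha> q i)))"
          by (rule sum.swap)
        also have "\<dots> = (\<Sum>p\<in>?S. \<Sum>q\<in>P ?n. \<Sum>i<d.
            w p q * (real (p i) * real (\<alpha> q i)))"
          by (intro sum.cong refl sum.swap)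
        finally show ?thesis by (simp only: sum_distrib_left)
      qed
      have 2: "(\<Sum>p\<in>?S. \<Sum>q\<in>P ?n. w p q *
          f q) = V * E f" for f
        unfolding V E_def w_def sum_product by (simp add: mult_ac)
      have 3: "E (\<lambda>q. \<Sum>i<d. (real (\<alpha> q i))\<^sup>2) = (\<Sum>i<d. E (\<lambda>p. (real (\<alpha> p i))\<^sup>2))"
        unfolding E_def sum_distrib_right by (rule sum.swap)
      have 4: "E (\<lambda>_. k) = k * E (\<lambda>_. 1)" for k
        by (simp add: E_def sum_distrib_left)
      have "(\<Sum>p\<in>?S. \<Sum>q\<in>P ?n. w p q *
          (2 * (\<Sum>i<d. real (p i) * real (\<alpha> q i)) + (\<Sum>i<d. (real (\<alpha> q i))\<^sup>2) - (real d - 1) * real ?n)) =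
        2 * (\<Sum>p\<in>?S. \<Sum>q\<in>P ?n. w p q *
          (\<Sum>i<d. real (p i) * real (\<alpha> q i))) +
        (\<Sum>p\<in>?S. \<Sum>q\<in>P ?n. w p q *
          (\<Sum>i<d. (real (\<alpha> q i))\<^sup>2)) -
        (\<Sum>p\<in>?S. \<Sum>q\<in>P ?n. w p q *
          ((real d - 1) * real ?n))"
        by (rule linear)
      then show ?thesis
        unfolding 1 2 3 by (subst (asm) 4) (simp only: mult_ac)
    qed
    also have "\<dots> = V * ((\<Sum>i<d. E (\<lambda>p. (real (\<alpha> p i))\<^sup>2)) +
        (2 * (\<Sum>i<d. (\<Sum>j\<in>{..<d} - {i}. x i / (x i - x j)) * E (\<lambda>p. real (\<alpha> p i)))
          - (real d - 1) * (\<Sum>i<d. E (\<lambda>p. real (\<alpha> p i)))))"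
      unfolding nE by (simp add: T algebra_simps sum_distrib_left del: of_nat_Suc)
    also have "\<dots> = V * ((real ?n)\<^sup>2 * (\<Sum>i<d. x i) * G m x)"
    proof -
      have "(real ?n)\<^sup>2 * (\<Sum>i<d. x i) * G m x = (\<Sum>i<d. E (\<lambda>p. (real (\<alpha> p i))\<^sup>2)) +
        (\<Sum>i<d. \<Sum>j\<in>{..<d} - {i}. x i * (E (\<lambda>p. real (\<alpha> p i)) - E (\<lambda>p. real (\<alpha> p j))) / (x i - x j))"
        by (rule pde) (use x inj E_def in auto)
      then show ?thesis
        unfolding euler_vandermonde_identity[OF inj] by (simp only:)
    qed
    also have "\<dots> = (real ?n)\<^sup>2 * ((\<Sum>i<d. x i) * (V * G m x))"
      by (simp only: mult_ac)
    also have "V * G m x = (\<Sum>\<mu>\<in>row_functions d m. schur_weight d m \<mu> * ?A x \<mu>)"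
      unfolding V_def by (rule Suc.IH) (rule x)
    also have "(\<Sum>i<d. x i) * \<dots> = (\<Sum>\<mu>\<in>row_functions d m. \<Sum>i\<in>addable d \<mu>.
        schur_weight d m \<mu> * ?A x (\<mu>(i := Suc (\<mu> i))))"
      unfolding sum_distrib_left
    proof (intro sum.cong refl)
      fix \<mu> assume "\<mu> \<in> row_functions d m"
      from alternant_pieri_partition[OF this, of x]
      show "(\<Sum>i<d. x i) * (schur_weight d m \<mu> * ?A x \<mu>) =
          (\<Sum>i\<in>addable d \<mu>. schur_weight d m \<mu> * ?A x (\<mu>(i := Suc (\<mu> i))))"
        by (simp add: mult.left_commute sum_distrib_left[symmetric])
    qed
    \<comment> \<open>Regrouping the Pieri terms by the larger shape collects the coefficient of
      each alternant, to which \<open>schur_weight_rec\<close> applies.\<close>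
    also have "\<dots> = (\<Sum>\<nu>\<in>row_functions d ?n. \<Sum>i\<in>removable d \<nu>.
        schur_weight d m (\<nu>(i := \<nu> i - 1)) * ?A x \<nu>)"
      by (rule sum_add_remove[where F="\<lambda>\<mu> i \<nu>. schur_weight d m \<mu> * ?A x \<nu>"])
    also have "(real ?n)\<^sup>2 * \<dots> = (\<Sum>\<nu>\<in>row_functions d ?n.
        casimir d (shifted d \<nu>) * schur_weight d ?n \<nu> * ?A x \<nu>)"
      unfolding sum_distrib_left[of "(real ?n)\<^sup>2"] sum_distrib_right[symmetric]
      by (intro sum.cong refl) (simp only: mult.assoc[symmetric] schur_weight_rec[OF _ d])
    also have "\<dots> = - (\<Sum>p\<in>P2. c2 p * (casimir d (b2 p) * monomial d x (b2 p)))"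
    proof -
      have "(\<Sum>p\<in>?S. of_int (sign p) * (casimir d (\<lambda>i. shifted d \<nu> (p i)) *
          monomial d x (\<lambda>i. shifted d \<nu> (p i)))) = casimir d (shifted d \<nu>) * ?A x \<nu>" for \<nu>
        unfolding alternant_monomial sum_distrib_left
        by (intro sum.cong refl) (simp add: casimir_permuted mult.left_commute)
      then show ?thesis
        unfolding sum2[of "\<lambda>l. casimir d l * monomial d x l"] by (simp add: mult_ac)
    qed
    finally show "(\<Sum>p\<in>I. c p * casimir d (b p) * monomial d x (b p)) = 0"
      using split[of "\<lambda>l. casimir d l * monomial d x l"] by (simp add: mult.assoc)
  qed simp
  moreover have "(\<Sum>p\<in>P1. c1 p * monomial d x (b1 p)) = vandermonde d x * G ?n x"
    by (rule sum1) (rule Suc.prems)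
  ultimately show ?case
    unfolding split sum2' by simp
qed

section \<open>Tableaux\<close>

definition diagram :: "(nat \<Rightarrow> nat) \<Rightarrow> (nat \<times> nat) set" where
  "diagram \<nu> = {(i, j). j < \<nu> i}"

lemma mem_diagram [simp]: "(i, j) \<in> diagram \<nu> \<longleftrightarrow> j < \<nu> i"
  by (simp add: diagram_def)

definition ssyt :: "(nat \<Rightarrow> nat) \<Rightarrow> nat \<Rightarrow> (nat \<times> nat \<Rightarrow> nat) set" where
  "ssyt \<nu> r = {T \<in> diagram \<nu> \<rightarrow>\<^sub>E {1..r}.
     (\<forall>i j j'. j < j' \<and> j < \<nu> i \<and> j' < \<nu> i \<longrightarrow> T (i, j) \<le> T (i, j')) \<and>
     (\<forall>i i' j. i < i' \<and> j < \<nu> i \<and> j < \<nu> i' \<longrightarrow> T (i, j) < T (i', j))}"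

definition syt :: "(nat \<Rightarrow> nat) \<Rightarrow> nat \<Rightarrow> (nat \<times> nat \<Rightarrow> nat) set" where
  "syt \<nu> n = {T \<in> extensional (diagram \<nu>). bij_betw T (diagram \<nu>) {1..n} \<and>
     (\<forall>i j j'. j < j' \<and> j < \<nu> i \<and> j' < \<nu> i \<longrightarrow> T (i, j) < T (i, j')) \<and>
     (\<forall>i i' j. i < i' \<and> j < \<nu> i \<and> j < \<nu> i' \<longrightarrow> T (i, j) < T (i', j))}"

lemma finite_diagram:
  assumes "decseq \<nu>" "\<forall>i\<ge>d. \<nu> i = 0" shows "finite (diagram \<nu>)"
proof (rule finite_subset)
  show "diagram \<nu> \<subseteq> {..<d} \<times> {..<\<nu> 0}"
  proof
    fix c assume "c \<in> diagram \<nu>"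
    then obtain i j where c: "c = (i, j)" "j < \<nu> i" by (cases c) auto
    moreover have "\<nu> i \<le> \<nu> 0" using assms(1) by (rule decseqD) simp
    ultimately show "c \<in> {..<d} \<times> {..<\<nu> 0}"
      using assms(2) by (cases "i < d") auto
  qed
qed simp

lemma downward_closed_eq_lessThan:
  assumes "finite S" "\<And>j k. j \<in> S \<Longrightarrow> k < j \<Longrightarrow> k \<in> S"
  shows "S = {..<card S}"
proof (cases "S = {}")
  case False
  have "S = {..Max S}"
  proof
    show "S \<subseteq> {..Max S}" using assms(1) by auto
    show "{..Max S} \<subseteq> S"
      using assms(2)[OF Max_in[OF assms(1) False]] Max_in[OF assms(1) False] by (auto simp: le_less)
  qed
  then have "S = {..<Suc (Max S)}" by (simp only: lessThan_Suc_atMost)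
  then show ?thesis by (metis card_lessThan)
qed simp

lemma ssyt_range: "T \<in> ssyt \<nu> r \<Longrightarrow> j < \<nu> i \<Longrightarrow> T (i, j) \<in> {1..r}"
  by (rule PiE_mem[of T "diagram \<nu>"]) (simp_all add: ssyt_def)

lemma ssyt_undefined: "T \<in> ssyt \<nu> r \<Longrightarrow> c \<notin> diagram \<nu> \<Longrightarrow> T c = undefined"
  by (rule PiE_arb[of T "diagram \<nu>" "\<lambda>_. {1..r}"]) (simp_all add: ssyt_def)

lemma ssyt_row: "T \<in> ssyt \<nu> r \<Longrightarrow> j < j' \<Longrightarrow> j' < \<nu> i \<Longrightarrow> T (i, j) \<le> T (i, j')"
  unfolding ssyt_def by (blast intro: less_trans)

lemma ssyt_column: "T \<in> ssyt \<nu> r \<Longrightarrow> i < i' \<Longrightarrow> j < \<nu> i \<Longrightarrow> j < \<nu> i' \<Longrightarrow> T (i, j) < T (i', j)"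
  unfolding ssyt_def by blast

lemma syt_row: "T \<in> syt \<nu> n \<Longrightarrow> j < j' \<Longrightarrow> j' < \<nu> i \<Longrightarrow> T (i, j) < T (i, j')"
  unfolding syt_def by (blast intro: less_trans)

lemma syt_column: "T \<in> syt \<nu> n \<Longrightarrow> i < i' \<Longrightarrow> j < \<nu> i \<Longrightarrow> j < \<nu> i' \<Longrightarrow> T (i, j) < T (i', j)"
  unfolding syt_def by blast

lemma ssyt_row_le:
  assumes T: "T \<in> ssyt \<nu> r" and dec: "decseq \<nu>" and "j < \<nu> i"
  shows "Suc i \<le> T (i, j)"
  using assms(3)
proof (induction i)
  case 0
  then show ?case using ssyt_range[OF T, of j 0] by simp
next
  case (Suc i)
  have "\<nu> (Suc i) \<le> \<nu> i" using dec by (rule decseq_SucD)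
  then have "j < \<nu> i" using Suc.prems by simp
  moreover have "T (i, j) < T (Suc i, j)"
    using T Suc.prems \<open>j < \<nu> i\<close> by (intro ssyt_column) auto
  ultimately show ?case using Suc.IH by simp
qed

section \<open>Branching of tableaux\<close>

definition inner :: "nat \<Rightarrow> (nat \<Rightarrow> nat) \<Rightarrow> (nat \<times> nat \<Rightarrow> nat) \<Rightarrow> nat \<Rightarrow> nat" where
  "inner r \<nu> T i = card {j. j < \<nu> i \<and> T (i, j) \<le> r}"

text \<open>Rows increase weakly, so the entries up to r form an initial segment of each row and
  counting them locates its end.\<close>

lemma less_inner:
  assumes T: "T \<in> ssyt \<nu> (Suc r)"
  shows "j < inner r \<nu> T i \<longleftrightarrow> j < \<nu> i \<and> T (i, j) \<le> r"
proof -
  let ?S = "{j. j < \<nu> i \<and> T (i, j) \<le> r}"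
  have "?S = {..<card ?S}"
  proof (rule downward_closed_eq_lessThan)
    fix j k assume jk: "j \<in> ?S" "k < j"
    then have "T (i, k) \<le> T (i, j)" using T by (intro ssyt_row) auto
    then show "k \<in> ?S" using jk by auto
  qed simp
  then show ?thesis unfolding inner_def by blast
qed

text \<open>A cell with another cell below it has an entry smaller than r + 1, hence survives; and
  column strictness leaves no entry up to r in rows from r on.\<close>

lemma inner_interlacing:
  assumes T: "T \<in> ssyt \<nu> (Suc r)" and dec: "decseq \<nu>"
  shows "inner r \<nu> T \<in> interlacing r \<nu>"
  unfolding interlacing_def
proof (intro CollectI conjI allI impI)
  fix i
  note less = less_inner[OF T]
  show "inner r \<nu> T i \<le> \<nu> i"
    using less[of "\<nu> i" i] by simp
  show "\<nu> (Suc i) \<le> inner r \<nu> T i"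
  proof (rule ccontr)
    define j where "j = inner r \<nu> T i"
    assume "\<not> \<nu> (Suc i) \<le> inner r \<nu> T i"
    then have j: "j < \<nu> (Suc i)" by (simp add: j_def)
    moreover have "\<nu> (Suc i) \<le> \<nu> i" using dec by (rule decseq_SucD)
    ultimately have j': "j < \<nu> i" by simp
    have "T (i, j) < T (Suc i, j)" using T j j' by (intro ssyt_column) auto
    moreover have "T (Suc i, j) \<in> {1..Suc r}" using T j by (rule ssyt_range)
    ultimately have "T (i, j) \<le> r" by simp
    then show False using less[of j i] j' by (simp add: j_def)
  qed
next
  fix i assume "r \<le> i"
  show "inner r \<nu> T i = 0"
  proof (rule ccontr)
    assume "inner r \<nu> T i \<noteq> 0"
    then have "0 < \<nu> i \<and> T (i, 0) \<le> r" using less_inner[OF T, of 0 i] by simp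
    then show False using ssyt_row_le[OF T dec, of 0 i] \<open>r \<le> i\<close> by simp
  qed
qed

text \<open>Deleting the entries r + 1 removes a horizontal strip; filling the strip with r + 1 is
  the inverse.\<close>

lemma ssyt_branching:
  assumes dec: "decseq \<nu>" and zero: "\<forall>i\<ge>Suc r. \<nu> i = 0"
  shows "bij_betw (\<lambda>T. (inner r \<nu> T, restrict T (diagram (inner r \<nu> T))))
    (ssyt \<nu> (Suc r)) (Sigma (interlacing r \<nu>) (\<lambda>\<mu>. ssyt \<mu> r))"
proof -
  define ext where "ext = (\<lambda>(\<mu>, T' :: nat \<times> nat \<Rightarrow> nat) c.
    if c \<in> diagram \<mu> then T' c else if c \<in> diagram \<nu> then Suc r else undefined)"
  show ?thesis
  proof (rule bij_betwI[where g=ext])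
    show "(\<lambda>T. (inner r \<nu> T, restrict T (diagram (inner r \<nu> T)))) \<in>
        ssyt \<nu> (Suc r) \<rightarrow> Sigma (interlacing r \<nu>) (\<lambda>\<mu>. ssyt \<mu> r)"
    proof
      fix T assume T: "T \<in> ssyt \<nu> (Suc r)"
      note less = less_inner[OF T]
      have range: "T (i, j) \<in> {1..Suc r}" if "j < \<nu> i" for i j
        using T that by (rule ssyt_range)
      have "restrict T (diagram (inner r \<nu> T)) \<in> ssyt (inner r \<nu> T) r"
        unfolding ssyt_def
      proof (intro CollectI conjI allI impI)
        show "restrict T (diagram (inner r \<nu> T)) \<in> diagram (inner r \<nu> T) \<rightarrow>\<^sub>E {1..r}"
        proof (rule restrict_PiE_iff[THEN iffD2], rule ballI)
          fix c assume "c \<in> diagram (inner r \<nu> T)"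
          then obtain i j where c: "c = (i, j)" "j < \<nu> i" "T (i, j) \<le> r" by (cases c) (auto simp: less)
          then show "T c \<in> {1..r}" using range[of j i] by simp
        qed
      qed (use ssyt_row[OF T] ssyt_column[OF T] in \<open>simp_all add: less\<close>)
      then show "(inner r \<nu> T, restrict T (diagram (inner r \<nu> T))) \<in>
          Sigma (interlacing r \<nu>) (\<lambda>\<mu>. ssyt \<mu> r)"
        using inner_interlacing[OF T dec] by simp
    qed
  next
    \<comment> \<open>The second fact says that a cell of \<nu> above another one already lies in
      \<mu>. So each column of the strip has at most one cell, which keeps columns strict.\<close>
    have props: "\<mu> i \<le> \<nu> i" "j < \<nu> i' \<Longrightarrow> i < i' \<Longrightarrow> j < \<mu> i"
      if "\<mu> \<in> interlacing r \<nu>" for \<mu> i i' j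
    proof -
      show "\<mu> i \<le> \<nu> i" using that by (cases "i < r") (auto simp: interlacing_def)
      assume j: "j < \<nu> i'" "i < i'"
      then have "i' < Suc r" using zero by (metis not_less not_less_zero)
      then have "\<nu> (Suc i) \<le> \<mu> i" using that j by (auto simp: interlacing_def)
      moreover have "\<nu> i' \<le> \<nu> (Suc i)" by (rule decseqD[OF dec]) (use j in simp)
      ultimately show "j < \<mu> i" using j by simp
    qed
    have range: "T' (i, j) \<in> {1..r}" if "T' \<in> ssyt \<mu> r" "j < \<mu> i" for T' \<mu> i j
      using that by (rule ssyt_range)
    show "ext \<in> Sigma (interlacing r \<nu>) (\<lambda>\<mu>. ssyt \<mu> r) \<rightarrow> ssyt \<nu> (Suc r)"
    proof
      fix y assume "y \<in> Sigma (interlacing r \<nu>) (\<lambda>\<mu>. ssyt \<mu> r)"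
      then obtain \<mu> T' where y: "y = (\<mu>, T')" and \<mu>: "\<mu> \<in> interlacing r \<nu>" and T': "T' \<in> ssyt \<mu> r" by auto
      have val: "ext y (i, j) = (if j < \<mu> i then T' (i, j) else if j < \<nu> i then Suc r else undefined)" for i j
        by (simp add: ext_def y)
      have bound: "1 \<le> T' (i, j) \<and> T' (i, j) \<le> r" if "j < \<mu> i" for i j using range[OF T' that] by simp
      show "ext y \<in> ssyt \<nu> (Suc r)"
        unfolding ssyt_def
      proof (intro CollectI conjI allI impI)
        show "ext y \<in> diagram \<nu> \<rightarrow>\<^sub>E {1..Suc r}"
        proof (rule PiE_I)
          fix c assume "c \<in> diagram \<nu>"
          then obtain i j where c: "c = (i, j)" "j < \<nu> i" by (cases c) auto
          then show "ext y c \<in> {1..Suc r}" using bound[of j i] by (auto simp: val)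
        next
          fix c assume "c \<notin> diagram \<nu>"
          then obtain i j where c: "c = (i, j)" "\<not> j < \<nu> i" by (cases c) auto
          then have "\<not> j < \<mu> i" using props(1)[OF \<mu>, of i] by simp
          then show "ext y c = undefined" using c by (simp add: val)
        qed
      next
        fix i j j' assume j: "j < j' \<and> j < \<nu> i \<and> j' < \<nu> i"
        show "ext y (i, j) \<le> ext y (i, j')"
        proof (cases "j' < \<mu> i")
          case True
          then have "T' (i, j) \<le> T' (i, j')" using T' j by (intro ssyt_row) auto
          then show ?thesis using True j by (simp add: val)
        next
          case False
          then show ?thesis using j bound[of j i] by (auto simp: val)
        qed
      next
        fix i i' j assume j: "i < i' \<and> j < \<nu> i \<and> j < \<nu> i'"
        then have ij: "j < \<mu> i" using props(2)[OF \<mu>] by blast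
        show "ext y (i, j) < ext y (i', j)"
        proof (cases "j < \<mu> i'")
          case True
          then have "T' (i, j) < T' (i', j)" using T' j ij by (intro ssyt_column) auto
          then show ?thesis using True ij by (simp add: val)
        next
          case False
          then show ?thesis using j ij bound[of j i] by (auto simp: val)
        qed
      qed
    qed
    show "ext (inner r \<nu> T, restrict T (diagram (inner r \<nu> T))) = T"
      if T: "T \<in> ssyt \<nu> (Suc r)" for T
    proof
      fix c :: "nat \<times> nat"
      obtain i j where c: "c = (i, j)" by (cases c)
      have "T (i, j) \<in> {1..Suc r}" if "j < \<nu> i"
        using T that by (rule ssyt_range)
      moreover have "T (i, j) = undefined" if "\<not> j < \<nu> i"
        using T that by (intro ssyt_undefined) auto
      ultimately show "ext (inner r \<nu> T, restrict T (diagram (inner r \<nu> T))) c = T c"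
        using less_inner[OF T, of j i] by (auto simp: ext_def c)
    qed
    show "(inner r \<nu> (ext y), restrict (ext y) (diagram (inner r \<nu> (ext y)))) = y"
      if mem: "y \<in> Sigma (interlacing r \<nu>) (\<lambda>\<mu>. ssyt \<mu> r)" for y
    proof -
      obtain \<mu> T' where y: "y = (\<mu>, T')" and \<mu>: "\<mu> \<in> interlacing r \<nu>" and T': "T' \<in> ssyt \<mu> r"
        using mem by auto
      have "inner r \<nu> (ext y) i = \<mu> i" for i
      proof -
        have "{j. j < \<nu> i \<and> ext y (i, j) \<le> r} = {..<\<mu> i}"
          using props(1)[OF \<mu>, of i] range[OF T', of _ i] by (auto simp: ext_def y split: if_splits)
        then show ?thesis by (simp add: inner_def)
      qed
      then have shape: "inner r \<nu> (ext y) = \<mu>" by auto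
      have "restrict (ext y) (diagram \<mu>) = T'"
      proof
        fix c
        show "restrict (ext y) (diagram \<mu>) c = T' c"
          using ssyt_undefined[OF T', of c] by (cases "c \<in> diagram \<mu>") (auto simp: ext_def y)
      qed
      then show ?thesis unfolding shape using y by (simp only:)
    qed
  qed
qed

lemma finite_ssyt:
  assumes "decseq \<nu>" "\<forall>i\<ge>d. \<nu> i = 0" shows "finite (ssyt \<nu> r)"
proof (rule finite_subset)
  show "ssyt \<nu> r \<subseteq> diagram \<nu> \<rightarrow>\<^sub>E {1..r}" by (auto simp: ssyt_def)
  show "finite (diagram \<nu> \<rightarrow>\<^sub>E {1..r})"
    by (intro finite_PiE finite_diagram[OF assms]) auto
qed

lemma finite_interlacing: "finite (interlacing r \<nu>)"
proof (rule finite_subset)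
  show "interlacing r \<nu> \<subseteq> {\<mu>. \<forall>i. (i \<in> {..<r} \<longrightarrow> \<mu> i \<in> (\<Union>i<r. {..\<nu> i})) \<and> (i \<notin> {..<r} \<longrightarrow> \<mu> i = 0)}"
    by (auto simp: interlacing_def)
  show "finite {\<mu>. \<forall>i. (i \<in> {..<r} \<longrightarrow> \<mu> i \<in> (\<Union>i<r. {..\<nu> i})) \<and> (i \<notin> {..<r} \<longrightarrow> \<mu> i = (0::nat))}"
    by (rule finite_set_of_finite_funs) auto
qed

text \<open>Both sides obey the same branching rule. The bound on the rows keeps the diagram inside
  the rows that \<open>gt_sum\<close> sees.\<close>

lemma card_ssyt:
  "decseq \<nu> \<Longrightarrow> \<forall>i\<ge>r. \<nu> i = 0 \<Longrightarrow> real (card (ssyt \<nu> r)) = gt_sum r (\<lambda>_. 1) \<nu>"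
proof (induction r arbitrary: \<nu>)
  case 0
  then have "ssyt \<nu> 0 = {\<lambda>_. undefined}"
    by (auto simp: ssyt_def diagram_def)
  then show ?case by simp
next
  case (Suc r)
  have IL: "decseq \<mu>" "\<forall>i\<ge>r. \<mu> i = 0" if "\<mu> \<in> interlacing r \<nu>" for \<mu>
    using interlacing_decseq[OF Suc.prems(1) that] that by (auto simp: interlacing_def)
  have "card (ssyt \<nu> (Suc r)) = card (Sigma (interlacing r \<nu>) (\<lambda>\<mu>. ssyt \<mu> r))"
    by (rule bij_betw_same_card[OF ssyt_branching[OF Suc.prems]])
  also have "\<dots> = (\<Sum>\<mu>\<in>interlacing r \<nu>. card (ssyt \<mu> r))"
    by (rule card_SigmaI) (use IL in \<open>auto intro!: finite_interlacing finite_ssyt\<close>)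
  finally show ?case
    using Suc.IH[OF IL] by simp
qed

text \<open>Nothing lies to the right of or below the largest entry, so it ends a removable row. The
  tableaux are split by that row and the entry is deleted.\<close>

lemma syt_branching:
  assumes \<nu>: "\<nu> \<in> row_functions d (Suc m)"
  shows "card (syt \<nu> (Suc m)) = (\<Sum>i\<in>removable d \<nu>. card (syt (\<nu>(i := \<nu> i - 1)) m))"
proof -
  have dec: "decseq \<nu>" and zero: "\<forall>i\<ge>d. \<nu> i = 0" using \<nu> by (auto simp: row_functions_def)
  define C where "C i = {T \<in> syt \<nu> (Suc m). T (i, \<nu> i - 1) = Suc m}" for i
  have diag: "diagram (\<nu>(i := \<nu> i - 1)) = diagram \<nu> - {(i, \<nu> i - 1)}" for i
    by (auto simp: diagram_def split: if_splits)
  have C_bij: "bij_betw (\<lambda>T. restrict T (diagram (\<nu>(i := \<nu> i - 1)))) (C i) (syt (\<nu>(i := \<nu> i - 1)) m)"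
    if i: "i \<in> removable d \<nu>" for i
  proof (rule bij_betwI[where g="\<lambda>T. T((i, \<nu> i - 1) := Suc m)"])
    let ?c = "(i, \<nu> i - 1)" and ?\<mu> = "\<nu>(i := \<nu> i - 1)"
    have pos: "\<nu> (Suc i) < \<nu> i" using i by (simp add: removable_def)
    then have c: "?c \<in> diagram \<nu>" by simp
    show "(\<lambda>T. restrict T (diagram ?\<mu>)) \<in> C i \<rightarrow> syt ?\<mu> m"
    proof
      fix T assume "T \<in> C i"
      then have T: "T \<in> syt \<nu> (Suc m)" and Tc: "T ?c = Suc m" by (auto simp: C_def)
      have bij: "bij_betw T (diagram \<nu>) {1..Suc m}" using T by (simp add: syt_def)
      have "T ` (diagram \<nu> - {?c}) = T ` diagram \<nu> - T ` {?c}"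
        using bij c by (intro inj_on_image_set_diff[of T "diagram \<nu>"]) (auto simp: bij_betw_def)
      also have "\<dots> = {1..m}" using bij Tc by (auto simp: bij_betw_def)
      finally have "bij_betw T (diagram ?\<mu>) {1..m}"
        unfolding diag using bij by (auto simp: bij_betw_def intro: inj_on_subset)
      then have "bij_betw (restrict T (diagram ?\<mu>)) (diagram ?\<mu>) {1..m}"
        by (rule bij_betw_cong[THEN iffD1, rotated]) simp
      moreover have sub: "j < \<nu> a" if "j < ?\<mu> a" for j a using that by (auto split: if_splits)
      ultimately show "restrict T (diagram ?\<mu>) \<in> syt ?\<mu> m"
        using T unfolding syt_def by (auto dest!: sub simp del: fun_upd_apply)
    qed
    show "(\<lambda>T. T(?c := Suc m)) \<in> syt ?\<mu> m \<rightarrow> C i"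
    proof
      fix T assume T: "T \<in> syt ?\<mu> m"
      have bij: "bij_betw T (diagram ?\<mu>) {1..m}" using T by (simp add: syt_def)
      have range: "T (a, j) \<le> m" if "j < ?\<mu> a" for a j
      proof -
        have "T (a, j) \<in> {1..m}"
          by (rule bij_betw_apply[OF bij]) (simp only: mem_diagram that)
        then show ?thesis by simp
      qed
      have "bij_betw (T(?c := Suc m)) (diagram ?\<mu>) {1..m}"
        using bij by (rule bij_betw_cong[THEN iffD1, rotated]) (auto simp: diag)
      then have "bij_betw (T(?c := Suc m)) (diagram ?\<mu> \<union> {?c}) ({1..m} \<union> {(T(?c := Suc m)) ?c})"
        by (intro notIn_Un_bij_betw) (auto simp: diag)
      moreover have "diagram ?\<mu> \<union> {?c} = diagram \<nu>" unfolding diag using c by blast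
      moreover have "{1..m} \<union> {(T(?c := Suc m)) ?c} = {1..Suc m}" by auto
      ultimately have bij': "bij_betw (T(?c := Suc m)) (diagram \<nu>) {1..Suc m}" by simp
      have mem: "(a, j) = ?c \<or> j < ?\<mu> a" if "j < \<nu> a" for a j using that by auto
      have "T(?c := Suc m) \<in> syt \<nu> (Suc m)"
        unfolding syt_def
      proof (intro CollectI conjI allI impI)
        show "T(?c := Suc m) \<in> extensional (diagram \<nu>)"
          unfolding extensional_def
        proof (intro CollectI allI impI)
          fix x assume x: "x \<notin> diagram \<nu>"
          have "x \<noteq> ?c" using x c by blast
          then have "(T(?c := Suc m)) x = T x" by (rule fun_upd_other)
          also have "\<dots> = undefined"
          proof (rule extensional_arb[of T "diagram ?\<mu>" x])
            show "T \<in> extensional (diagram ?\<mu>)" using T by (simp only: syt_def mem_Collect_eq)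
            show "x \<notin> diagram ?\<mu>" using x unfolding diag by blast
          qed
          finally show "(T(?c := Suc m)) x = undefined" .
        qed
        show "bij_betw (T(?c := Suc m)) (diagram \<nu>) {1..Suc m}" by (rule bij')
      next
        fix a j j' assume j: "j < j' \<and> j < \<nu> a \<and> j' < \<nu> a"
        then have "(a, j) \<noteq> ?c" by auto
        then have ja: "j < ?\<mu> a" using mem[of j a] j by blast
        show "(T(?c := Suc m)) (a, j) < (T(?c := Suc m)) (a, j')"
        proof (cases "(a, j') = ?c")
          case True
          then show ?thesis using range[OF ja] \<open>(a, j) \<noteq> ?c\<close> by (simp add: less_Suc_eq_le)
        next
          case False
          then have "j' < ?\<mu> a" using mem[of j' a] j by blast
          then have "T (a, j) < T (a, j')" using j by (intro syt_row[OF T]) auto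
          then show ?thesis
            unfolding fun_upd_other[OF False] fun_upd_other[OF \<open>(a, j) \<noteq> ?c\<close>] .
        qed
      next
        fix a a' j assume j: "a < a' \<and> j < \<nu> a \<and> j < \<nu> a'"
        have "\<nu> a' \<le> \<nu> (Suc a)" by (rule decseqD[OF dec]) (use j in simp)
        then have "(a, j) \<noteq> ?c" using pos j by auto
        then have ja: "j < ?\<mu> a" using mem[of j a] j by blast
        show "(T(?c := Suc m)) (a, j) < (T(?c := Suc m)) (a', j)"
        proof (cases "(a', j) = ?c")
          case True
          then show ?thesis using range[OF ja] \<open>(a, j) \<noteq> ?c\<close> by (simp add: less_Suc_eq_le)
        next
          case False
          then have "j < ?\<mu> a'" using mem[of j a'] j by blast
          then have "T (a, j) < T (a', j)" using ja j by (intro syt_column[OF T]) auto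
          then show ?thesis
            unfolding fun_upd_other[OF False] fun_upd_other[OF \<open>(a, j) \<noteq> ?c\<close>] .
        qed
      qed
      then show "T(?c := Suc m) \<in> C i" by (simp add: C_def)
    qed
    show "(restrict T (diagram ?\<mu>))(?c := Suc m) = T" if "T \<in> C i" for T
    proof
      fix x
      have "T \<in> extensional (diagram \<nu>)" "T ?c = Suc m" using that by (simp_all only: C_def syt_def mem_Collect_eq)
      then show "((restrict T (diagram ?\<mu>))(?c := Suc m)) x = T x"
        unfolding diag using extensional_arb[of T "diagram \<nu>" x] by (cases "x \<in> diagram \<nu>") auto
    qed
    show "restrict (T(?c := Suc m)) (diagram ?\<mu>) = T" if "T \<in> syt ?\<mu> m" for T
    proof
      fix x
      have "T \<in> extensional (diagram ?\<mu>)" using that by (simp only: syt_def mem_Collect_eq)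
      then show "restrict (T(?c := Suc m)) (diagram ?\<mu>) x = T x"
        unfolding diag using extensional_arb[of T "diagram \<nu> - {?c}" x]
        by (cases "x \<in> diagram \<nu> - {?c}") auto
    qed
  qed
  have union: "syt \<nu> (Suc m) = (\<Union>i\<in>removable d \<nu>. C i)"
  proof
    show "syt \<nu> (Suc m) \<subseteq> (\<Union>i\<in>removable d \<nu>. C i)"
    proof
      fix T assume T: "T \<in> syt \<nu> (Suc m)"
      then have bij: "bij_betw T (diagram \<nu>) {1..Suc m}" by (simp add: syt_def)
      then have "Suc m \<in> T ` diagram \<nu>" by (simp add: bij_betw_def)
      then obtain i j where ij: "j < \<nu> i" "T (i, j) = Suc m" by auto
      have le: "T (a, b) \<le> Suc m" if "b < \<nu> a" for a b
        using bij_betw_apply[OF bij, of "(a, b)"] that by simp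
      have "\<not> Suc j < \<nu> i"
      proof
        assume j: "Suc j < \<nu> i"
        then have "T (i, j) < T (i, Suc j)" using T by (intro syt_row) auto
        then show False using le[OF j] ij by simp
      qed
      then have j: "j = \<nu> i - 1" using ij by simp
      have "\<not> j < \<nu> (Suc i)"
      proof
        assume j: "j < \<nu> (Suc i)"
        then have "T (i, j) < T (Suc i, j)" using T ij by (intro syt_column) auto
        then show False using le[OF j] ij by simp
      qed
      then have "\<nu> (Suc i) < \<nu> i" using j ij by simp
      moreover have "i < d" using zero ij by (metis not_less not_less_zero)
      ultimately have "i \<in> removable d \<nu>" by (simp add: removable_def)
      then show "T \<in> (\<Union>i\<in>removable d \<nu>. C i)" using T ij j by (auto simp: C_def)
    qed
  qed (auto simp: C_def)
  have disj: "C i \<inter> C i' = {}" if "i \<in> removable d \<nu>" "i' \<in> removable d \<nu>" "i \<noteq> i'" for i i'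
  proof -
    have False if T: "T \<in> C i" "T \<in> C i'" for T
    proof -
      have "inj_on T (diagram \<nu>)" using T by (auto simp: C_def syt_def bij_betw_def)
      then have "(i, \<nu> i - 1) = (i', \<nu> i' - 1)"
        by (rule inj_onD) (use T \<open>i \<in> removable d \<nu>\<close> \<open>i' \<in> removable d \<nu>\<close> in
          \<open>auto simp: C_def removable_def\<close>)
      then show False using \<open>i \<noteq> i'\<close> by simp
    qed
    then show ?thesis by blast
  qed
  have fin: "finite (C i)" for i
  proof (rule finite_subset)
    show "C i \<subseteq> diagram \<nu> \<rightarrow>\<^sub>E {1..Suc m}"
      by (auto simp: C_def syt_def PiE_def dest: bij_betw_apply)
    show "finite (diagram \<nu> \<rightarrow>\<^sub>E {1..Suc m})"
      by (intro finite_PiE finite_diagram[OF dec zero]) auto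
  qed
  have "card (syt \<nu> (Suc m)) = (\<Sum>i\<in>removable d \<nu>. card (C i))"
    unfolding union by (rule card_UN_disjoint) (use fin disj in auto)
  also have "\<dots> = (\<Sum>i\<in>removable d \<nu>. card (syt (\<nu>(i := \<nu> i - 1)) m))"
    by (intro sum.cong refl bij_betw_same_card[OF C_bij])
  finally show ?thesis .
qed

lemma card_syt:
  "\<nu> \<in> row_functions d n \<Longrightarrow> real (card (syt \<nu> n)) = syt_weight d n \<nu>"
proof (induction n arbitrary: \<nu>)
  case 0
  then have \<nu>: "\<nu> = (\<lambda>_. 0)" by (simp add: row_functions_0)
  have "syt \<nu> 0 = {\<lambda>_. undefined}"
    unfolding \<nu> by (auto simp: syt_def diagram_def bij_betw_def)
  then show ?case by (simp add: \<nu> syt_weight_0)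
next
  case (Suc m)
  show ?case
    unfolding syt_branching[OF Suc.prems] syt_weight_rec[OF Suc.prems] of_nat_sum
    by (intro sum.cong refl Suc.IH remove_box(1)[OF Suc.prems])
qed

section \<open>Evaluation at the corner\<close>

text \<open>Powers of 0 vanish except for exponent 0, so the strip must be empty: \<mu> = \<nu>,
  which forces row r of \<nu> to be empty.\<close>

lemma gt_sum_zero_variable:
  assumes dec: "decseq \<nu>" and zero: "\<forall>i\<ge>Suc r. \<nu> i = 0" and "x 0 = 0"
  shows "gt_sum (Suc r) x \<nu> = (if \<nu> r = 0 then gt_sum r (\<lambda>i. x (Suc i)) \<nu> else 0)"
proof -
  have exponent: "(\<Sum>i<Suc r. \<nu> i) - (\<Sum>i<r. \<mu> i) = 0 \<longleftrightarrow> \<nu> r = 0 \<and> \<mu> = \<nu>"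
    if \<mu>: "\<mu> \<in> interlacing r \<nu>" for \<mu>
  proof
    have le: "\<mu> i \<le> \<nu> i" if "i < r" for i using \<mu> that by (simp add: interlacing_def)
    then have sum_le: "(\<Sum>i<r. \<mu> i) \<le> (\<Sum>i<r. \<nu> i)" by (intro sum_mono) auto
    assume "(\<Sum>i<Suc r. \<nu> i) - (\<Sum>i<r. \<mu> i) = 0"
    then have r: "\<nu> r = 0" and eq: "(\<Sum>i<r. \<mu> i) = (\<Sum>i<r. \<nu> i)" using sum_le by simp_all
    have "\<mu> i = \<nu> i" for i
    proof (cases "i < r")
      case True
      show ?thesis
      proof (rule ccontr)
        assume "\<mu> i \<noteq> \<nu> i"
        then have "\<mu> i < \<nu> i" using le[OF True] by simp
        then have "(\<Sum>i<r. \<mu> i) < (\<Sum>i<r. \<nu> i)"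
          using le True by (intro sum_strict_mono_ex1) auto
        then show False using eq by simp
      qed
    next
      case False
      then have "\<nu> i = 0" using zero r by (cases "i = r") auto
      then show ?thesis using False \<mu> by (simp add: interlacing_def)
    qed
    then show "\<nu> r = 0 \<and> \<mu> = \<nu>" using r by auto
  qed auto
  have "gt_sum (Suc r) x \<nu> = (\<Sum>\<mu>\<in>interlacing r \<nu>.
      if \<nu> r = 0 \<and> \<mu> = \<nu> then gt_sum r (\<lambda>i. x (Suc i)) \<nu> else 0)"
    unfolding gt_sum.simps
  proof (intro sum.cong refl)
    fix \<mu> assume "\<mu> \<in> interlacing r \<nu>"
    from exponent[OF this] show "x 0 ^ ((\<Sum>i<Suc r. \<nu> i) - (\<Sum>i<r. \<mu> i)) * gt_sum r (\<lambda>i. x (Suc i)) \<mu> =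
        (if \<nu> r = 0 \<and> \<mu> = \<nu> then gt_sum r (\<lambda>i. x (Suc i)) \<nu> else 0)"
      using \<open>x 0 = 0\<close> by (cases "(\<Sum>i<Suc r. \<nu> i) - (\<Sum>i<r. \<mu> i) = 0") auto
  qed
  also have "\<dots> = (if \<nu> r = 0 then gt_sum r (\<lambda>i. x (Suc i)) \<nu> else 0)"
  proof (cases "\<nu> r = 0")
    case True
    then have "\<nu> i = 0" if "r \<le> i" for i using zero that by (cases "i = r") auto
    then have "\<nu> \<in> interlacing r \<nu>" using dec by (auto simp: interlacing_def decseq_SucD)
    then show ?thesis using True by (simp add: finite_interlacing)
  qed simp
  finally show ?thesis .
qed

text \<open>\<open>gt_sum\<close> consumes its variables from index 0 upwards, so the zeros stand
  first; each of them lowers the admissible number of rows by one.\<close>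

lemma gt_sum_corner:
  assumes "decseq \<nu>" "\<forall>i\<ge>e + k. \<nu> i = 0"
  shows "gt_sum (e + k) (\<lambda>i. if i < e then 0 else 1) \<nu> =
    (if \<forall>i\<ge>k. \<nu> i = 0 then gt_sum k (\<lambda>_. 1) \<nu> else 0)"
  using assms(2)
proof (induction e)
  case (Suc e)
  have shift: "(\<lambda>i. if Suc i < Suc e then 0 else 1) = (\<lambda>i. if i < e then 0 else (1::real))" by auto
  have "gt_sum (Suc e + k) (\<lambda>i. if i < Suc e then 0 else 1) \<nu> =
      (if \<nu> (e + k) = 0 then gt_sum (e + k) (\<lambda>i. if i < e then 0 else 1) \<nu> else 0)"
    using gt_sum_zero_variable[OF assms(1), of "e + k" "\<lambda>i. if i < Suc e then 0 else 1"] Suc.prems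
    by (simp only: shift add_Suc) simp
  also have "\<dots> = (if \<forall>i\<ge>k. \<nu> i = 0 then gt_sum k (\<lambda>_. 1) \<nu> else 0)"
  proof (cases "\<nu> (e + k) = 0")
    case True
    have "\<forall>i\<ge>e + k. \<nu> i = 0"
    proof (intro allI impI)
      fix i assume "e + k \<le> i"
      then show "\<nu> i = 0" using True Suc.prems by (cases "i = e + k") auto
    qed
    then show ?thesis using True Suc.IH by simp
  qed auto
  finally show ?case .
qed simp

lemma tendsto_gt_sum:
  assumes "\<And>i. i < d \<Longrightarrow> ((\<lambda>t. x t i) \<longlongrightarrow> y i) F"
  shows "((\<lambda>t. gt_sum d (x t) \<nu>) \<longlongrightarrow> gt_sum d y \<nu>) F"
  using assms
proof (induction d arbitrary: x y \<nu>)
  case (Suc r)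
  show ?case
    unfolding gt_sum.simps by (intro tendsto_intros Suc.IH Suc.prems) auto
qed simp

lemma tendsto_monomial:
  assumes "\<And>i. i < d \<Longrightarrow> ((\<lambda>t. x t i) \<longlongrightarrow> y i) F"
  shows "((\<lambda>t. monomial d (x t) l) \<longlongrightarrow> monomial d y l) F"
  unfolding monomial_def by (intro tendsto_intros assms) auto

section \<open>Partitions as lists\<close>

definition shape :: "nat list \<Rightarrow> nat \<Rightarrow> nat" where
  "shape \<nu> i = (if i < length \<nu> then \<nu> ! i else 0)"

lemma young_diagram_eq: "young_diagram \<nu> = diagram (shape \<nu>)"
  by (auto simp: young_diagram_def diagram_def shape_def split: if_splits)

lemma standard_tableaux_eq: "standard_tableaux \<nu> = syt (shape \<nu>) (sum_list \<nu>)"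
  unfolding standard_tableaux_def syt_def young_diagram_eq mem_diagram by simp

lemma semistandard_tableaux_eq: "semistandard_tableaux \<nu> r = ssyt (shape \<nu>) r"
  unfolding semistandard_tableaux_def ssyt_def young_diagram_eq mem_diagram by simp

text \<open>The inverse reads the rows up to the first zero. Monotonicity makes all later rows zero,
  and parts of a partition are positive, so that zero marks the length.\<close>

lemma shape_bij:
  "bij_betw shape {\<nu> \<in> partitions n. length \<nu> \<le> d} (row_functions d n)"
proof (rule bij_betwI[where g="\<lambda>\<mu>. map \<mu> [0..<(LEAST i. \<mu> i = 0)]"])
  have pos: "shape \<nu> i = 0 \<longleftrightarrow> length \<nu> \<le> i" if "\<nu> \<in> partitions n" for \<nu> i
    using that by (auto simp: partitions_def shape_def in_set_conv_nth)
  show "shape \<in> {\<nu> \<in> partitions n. length \<nu> \<le> d} \<rightarrow> row_functions d n"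
  proof
    fix \<nu> assume "\<nu> \<in> {\<nu> \<in> partitions n. length \<nu> \<le> d}"
    then have \<nu>: "sorted_wrt (\<ge>) \<nu>" "sum_list \<nu> = n" and len: "length \<nu> \<le> d"
      by (auto simp: partitions_def)
    have "decseq (shape \<nu>)"
      by (rule decseq_SucI) (use \<nu>(1) in \<open>auto simp: shape_def sorted_wrt_iff_nth_less\<close>)
    moreover have "(\<Sum>i<d. shape \<nu> i) = (\<Sum>i<length \<nu>. \<nu> ! i)"
      using len by (intro sum.mono_neutral_cong_right) (auto simp: shape_def)
    ultimately show "shape \<nu> \<in> row_functions d n"
      using \<nu>(2) len by (simp add: row_functions_def sum_list_sum_nth atLeast0LessThan shape_def)
  qed
  have least: "\<mu> i \<noteq> 0 \<longleftrightarrow> i < (LEAST i. \<mu> i = 0)" "(LEAST i. \<mu> i = 0) \<le> d"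
    if "\<mu> \<in> row_functions d n" for \<mu> i
  proof -
    have dec: "decseq \<mu>" and zero: "\<mu> d = 0" using that by (auto simp: row_functions_def)
    let ?k = "LEAST i. \<mu> i = 0"
    have k: "\<mu> ?k = 0" by (rule LeastI[of "\<lambda>i. \<mu> i = 0", OF zero])
    show "?k \<le> d" by (rule Least_le[of "\<lambda>i. \<mu> i = 0", OF zero])
    show "\<mu> i \<noteq> 0 \<longleftrightarrow> i < ?k"
    proof
      assume "\<mu> i \<noteq> 0"
      then show "i < ?k" using decseqD[OF dec, of ?k i] k by (cases "i < ?k") auto
    next
      assume "i < ?k"
      then show "\<mu> i \<noteq> 0" by (rule not_less_Least)
    qed
  qed
  have shape_map: "shape (map \<mu> [0..<(LEAST i. \<mu> i = 0)]) = \<mu>" if "\<mu> \<in> row_functions d n" for \<mu>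
  proof
    fix i show "shape (map \<mu> [0..<(LEAST i. \<mu> i = 0)]) i = \<mu> i"
      using least(1)[OF that, of i] by (cases "i < (LEAST i. \<mu> i = 0)") (simp_all add: shape_def)
  qed
  show "(\<lambda>\<mu>. map \<mu> [0..<(LEAST i. \<mu> i = 0)]) \<in> row_functions d n \<rightarrow> {\<nu> \<in> partitions n. length \<nu> \<le> d}"
  proof
    fix \<mu> assume \<mu>: "\<mu> \<in> row_functions d n"
    have dec: "decseq \<mu>" and sum: "(\<Sum>i<d. \<mu> i) = n" using \<mu> by (auto simp: row_functions_def)
    define k where "k = (LEAST i. \<mu> i = 0)"
    have nonzero: "\<mu> i \<noteq> 0" if "i < k" for i
      using least(1)[OF \<mu>, of i] that by (simp only: k_def)
    have zero: "\<mu> i = 0" if "k \<le> i" for i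
      using least(1)[OF \<mu>, of i] that unfolding k_def by (metis not_le)
    have "k \<le> d" using least(2)[OF \<mu>] by (simp only: k_def)
    then have "(\<Sum>i<d. \<mu> i) = (\<Sum>i<k. \<mu> i)"
      by (intro sum.mono_neutral_right) (auto intro: zero)
    then have "sum_list (map \<mu> [0..<k]) = n"
      using sum by (simp add: sum_list_sum_nth atLeast0LessThan)
    moreover have "sorted_wrt (\<ge>) (map \<mu> [0..<k])"
      using dec by (auto simp: sorted_wrt_iff_nth_less decseq_def)
    moreover have "0 \<notin> set (map \<mu> [0..<k])"
    proof
      assume "0 \<in> set (map \<mu> [0..<k])"
      then obtain i where "i < k" "\<mu> i = 0" by auto
      then show False using nonzero[of i] by simp
    qed
    ultimately show "map \<mu> [0..<(LEAST i. \<mu> i = 0)] \<in> {\<nu> \<in> partitions n. length \<nu> \<le> d}"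
      using \<open>k \<le> d\<close> unfolding k_def[symmetric] by (simp add: partitions_def)
  qed
  show "shape (map \<mu> [0..<(LEAST i. \<mu> i = 0)]) = \<mu>" if "\<mu> \<in> row_functions d n" for \<mu>
    by (rule shape_map[OF that])
  show "map (shape \<nu>) [0..<(LEAST i. shape \<nu> i = 0)] = \<nu>"
    if "\<nu> \<in> {\<nu> \<in> partitions n. length \<nu> \<le> d}" for \<nu>
  proof -
    have "(LEAST i. shape \<nu> i = 0) = length \<nu>"
      using that pos[of \<nu>] by (intro Least_equality) auto
    then show ?thesis by (intro nth_equalityI) (auto simp: shape_def)
  qed
qed

lemma num_SYT_eq:
  assumes "\<nu> \<in> partitions n" "length \<nu> \<le> d"
  shows "real (num_SYT \<nu>) = syt_weight d n (shape \<nu>)"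
  using assms card_syt[of "shape \<nu>" d n] bij_betw_apply[OF shape_bij[of n d], of \<nu>]
  by (simp add: num_SYT_def standard_tableaux_eq partitions_def)

lemma num_SSYT_eq:
  assumes "\<nu> \<in> partitions n" "length \<nu> \<le> r"
  shows "real (num_SSYT \<nu> r) = gt_sum r (\<lambda>_. 1) (shape \<nu>)"
  using card_ssyt[of "shape \<nu>" r] bij_betw_apply[OF shape_bij[of n r], of \<nu>] assms
  by (simp add: num_SSYT_def semistandard_tableaux_eq row_functions_def)

section \<open>The moments of the corner trace\<close>

context haar
begin

context
  fixes ix :: "nat \<Rightarrow> 'd"
  assumes bij: "bij_betw ix {..<CARD('d)} UNIV"
begin

text \<open>Matrices are indexed by a type, polynomials by numbers. The enumeration
  \<open>ix\<close> remains a parameter because the final application needs a decreasing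
  one.\<close>

definition pos :: "'d \<Rightarrow> nat" where "pos a = inv_into {..<CARD('d)} ix a"

lemma pos_ix: "i < CARD('d) \<Longrightarrow> pos (ix i) = i"
  using bij by (simp add: pos_def bij_betw_def)

lemma ix_pos: "ix (pos a) = a" and pos_less: "pos a < CARD('d)"
proof -
  have a: "a \<in> ix ` {..<CARD('d)}" using bij by (simp add: bij_betw_def)
  show "ix (pos a) = a" unfolding pos_def by (rule f_inv_into_f[OF a])
  show "pos a < CARD('d)" unfolding pos_def using inv_into_into[OF a] by simp
qed

definition scaling :: "(nat \<Rightarrow> real) \<Rightarrow> 'd \<Rightarrow> real" where
  "scaling x a = sqrt (x (pos a))"

lemma scaling_square: "(\<And>i. i < CARD('d) \<Longrightarrow> 0 \<le> x i) \<Longrightarrow> (scaling x a)\<^sup>2 = x (pos a)"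
  by (simp add: scaling_def pos_less)

lemma sum_ix: "(\<Sum>a\<in>UNIV. g a) = (\<Sum>i<CARD('d). g (ix i))"
  by (rule sum.reindex_bij_betw[OF bij, symmetric])

lemma sum_ix_diff:
  assumes "i < CARD('d)"
  shows "(\<Sum>a\<in>UNIV - {ix i}. g a) = (\<Sum>j\<in>{..<CARD('d)} - {i}. g (ix j))"
proof -
  have "bij_betw ix ({..<CARD('d)} - {i}) (UNIV - {ix i})"
    using bij assms by (intro bij_betw_DiffI) (auto simp: bij_betw_def)
  then show ?thesis by (rule sum.reindex_bij_betw[symmetric])
qed

lemma wsum_monomial:
  assumes "\<And>i. i < CARD('d) \<Longrightarrow> 0 \<le> x i"
  shows "wsum n (scaling x) f = (\<Sum>p\<in>balanced n. f (fst p) *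
    (diag_moment (count_list (fst p)) * monomial CARD('d) x (\<lambda>i. count_list (fst p) (ix i))))"
proof -
  have "(\<Prod>a\<in>UNIV. ((scaling x a)\<^sup>2) ^ l a) = monomial CARD('d) x (\<lambda>i. l (ix i))" for l :: "'d \<Rightarrow> nat"
  proof -
    have "(\<Prod>a\<in>UNIV. ((scaling x a)\<^sup>2) ^ l a) = (\<Prod>i<CARD('d). ((scaling x (ix i))\<^sup>2) ^ l (ix i))"
      by (rule prod.reindex_bij_betw[OF bij, symmetric])
    also have "\<dots> = (\<Prod>i<CARD('d). x i ^ l (ix i))"
      by (intro prod.cong refl) (simp add: scaling_square[OF assms] pos_ix)
    finally show ?thesis by (simp add: monomial_def)
  qed
  then show ?thesis
    unfolding wsum_def by (simp add: case_prod_unfold)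
qed

text \<open>The monomials are indexed by balanced pairs of words, with the letter counts of the
  first word as exponents; this makes \<open>radial_equation\<close> an instance of the abstract
  hypothesis.\<close>

lemma moment_schur_expansion:
  assumes x: "\<And>i. i < CARD('d) \<Longrightarrow> 0 < x i"
  shows "vandermonde CARD('d) x * moment n (scaling x) =
    (\<Sum>\<nu>\<in>row_functions CARD('d) n. schur_weight CARD('d) n \<nu> *
      alternant CARD('d) (\<lambda>i k. x i ^ k) (shifted CARD('d) \<nu>))"
proof (rule radial_solution[where G="\<lambda>n x. moment n (scaling x)" and P=balanced
      and e="\<lambda>p. diag_moment (count_list (fst p))" and \<alpha>="\<lambda>p i. count_list (fst p) (ix i)"])
  let ?d = "CARD('d)"
  show "finite (balanced n :: ('d list \<times> 'd list) set)" for n by simp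
  show "moment n (scaling x) = (\<Sum>p\<in>balanced n. diag_moment (count_list (fst p)) *
      monomial ?d x (\<lambda>i. count_list (fst p) (ix i)))" if "\<And>i. i < ?d \<Longrightarrow> 0 < x i" for n x
    unfolding moment_expansion by (subst wsum_monomial) (auto intro: less_imp_le that)
  show "(\<Sum>i<?d. count_list (fst p) (ix i)) = n" if "p \<in> balanced n" for n and p :: "'d list \<times> 'd list"
    using that sum_count_list_UNIV[of "fst p"]
    by (auto simp: balanced_def words_def simp flip: sum_ix[of "count_list (fst p)"])
  show "moment 0 (scaling x) = 1" for x by (simp add: moment_def prob_space)
  show "moment n (scaling (\<lambda>i. x (Transposition.transpose a b i))) = moment n (scaling x)"
    if "a < ?d" "b < ?d" for n x a b
  proof -
    have "pos (Transposition.transpose (ix a) (ix b) c) = Transposition.transpose a b (pos c)" for c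
      using pos_ix[OF that(1)] pos_ix[OF that(2)] ix_pos[of c]
      by (auto simp: Transposition.transpose_def)
    then have "scaling (\<lambda>i. x (Transposition.transpose a b i)) = scaling x \<circ> Transposition.transpose (ix a) (ix b)"
      by (simp add: scaling_def fun_eq_iff)
    then show ?thesis by (simp only: moment_transpose)
  qed
  show "(real (Suc m))\<^sup>2 * (\<Sum>i<?d. x i) * moment m (scaling x) =
      (\<Sum>i<?d. E (\<lambda>p. (real (count_list (fst p) (ix i)))\<^sup>2)) +
      (\<Sum>i<?d. \<Sum>j\<in>{..<?d} - {i}. x i * (E (\<lambda>p. real (count_list (fst p) (ix i)))
        - E (\<lambda>p. real (count_list (fst p) (ix j)))) / (x i - x j))"
    if x: "\<And>i. i < ?d \<Longrightarrow> 0 < x i" and inj: "inj_on x {..<?d}"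
      and E: "E = (\<lambda>f. \<Sum>p\<in>balanced (Suc m). f p * (diag_moment (count_list (fst p)) *
        monomial ?d x (\<lambda>i. count_list (fst p) (ix i))))" for m x E
  proof -
    have nonneg: "\<And>i. i < ?d \<Longrightarrow> 0 \<le> x i" using x by (simp add: less_imp_le)
    have sq: "(scaling x (ix i))\<^sup>2 = x i" if "i < ?d" for i
      using scaling_square[of x "ix i"] nonneg pos_ix[OF that] by simp
    have EW: "wsum (Suc m) (scaling x) f = E (\<lambda>p. f (fst p))" for f
      unfolding E by (rule wsum_monomial) (rule nonneg)
    have distinct: "(scaling x a)\<^sup>2 \<noteq> (scaling x b)\<^sup>2" if "a \<noteq> b" for a b
    proof
      assume "(scaling x a)\<^sup>2 = (scaling x b)\<^sup>2"
      then have "x (pos a) = x (pos b)"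
        using scaling_square[of x a] scaling_square[of x b] nonneg by simp
      then have "pos a = pos b" using inj pos_less by (auto dest: inj_onD)
      then show False using that ix_pos by metis
    qed
    have squares: "(\<Sum>i<?d. (scaling x (ix i))\<^sup>2) = (\<Sum>i<?d. x i)"
      by (intro sum.cong refl) (simp add: sq)
    have differences: "(\<Sum>i<?d. \<Sum>a\<in>UNIV - {ix i}. (scaling x (ix i))\<^sup>2 * (E (\<lambda>p. real (count_list (fst p) (ix i)))
        - E (\<lambda>p. real (count_list (fst p) a))) / ((scaling x (ix i))\<^sup>2 - (scaling x a)\<^sup>2)) =
      (\<Sum>i<?d. \<Sum>j\<in>{..<?d} - {i}. x i * (E (\<lambda>p. real (count_list (fst p) (ix i)))
        - E (\<lambda>p. real (count_list (fst p) (ix j)))) / (x i - x j))"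
      by (intro sum.cong refl, subst sum_ix_diff, simp, intro sum.cong refl, simp add: sq)
    show ?thesis
      using radial_equation[where t="scaling x" and m=m, OF distinct]
      unfolding EW sum_ix squares differences by simp
  qed
qed (use x in auto)

lemma moment_schur_sum:
  assumes x: "\<And>i. i < CARD('d) \<Longrightarrow> 0 < x i" and inj: "inj_on x {..<CARD('d)}"
  shows "moment n (scaling x) =
    (\<Sum>\<nu>\<in>row_functions CARD('d) n. schur_weight CARD('d) n \<nu> * gt_sum CARD('d) x \<nu>)"
proof -
  have "vandermonde CARD('d) x * moment n (scaling x) = vandermonde CARD('d) x *
    (\<Sum>\<nu>\<in>row_functions CARD('d) n. schur_weight CARD('d) n \<nu> * gt_sum CARD('d) x \<nu>)"
    unfolding moment_schur_expansion[of x, OF x, simplified] sum_distrib_left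
    by (intro sum.cong refl) (simp add: alternant_power x row_functions_def)
  then show ?thesis using vandermonde_nonzero[OF inj] by simp
qed

text \<open>At k ones and d - k zeros the Vandermonde product may vanish, so the expansion is
  carried there by continuity from distinct positive points.\<close>

lemma moment_corner:
  assumes k: "k \<le> CARD('d)"
  shows "moment n (\<lambda>a. if pos a < CARD('d) - k then 0 else 1) =
    (\<Sum>\<nu>\<in>row_functions k n. schur_weight CARD('d) n \<nu> * gt_sum k (\<lambda>_. 1) \<nu>)"
proof -
  let ?d = "CARD('d)"
  define y where "y = (\<lambda>i. if i < ?d - k then 0 else 1 :: real)"
  \<comment> \<open>Adding multiples of \<epsilon> that grow with i to the weakly increasing
    \<open>y\<close> makes the values positive and strictly increasing.\<close>
  define x where "x \<epsilon> i = y i + \<epsilon> * real (Suc i)" for \<epsilon> i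
  have lim: "((\<lambda>\<epsilon>. x \<epsilon> i) \<longlongrightarrow> y i) (at_right 0)" for i
    unfolding x_def by (auto intro!: tendsto_eq_intros)
  have x_pos: "x \<epsilon> i > 0" if "\<epsilon> > 0" for \<epsilon> i
    using that by (simp add: x_def y_def add_nonneg_pos)
  have x_mono: "x \<epsilon> i < x \<epsilon> j" if "\<epsilon> > 0" "i < j" for \<epsilon> i j
  proof -
    have "\<epsilon> * real (Suc i) < \<epsilon> * real (Suc j)" using that by simp
    moreover have "y i \<le> y j" using that by (auto simp: y_def)
    ultimately show ?thesis unfolding x_def by linarith
  qed
  have x_inj: "inj_on (x \<epsilon>) S" if "\<epsilon> > 0" for \<epsilon> S
    using x_mono[OF that] by (metis inj_onI less_irrefl linorder_neqE_nat)
  \<comment> \<open>The moment involves square roots of x; its expansion \<open>R\<close> is a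
    polynomial in x, so its limit is immediate.\<close>
  define R where "R z = (\<Sum>p\<in>balanced n. 1 * (diag_moment (count_list (fst p)) *
    monomial ?d z (\<lambda>i. count_list (fst p) (ix i))))" for z
  have R: "moment n (scaling z) = R z" if "\<And>i. i < ?d \<Longrightarrow> 0 \<le> z i" for z
    unfolding moment_expansion R_def by (rule wsum_monomial) (rule that)
  have left: "((\<lambda>\<epsilon>. R (x \<epsilon>)) \<longlongrightarrow> R y) (at_right 0)"
    unfolding R_def by (intro tendsto_intros tendsto_monomial lim)
  have right: "((\<lambda>\<epsilon>. \<Sum>\<nu>\<in>row_functions ?d n. schur_weight ?d n \<nu> * gt_sum ?d (x \<epsilon>) \<nu>) \<longlongrightarrow>
      (\<Sum>\<nu>\<in>row_functions ?d n. schur_weight ?d n \<nu> * gt_sum ?d y \<nu>)) (at_right 0)"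
    by (intro tendsto_intros tendsto_gt_sum lim)
  have "\<forall>\<^sub>F \<epsilon> in at_right 0. R (x \<epsilon>) =
      (\<Sum>\<nu>\<in>row_functions ?d n. schur_weight ?d n \<nu> * gt_sum ?d (x \<epsilon>) \<nu>)"
    unfolding eventually_at_right_field
  proof (intro exI[of _ 1] conjI allI impI)
    fix \<epsilon> :: real assume "0 < \<epsilon>"
    then show "R (x \<epsilon>) = (\<Sum>\<nu>\<in>row_functions ?d n. schur_weight ?d n \<nu> * gt_sum ?d (x \<epsilon>) \<nu>)"
      using R[of "x \<epsilon>"] moment_schur_sum[of "x \<epsilon>" n] x_pos x_inj by (simp add: less_imp_le)
  qed simp
  from tendsto_cong[OF this] right
  have "((\<lambda>\<epsilon>. R (x \<epsilon>)) \<longlongrightarrow> (\<Sum>\<nu>\<in>row_functions ?d n. schur_weight ?d n \<nu> * gt_sum ?d y \<nu>)) (at_right 0)"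
    by (rule iffD2)
  then have "R y = (\<Sum>\<nu>\<in>row_functions ?d n. schur_weight ?d n \<nu> * gt_sum ?d y \<nu>)"
    by (rule tendsto_unique[OF trivial_limit_at_right_real left])
  also have "\<dots> = (\<Sum>\<nu>\<in>row_functions ?d n. if \<forall>i\<ge>k. \<nu> i = 0
      then schur_weight ?d n \<nu> * gt_sum k (\<lambda>_. 1) \<nu> else 0)"
  proof (intro sum.cong refl)
    fix \<nu> assume "\<nu> \<in> row_functions ?d n"
    then show "schur_weight ?d n \<nu> * gt_sum ?d y \<nu> =
        (if \<forall>i\<ge>k. \<nu> i = 0 then schur_weight ?d n \<nu> * gt_sum k (\<lambda>_. 1) \<nu> else 0)"
      using gt_sum_corner[of \<nu> "?d - k" k] k by (auto simp: y_def row_functions_def)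
  qed
  also have "\<dots> = (\<Sum>\<nu>\<in>row_functions k n. schur_weight ?d n \<nu> * gt_sum k (\<lambda>_. 1) \<nu>)"
  proof -
    have "(\<Sum>i<?d. \<nu> i) = (\<Sum>i<k. \<nu> i)" if "\<forall>i\<ge>k. \<nu> i = 0" for \<nu> :: "nat \<Rightarrow> nat"
      using that k by (intro sum.mono_neutral_right) auto
    then have "row_functions k n = {\<nu> \<in> row_functions ?d n. \<forall>i\<ge>k. \<nu> i = 0}"
      using k by (auto simp: row_functions_def)
    then show ?thesis by (simp add: sum.inter_filter)
  qed
  also have "R y = moment n (scaling y)" by (rule R[symmetric]) (simp add: y_def)
  also have "scaling y = (\<lambda>a. if pos a < ?d - k then 0 else 1)"
    by (auto simp: scaling_def y_def fun_eq_iff)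
  finally show ?thesis .
qed

end

end

section \<open>The upper left corner\<close>

lemma bij_index_at: "bij_betw (index_at :: nat \<Rightarrow> 'a::{finite,linorder}) {..<CARD('a)} UNIV"
proof -
  have inj: "inj_on (index_at :: nat \<Rightarrow> 'a) {..<CARD('a)}"
    by (rule inj_on_inverseI[where g=index_pos]) (simp add: index_pos_index_at)
  then have "card ((index_at :: nat \<Rightarrow> 'a) ` {..<CARD('a)}) = CARD('a)"
    by (simp add: card_image)
  then have "(index_at :: nat \<Rightarrow> 'a) ` {..<CARD('a)} = UNIV"
    by (intro card_subset_eq) auto
  then show ?thesis using inj by (simp add: bij_betw_def)
qed

lemma trace_upper_left_corner:
  fixes U :: "complex^'d::{finite,linorder}^'d::{finite,linorder}"
  assumes "CARD('k::{finite,linorder}) \<le> CARD('d)"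
  shows "trace (upper_left_corner U :: complex^'k::{finite,linorder}^'k::{finite,linorder}) =
    dtrace (\<lambda>a. if index_pos a < CARD('k) then 1 else 0) U"
proof -
  have "trace (upper_left_corner U :: complex^'k::{finite,linorder}^'k::{finite,linorder}) =
      (\<Sum>i\<in>(UNIV :: 'k::{finite,linorder} set). U $ index_at (index_pos i) $ index_at (index_pos i))"
    by (simp add: trace_def upper_left_corner_def)
  also have "\<dots> = (\<Sum>p<CARD('k). U $ index_at p $ index_at p)"
    by (subst sum.reindex_bij_betw[OF bij_index_at, symmetric])
       (auto simp: index_pos_index_at intro!: sum.cong)
  also have "\<dots> = (\<Sum>p<CARD('d). if p < CARD('k) then U $ index_at p $ index_at p else 0)"
    using assms by (intro sum.mono_neutral_cong_left) auto
  also have "\<dots> = (\<Sum>a\<in>UNIV. if index_pos a < CARD('k) then U $ a $ a else 0)"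
    by (subst sum.reindex_bij_betw[OF bij_index_at, symmetric])
       (auto simp: index_pos_index_at intro!: sum.cong)
  also have "\<dots> = dtrace (\<lambda>a. if index_pos a < CARD('k) then 1 else 0) U"
    unfolding dtrace_def by (intro sum.cong) auto
  finally show ?thesis .
qed

theorem theorem1:
  fixes d k n :: nat
    and M :: "(complex^'d::{finite,linorder}^'d::{finite,linorder}) measure"
  assumes "CARD('d) = d" and "CARD('k::{finite,linorder}) = k"
    and "1 \<le> k" and "k \<le> d" and "1 \<le> n"
    and "normalized_haar_measure M"
  shows "prob_space.expectation M
           (\<lambda>U. cmod (trace (upper_left_corner U :: complex^'k::{finite,linorder}^'k::{finite,linorder})) ^ (2 * n)) =
         (\<Sum>\<nu> \<in> {\<nu> \<in> partitions n. length \<nu> \<le> k}.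
            (real (num_SYT \<nu>))\<^sup>2 * (real (num_SSYT \<nu> k) / real (num_SSYT \<nu> d)))"
proof -
  interpret haar M using assms(6) by (rule haar.intro)
  \<comment> \<open>Order-reversing, because \<open>moment_corner\<close> puts the d - k zeros at
    the first positions while the corner consists of the first k indices.\<close>
  let ?ix = "\<lambda>i. index_at (d - Suc i) :: 'd"
  have "bij_betw (\<lambda>i. d - Suc i) {..<d} {..<d}"
    by (rule bij_betwI[where g="\<lambda>i. d - Suc i"]) auto
  from bij_betw_trans[OF this bij_index_at[where 'a='d, unfolded assms(1)]]
  have bij: "bij_betw ?ix {..<CARD('d)} UNIV" by (simp add: comp_def assms(1))
  have ind: "(if pos ?ix a < CARD('d) - k then 0 else 1) = (if index_pos a < k then 1 else 0 :: real)" for a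
  proof -
    have "index_pos (?ix (pos ?ix a)) = d - Suc (pos ?ix a)"
      using pos_less[OF bij, of a] assms(1) by (intro index_pos_index_at) auto
    then have "index_pos a = d - Suc (pos ?ix a)" by (simp only: ix_pos[OF bij])
    then show ?thesis using pos_less[OF bij, of a] assms(1,4) by auto
  qed
  have "prob_space.expectation M (\<lambda>U. cmod (trace (upper_left_corner U :: complex^'k::{finite,linorder}^'k::{finite,linorder})) ^ (2 * n)) =
      moment n (\<lambda>a. if pos ?ix a < CARD('d) - k then 0 else 1)"
    using assms(1,2,4) unfolding moment_def ind by (simp add: trace_upper_left_corner)
  also have "\<dots> = (\<Sum>\<nu>\<in>row_functions k n. schur_weight d n \<nu> * gt_sum k (\<lambda>_. 1) \<nu>)"
    using moment_corner[OF bij, of k n] assms(1,4) by simp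
  also have "\<dots> = (\<Sum>\<nu> | \<nu> \<in> partitions n \<and> length \<nu> \<le> k.
      schur_weight d n (shape \<nu>) * gt_sum k (\<lambda>_. 1) (shape \<nu>))"
    by (rule sum.reindex_bij_betw[OF shape_bij, symmetric])
  also have "\<dots> = (\<Sum>\<nu> | \<nu> \<in> partitions n \<and> length \<nu> \<le> k.
      (real (num_SYT \<nu>))\<^sup>2 * (real (num_SSYT \<nu> k) / real (num_SSYT \<nu> d)))"
  proof (intro sum.cong refl)
    fix \<nu> assume "\<nu> \<in> {\<nu>. \<nu> \<in> partitions n \<and> length \<nu> \<le> k}"
    then have \<nu>: "\<nu> \<in> partitions n" "length \<nu> \<le> k" "length \<nu> \<le> d" using assms(4) by auto
    then have "decseq (shape \<nu>)"
      using bij_betw_apply[OF shape_bij[of n k], of \<nu>] by (simp add: row_functions_def)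
    then show "schur_weight d n (shape \<nu>) * gt_sum k (\<lambda>_. 1) (shape \<nu>) =
        (real (num_SYT \<nu>))\<^sup>2 * (real (num_SSYT \<nu> k) / real (num_SSYT \<nu> d))"
      by (simp add: num_SYT_eq[OF \<nu>(1,3)] num_SSYT_eq[OF \<nu>(1,2)] num_SSYT_eq[OF \<nu>(1,3)] schur_weight_eq)
  qed
  finally show ?thesis .
qed

end
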